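(* Let $S$ be a compact simplicial surface without boundary in $\mathbb{R}^3$, and let $W(S)$ be its discrete Willmore energy. Then $$W(S)\ge 0,$$ and equality holds if and only if $S$ is a convex polyhedron inscribed in a sphere, i.e. a Delaunay triangulation of a sphere.
   Context: A simplicial surface $S$ in $\mathbb{R}^3$ has vertex set $V$, edge set $E$ and (triangular) face set $F$. Each edge $e$ is incident to two triangles. A consistent orientation of the two triangles induces an orientation of their circumcircles; $\beta(e)\in[0,\pi]$ denotes the external intersection angle of the circumcircles of the two triangles sharing $e$, i.e. the angle between the tangent vectors of the oriented circumcircles at either intersection point. The local discrete Willmore energy at a vertex $v$ is $W(v)=\sum_{e\ni v}\beta(e)-2\pi$ (sum over all edges incident to $v$), and the discrete Willmore energy of a compact simplicial surface without boundary is $$W(S)=\frac12\sum_{v\in V}W(v)=\sum_{e\in E}\beta(e)-\pi|V|,$$ where $|V|$ is the number of vertices. In the convex polyhedron, adjacent triangles are allowed to lie in a common plane (so the triangulation may subdivide larger circular faces); inscribed in a sphere means that all vertices lie on a common sphere. *)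

theory Defs
  imports "HOL-Analysis.Analysis"
begin

text \<open>
  A simplicial surface in 3-space is a geometric simplicial complex
  (\<^const>\<open>simplicial_complex\<close>: finite, closed under faces, with simplices meeting in common
  faces), so all triangles are nondegenerate and the surface is embedded.
  Simplices are point sets, and the empty simplex is one of them.
\<close>

definition verts :: "(real^3) set set \<Rightarrow> (real^3) set"
  where "verts K = {v. {v} \<in> K}"

definition edges :: "(real^3) set set \<Rightarrow> (real^3) set set"
  where "edges K = {e \<in> K. 1 simplex e}"

definition faces :: "(real^3) set set \<Rightarrow> (real^3) set set"
  where "faces K = {t \<in> K. 2 simplex t}"

definition adjacent_at :: "(real^3) set set \<Rightarrow> real^3 \<Rightarrow> ((real^3) set \<times> (real^3) set) set"
  where "adjacent_at K v =
    {(s, t). s \<in> faces K \<and> t \<in> faces K \<and> v \<in> s \<and> v \<in> t \<and> s \<inter> t \<in> edges K}"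

text \<open>
  Compact connected surface without boundary: the complex is nonempty and purely
  two-dimensional, every edge lies in exactly two triangles (no boundary), and the triangles at
  each vertex form a single cycle (as every edge lies in two triangles, it is enough that they can
  be joined through common edges at that vertex).  Compactness is finiteness of the complex.
\<close>

definition closed_simplicial_surface :: "(real^3) set set \<Rightarrow> bool"
  where "closed_simplicial_surface K \<longleftrightarrow>
    simplicial_complex K \<and> K \<noteq> {} \<and>
    (\<forall>s\<in>K. \<exists>t\<in>faces K. s \<subseteq> t) \<and>
    (\<forall>e\<in>edges K. card {t \<in> faces K. e \<subseteq> t} = 2) \<and>
    (\<forall>v\<in>verts K. \<forall>s\<in>faces K. \<forall>t\<in>faces K. v \<in> s \<and> v \<in> t \<longrightarrow> (s, t) \<in> (adjacent_at K v)\<^sup>*) \<and>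
    connected (\<Union>K)"

definition circumcenter :: "real^3 \<Rightarrow> real^3 \<Rightarrow> real^3 \<Rightarrow> real^3"
  where "circumcenter a b c =
    (THE m. m \<in> affine hull {a, b, c} \<and> dist m a = dist m b \<and> dist m a = dist m c)"

text \<open>
  Tangent vector at \<open>p\<close> of the circumcircle of the triangle \<open>a b c\<close>, oriented by
  \<open>a \<rightarrow> b \<rightarrow> c\<close>: the velocity of the rotation about the centre with axis the oriented normal.
\<close>

definition circumcircle_tangent :: "real^3 \<Rightarrow> real^3 \<Rightarrow> real^3 \<Rightarrow> real^3 \<Rightarrow> real^3"
  where "circumcircle_tangent a b c p =
    cross3 (cross3 (b - a) (c - a)) (p - circumcenter a b c)"

definition vector_angle :: "'a::real_inner \<Rightarrow> 'a \<Rightarrow> real"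
  where "vector_angle u w = arccos ((u \<bullet> w) / (norm u * norm w))"

text \<open>
  The triangles \<open>x y z\<close> and \<open>y x w\<close> run through their common edge in opposite directions, which is
  what it means for them to be consistently oriented.  Interchanging \<open>z\<close> and \<open>w\<close> reverses both
  circles, and interchanging \<open>x\<close> and \<open>y\<close> passes to the other intersection point; neither changes
  the angle, so \<open>beta\<close> does not depend on the labelling.
\<close>

definition beta :: "(real^3) set set \<Rightarrow> (real^3) set \<Rightarrow> real"
  where "beta K e = (THE \<beta>. \<exists>x y z w.
    e = convex hull {x, y} \<and> z \<noteq> w \<and>
    convex hull {x, y, z} \<in> faces K \<and> convex hull {y, x, w} \<in> faces K \<and>
    \<beta> = vector_angle (circumcircle_tangent x y z x) (circumcircle_tangent y x w x))"

definition willmore_at :: "(real^3) set set \<Rightarrow> real^3 \<Rightarrow> real"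
  where "willmore_at K v = (\<Sum>e | e \<in> edges K \<and> v \<in> e. beta K e) - 2 * pi"

definition willmore :: "(real^3) set set \<Rightarrow> real"
  where "willmore K = 1/2 * (\<Sum>v\<in>verts K. willmore_at K v)"

lemma finite_verts: "simplicial_complex K \<Longrightarrow> finite (verts K)"
proof -
  assume "simplicial_complex K"
  then have "finite K" by (simp add: simplicial_complex_def)
  then have "finite ((\<lambda>v. {v}) -` K)"
    by (rule finite_vimageI) simp
  then show ?thesis by (simp add: verts_def vimage_def)
qed

lemma card_verts_edge:
  assumes K: "simplicial_complex K" and e: "e \<in> edges K"
  shows "card {v \<in> verts K. v \<in> e} = 2"
proof -
  from e have eK: "e \<in> K" and "1 simplex e" by (auto simp: edges_def)
  then obtain C where C: "\<not> affine_dependent C" "int (card C) = 1 + 1" "e = convex hull C"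
    by (auto simp: simplex_def)
  have "{v \<in> verts K. v \<in> e} = C"
  proof (intro set_eqI iffI)
    fix v assume "v \<in> {v \<in> verts K. v \<in> e}"
    then have v: "{v} \<in> K" "v \<in> e" by (auto simp: verts_def)
    then have "{v} \<inter> e face_of e"
      using K eK unfolding simplicial_complex_def by (metis inf_commute)
    then have "v extreme_point_of (convex hull C)"
      using v C(3) by (simp add: face_of_singleton)
    then show "v \<in> C" by (rule extreme_point_of_convex_hull)
  next
    fix v assume "v \<in> C"
    then have "v extreme_point_of e"
      using C by (simp add: extreme_point_of_convex_hull_affine_independent)
    then have "{v} face_of e" by (simp add: face_of_singleton)
    then show "v \<in> {v \<in> verts K. v \<in> e}"
      using K eK \<open>v \<in> C\<close> C(3) unfolding simplicial_complex_def verts_def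
      by (auto intro: hull_inc)
  qed
  then show ?thesis using C(2) by simp
qed

lemma willmore_eq_sum_edges:
  assumes K: "simplicial_complex K"
  shows "willmore K = (\<Sum>e\<in>edges K. beta K e) - pi * card (verts K)"
proof -
  have fE: "finite (edges K)"
    using K by (simp add: simplicial_complex_def edges_def)
  have "(\<Sum>v\<in>verts K. \<Sum>e | e \<in> edges K \<and> v \<in> e. beta K e)
      = (\<Sum>e\<in>edges K. \<Sum>v | v \<in> verts K \<and> v \<in> e. beta K e)"
    using finite_verts[OF K] fE by (rule sum.swap_restrict)
  also have "\<dots> = (\<Sum>e\<in>edges K. 2 * beta K e)"
    using card_verts_edge[OF K] by (intro sum.cong) auto
  finally show ?thesis
    by (simp add: willmore_def willmore_at_def sum_subtractf sum_distrib_left[symmetric]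
        right_diff_distrib)
qed

text \<open>
  The surface is the boundary of a convex polyhedron.  Vertices and faces of the polyhedron are not
  compared with those of the complex, so the triangulation may subdivide larger planar faces.
\<close>

definition convex_polyhedral_surface :: "(real^3) set set \<Rightarrow> bool"
  where "convex_polyhedral_surface K \<longleftrightarrow>
    (\<exists>P. polytope P \<and> interior P \<noteq> {} \<and> \<Union>K = frontier P)"

definition inscribed_in_sphere :: "(real^3) set set \<Rightarrow> bool"
  where "inscribed_in_sphere K \<longleftrightarrow> (\<exists>c r. 0 < r \<and> verts K \<subseteq> sphere c r)"

text \<open>
  Delaunay triangulation of a sphere: the complex triangulates a topological sphere, its vertices
  lie on a round sphere, and the circumcircle of each triangle (the intersection of the
  round sphere with the plane of the triangle) bounds an open spherical cap that contains no
  vertex.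
\<close>

definition delaunay_triangulation_of_sphere :: "(real^3) set set \<Rightarrow> bool"
  where "delaunay_triangulation_of_sphere K \<longleftrightarrow>
    (\<exists>c r. 0 < r \<and> \<Union>K homeomorphic sphere c r \<and> verts K \<subseteq> sphere c r \<and>
      (\<forall>t\<in>faces K. \<exists>a b. a \<noteq> 0 \<and> t \<subseteq> {x. a \<bullet> x = b} \<and>
        verts K \<inter> {x \<in> sphere c r. b < a \<bullet> x} = {}))"

end

theory Submission
  imports Defs "HOL-Library.Sublist"
begin

text \<open>
  Inversion at a vertex \<open>v\<close> sends the circumcircles of the triangles at \<open>v\<close> to the side lines of a
  closed polygon, the inverted link of \<open>v\<close>, and \<open>\<beta>\<close> of an edge at \<open>v\<close> to the exterior angle at
  the image of its other end.  So \<open>W(v) \<ge> 0\<close> is Fenchel's inequality for that polygon, proved by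
  cutting off one vertex at a time.  Equality passes to all subpolygons, hence to all
  quadrilaterals, and for these it says that the two diagonals meet.

  If \<open>W(S) = 0\<close>, every inverted link has this property, so no plane separates it into more than two
  arcs.  For a function \<open>\<alpha> |x|\<^sup>2 + u \<bullet> x\<close> this means that the part of the link of \<open>v\<close> above the
  level of \<open>v\<close> is connected: the function has no saddles, and a local maximum on the vertices is a
  global one.  Each inverted link is planar, which gives such a function that is constant on a vertex
  star; perturbed by \<open>\<plusminus>\<epsilon> |x - v|\<^sup>2\<close> it has a strict local maximum or minimum at \<open>v\<close>, so it is
  constant on all vertices, and these lie on a sphere.  The same argument with linear functions
  shows that the plane of each triangle supports the set of vertices.

  Conversely, supporting planes make the sides of each inverted link lie on the boundary of its
  convex hull, so a line cannot cross three of them, and the diagonals of its quadrilaterals meet.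
  Seen from an interior point of the convex hull of the vertices, the triangles cover all directions,
  so the surface is the whole boundary.
\<close>

subsection \<open>Angles\<close>

text \<open>The obstacle is that the energy condition is local, one polygon per vertex, while the
  conclusion is global and the genus of the surface is not given. Convexity of a polygon is
  therefore not expressed by a plane or a region but by \<open>diagonals_meet\<close>, a condition
  on four vertices in cyclic order. It is exactly the equality case of the angle sum, it passes to
  subsequences, and it permits flat angles, which arise from adjacent triangles with a common
  circumcircle. The passage from local to global is a discrete Morse argument: if upper links are
  connected, removing vertices from the lowest upwards never disconnects the rest, whereas a local
  maximum below the top would end up isolated. This needs distinct values at the vertices, so
  besides the quadratic perturbation, which turns weak maxima into strict ones, a small generic
  linear term is added. Embeddedness enters metrically because triangles meet only in common faces:
  a closed surface cannot be flat, an inverted link does not cross itself, and adjacent triangles do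
  not overlap as seen from an interior point.\<close>

lemma cos_quotient_bounds:
  fixes u w :: "'a::real_inner"
  shows "- 1 \<le> (u \<bullet> w) / (norm u * norm w)" "(u \<bullet> w) / (norm u * norm w) \<le> 1"
proof -
  have "\<bar>(u \<bullet> w) / (norm u * norm w)\<bar> \<le> 1"
    using Cauchy_Schwarz_ineq2[of u w]
    by (cases "u = 0 \<or> w = 0") (auto simp: abs_mult divide_le_eq_1)
  then show "- 1 \<le> (u \<bullet> w) / (norm u * norm w)" "(u \<bullet> w) / (norm u * norm w) \<le> 1"
    unfolding abs_le_iff
    by auto
qed

lemma vector_angle_bounds: "0 \<le> vector_angle u w" "vector_angle u w \<le> pi"
  unfolding vector_angle_def by (auto intro: arccos_lbound arccos_ubound cos_quotient_bounds)

lemma cos_vector_angle: "cos (vector_angle u w) = (u \<bullet> w) / (norm u * norm w)"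
  unfolding vector_angle_def by (rule cos_arccos[OF cos_quotient_bounds])

lemma vector_angle_commute: "vector_angle u w = vector_angle w u"
  unfolding vector_angle_def by (simp add: inner_commute mult.commute)

lemma vector_angle_scale_left: "0 < s \<Longrightarrow> vector_angle (s *\<^sub>R u) w = vector_angle u w"
  unfolding vector_angle_def
  by (simp only: inner_scaleR_left norm_scaleR abs_of_pos mult.assoc mult_divide_mult_cancel_left)

lemma vector_angle_scale_right: "0 < s \<Longrightarrow> vector_angle u (s *\<^sub>R w) = vector_angle u w"
  by (metis vector_angle_commute vector_angle_scale_left)

lemma vector_angle_minus_left: "vector_angle (- u) w = pi - vector_angle u w"
  unfolding vector_angle_def using cos_quotient_bounds[of u w] by (simp add: arccos_minus)

lemma vector_angle_minus_right: "vector_angle u (- w) = pi - vector_angle u w"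
  by (metis vector_angle_commute vector_angle_minus_left)

lemma vector_angle_sgn: "vector_angle (sgn u) (sgn w) = vector_angle u w"
proof (cases "u = 0 \<or> w = 0")
  case False
  then show ?thesis
    by (simp add: sgn_div_norm vector_angle_scale_left vector_angle_scale_right)
qed (auto simp: vector_angle_def)

lemma vector_angle_self: "u \<noteq> 0 \<Longrightarrow> vector_angle u u = 0"
  by (simp add: vector_angle_def dot_square_norm power2_eq_square)

text \<open>The spherical law of cosines. \<open>a'\<close> and \<open>c'\<close> are the components
  orthogonal to \<open>b\<close>, and the last two terms are arranged for Cauchy-Schwarz: together
  they are at most 0, and they vanish exactly when \<open>a'\<close> and \<open>c'\<close> have
  opposite directions or one of them is 0.\<close>

lemma cos_add_vector_angle:
  fixes a b c :: "'a::real_inner"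
  assumes "norm a = 1" "norm b = 1" "norm c = 1"
  defines "a' \<equiv> a - (a \<bullet> b) *\<^sub>R b" and "c' \<equiv> c - (b \<bullet> c) *\<^sub>R b"
  shows "sin (vector_angle a b) = norm a'" "sin (vector_angle b c) = norm c'"
    "cos (vector_angle a b + vector_angle b c) = (a \<bullet> c) - (a' \<bullet> c') - norm a' * norm c'"
proof -
  have bb: "b \<bullet> b = 1" "a \<bullet> a = 1" "c \<bullet> c = 1"
    using assms by (auto simp: dot_square_norm)
  have n1: "(norm a')\<^sup>2 = 1 - (a \<bullet> b)\<^sup>2"
    unfolding a'_def power2_norm_eq_inner
    by (simp add: inner_diff inner_commute bb power2_eq_square algebra_simps)
  have n2: "(norm c')\<^sup>2 = 1 - (b \<bullet> c)\<^sup>2"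
    unfolding c'_def power2_norm_eq_inner
    by (simp add: inner_diff inner_commute bb power2_eq_square algebra_simps)
  have "(sin (vector_angle a b))\<^sup>2 = (norm a')\<^sup>2" "(sin (vector_angle b c))\<^sup>2 = (norm c')\<^sup>2"
    by (simp_all add: sin_squared_eq cos_vector_angle assms(1-3) n1 n2)
  then show s: "sin (vector_angle a b) = norm a'" "sin (vector_angle b c) = norm c'"
    by (auto intro!: power2_eq_imp_eq sin_ge_zero vector_angle_bounds)
  have "a' \<bullet> c' = a \<bullet> c - (a \<bullet> b) * (b \<bullet> c)"
    unfolding a'_def c'_def by (simp add: inner_diff inner_commute bb algebra_simps)
  then show "cos (vector_angle a b + vector_angle b c) = (a \<bullet> c) - (a' \<bullet> c') - norm a' * norm c'"
    by (simp add: cos_add s cos_vector_angle assms(1-3))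
qed

lemma vector_angle_triangle_unit:
  fixes a b c :: "'a::real_inner"
  assumes u: "norm a = 1" "norm b = 1" "norm c = 1"
  shows "vector_angle a c \<le> vector_angle a b + vector_angle b c"
proof (cases "vector_angle a b + vector_angle b c \<le> pi")
  case True
  let ?a = "a - (a \<bullet> b) *\<^sub>R b" and ?c = "c - (b \<bullet> c) *\<^sub>R b"
  have "- (?a \<bullet> ?c) \<le> norm ?a * norm ?c"
    using Cauchy_Schwarz_ineq2[of ?a ?c] by linarith
  then have "cos (vector_angle a b + vector_angle b c) \<le> cos (vector_angle a c)"
    using cos_add_vector_angle(3)[OF u] u by (simp add: cos_vector_angle)
  then show ?thesis
    using True vector_angle_bounds by (metis add_nonneg_nonneg cos_mono_le_eq)
next
  case False
  then show ?thesis using vector_angle_bounds(2)[of a c] by linarith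
qed

lemma vector_angle_triangle:
  fixes a b c :: "'a::real_inner"
  assumes "a \<noteq> 0" "b \<noteq> 0" "c \<noteq> 0"
  shows "vector_angle a c \<le> vector_angle a b + vector_angle b c"
  using vector_angle_triangle_unit[of "sgn a" "sgn b" "sgn c"] assms
  by (simp add: vector_angle_sgn norm_sgn)

text \<open>Equality forces equality in Cauchy-Schwarz, so the components of \<open>a\<close> and
  \<open>c\<close> orthogonal to \<open>b\<close> are opposite, and the combination of
  \<open>a\<close> and \<open>c\<close> in which they cancel is a multiple of \<open>b\<close>. If
  the angle is \<open>pi\<close>, then \<open>a\<close> and \<open>c\<close> are opposite and every
  \<open>b\<close> gives equality, whence the bound \<open>lt\<close>.\<close>

lemma vector_angle_triangle_eq:
  fixes a b c :: "'a::real_inner"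
  assumes nz: "a \<noteq> 0" "b \<noteq> 0" "c \<noteq> 0"
    and eq: "vector_angle a c = vector_angle a b + vector_angle b c"
    and lt: "vector_angle a c < pi"
  obtains l m where "0 \<le> l" "0 \<le> m" "b = l *\<^sub>R a + m *\<^sub>R c"
proof -
  define A B C where "A = sgn a" and "B = sgn b" and "C = sgn c"
  have u: "norm A = 1" "norm B = 1" "norm C = 1"
    using nz by (auto simp: A_def B_def C_def norm_sgn)
  have eq': "vector_angle A C = vector_angle A B + vector_angle B C" and lt': "vector_angle A C < pi"
    using eq lt by (auto simp: A_def B_def C_def vector_angle_sgn)
  define A' C' where "A' = A - (A \<bullet> B) *\<^sub>R B" and "C' = C - (B \<bullet> C) *\<^sub>R B"
  note cs = cos_add_vector_angle[OF u, folded A'_def C'_def]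
  have "cos (vector_angle A B + vector_angle B C) = A \<bullet> C"
    unfolding eq'[symmetric] cos_vector_angle by (simp add: u)
  then have "(- A') \<bullet> C' = norm (- A') * norm C'"
    using cs(3) by simp
  then have "norm (- A') *\<^sub>R C' = norm C' *\<^sub>R (- A')"
    by (simp only: norm_cauchy_schwarz_eq)
  then have "norm A' *\<^sub>R C' = - (norm C' *\<^sub>R A')"
    by simp
  then have perp: "norm A' *\<^sub>R C' + norm C' *\<^sub>R A' = 0" by simp
  have "sin (vector_angle A B + vector_angle B C) = norm A' * (B \<bullet> C) + (A \<bullet> B) * norm C'"
    by (simp add: sin_add cs cos_vector_angle u)
  then have B: "norm A' *\<^sub>R C + norm C' *\<^sub>R A = sin (vector_angle A C) *\<^sub>R B"
    using perp by (simp add: A'_def C'_def eq' algebra_simps)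
  have "\<exists>l m. 0 \<le> l \<and> 0 \<le> m \<and> B = l *\<^sub>R A + m *\<^sub>R C"
  proof (cases "vector_angle A C = 0")
    case True
    then have "vector_angle A B = 0" using eq' vector_angle_bounds by (metis add_nonneg_eq_0_iff)
    then have "A \<bullet> B = 1" using cos_vector_angle[of A B] u by simp
    then have "A = B" using u norm_cauchy_schwarz_eq[of A B] by simp
    then show ?thesis by (intro exI[of _ 1] exI[of _ 0]) auto
  next
    case False
    then have s: "0 < sin (vector_angle A C)"
      using lt' vector_angle_bounds[of A C] by (intro sin_gt_zero) auto
    have "B = (1 / sin (vector_angle A C)) *\<^sub>R (sin (vector_angle A C) *\<^sub>R B)"
      using s by simp
    also have "\<dots> = (norm C' / sin (vector_angle A C)) *\<^sub>R A + (norm A' / sin (vector_angle A C)) *\<^sub>R C"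
      by (simp flip: B add: algebra_simps)
    finally show ?thesis using s
      by (intro exI[of _ "norm C' / sin (vector_angle A C)"] exI[of _ "norm A' / sin (vector_angle A C)"]) auto
  qed
  then obtain l m where lm: "0 \<le> l" "0 \<le> m" "B = l *\<^sub>R A + m *\<^sub>R C" by blast
  have "b = norm b *\<^sub>R B" using nz by (simp add: B_def sgn_div_norm)
  also have "\<dots> = (norm b * l / norm a) *\<^sub>R a + (norm b * m / norm c) *\<^sub>R c"
    by (simp add: lm(3) A_def C_def sgn_div_norm algebra_simps divide_inverse)
  finally show thesis using lm nz
    by (intro that[of "norm b * l / norm a" "norm b * m / norm c"]) auto
qed

text \<open>For \<open>b\<close> in the cone of \<open>a\<close> and \<open>c\<close>, the
  components of \<open>a\<close> and \<open>c\<close> orthogonal to \<open>b\<close> are opposite,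
  so both sides have the same cosine. It remains to see that the sum of the two angles does not
  exceed \<open>pi\<close>, where the cosine is injective.\<close>

lemma vector_angle_add_cone_unit:
  fixes a b c :: "'a::real_inner"
  assumes u: "norm a = 1" "norm b = 1" "norm c = 1"
    and l: "0 \<le> l" "0 \<le> m" "b = l *\<^sub>R a + m *\<^sub>R c"
  shows "vector_angle a c = vector_angle a b + vector_angle b c"
proof -
  define a' c' where "a' = a - (a \<bullet> b) *\<^sub>R b" and "c' = c - (b \<bullet> c) *\<^sub>R b"
  note cs = cos_add_vector_angle[OF u, folded a'_def c'_def]
  have bb: "b \<bullet> b = 1" "a \<bullet> a = 1" "c \<bullet> c = 1"
    using u by (auto simp: dot_square_norm)
  have "l * (a \<bullet> b) + m * (b \<bullet> c) = b \<bullet> b"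
    by (subst (3) l(3)) (simp add: inner_add_right inner_commute)
  then have "l *\<^sub>R a' + m *\<^sub>R c' = b - (b \<bullet> b) *\<^sub>R b"
    unfolding a'_def c'_def by (subst (4) l(3)) (simp add: algebra_simps flip: scaleR_add_left)
  then have perp: "l *\<^sub>R a' + m *\<^sub>R c' = 0" by (simp add: bb)
  have opp: "a' \<bullet> c' = - (norm a' * norm c')"
  proof (cases "l = 0")
    case False
    then have a': "a' = (- (m / l)) *\<^sub>R c'"
    proof -
      have "l *\<^sub>R a' = - (m *\<^sub>R c')" using perp by (simp add: eq_neg_iff_add_eq_0)
      then have "(1 / l) *\<^sub>R (l *\<^sub>R a') = (1 / l) *\<^sub>R (- (m *\<^sub>R c'))" by simp
      then show ?thesis using False by simp
    qed
    have "norm a' = (m / l) * norm c'" unfolding a' norm_scaleR using l(1,2) by simp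
    then show ?thesis by (simp add: a' dot_square_norm power2_eq_square)
  next
    case True
    then have "m \<noteq> 0" using l(3) u(2) by auto
    then have "c' = 0" using perp True by simp
    then show ?thesis by simp
  qed
  then have cos: "cos (vector_angle a b + vector_angle b c) = cos (vector_angle a c)"
    using cs(3) u by (simp add: cos_vector_angle)
  \<comment> \<open>\<open>b \<bullet> (a + c)\<close> is the sum of the cosines of the two angles;
    being nonnegative, it bounds the sum of the angles by \<open>pi\<close>.\<close>
  have "-1 \<le> a \<bullet> c" using cos_quotient_bounds(1)[of a c] u by simp
  then have "0 \<le> (l + m) * (1 + a \<bullet> c)" using l by simp
  also have "(l + m) * (1 + a \<bullet> c) = b \<bullet> (a + c)"
    by (subst l(3)) (simp add: inner_add inner_commute bb algebra_simps)
  finally have "cos (pi - vector_angle b c) \<le> cos (vector_angle a b)"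
    by (simp add: cos_vector_angle u inner_add_right inner_commute)
  then have "vector_angle a b \<le> pi - vector_angle b c"
    using vector_angle_bounds[of b c] vector_angle_bounds[of a b]
    by (subst (asm) cos_mono_le_eq) auto
  then show ?thesis
    using cos_inj_pi[OF _ _ _ _ cos[symmetric]] vector_angle_bounds[of b c] vector_angle_bounds[of a b]
      vector_angle_bounds[of a c] by linarith
qed

lemma vector_angle_add_cone:
  fixes a b c :: "'a::real_inner"
  assumes nz: "a \<noteq> 0" "b \<noteq> 0" "c \<noteq> 0"
    and l: "0 \<le> l" "0 \<le> m" "b = l *\<^sub>R a + m *\<^sub>R c"
  shows "vector_angle a c = vector_angle a b + vector_angle b c"
proof -
  have "sgn b = (l * norm a / norm b) *\<^sub>R sgn a + (m * norm c / norm b) *\<^sub>R sgn c"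
  proof -
    have "sgn b = (1 / norm b) *\<^sub>R (l *\<^sub>R a + m *\<^sub>R c)"
      using l(3) by (simp add: sgn_div_norm divide_inverse)
    also have "l *\<^sub>R a + m *\<^sub>R c = (l * norm a) *\<^sub>R sgn a + (m * norm c) *\<^sub>R sgn c"
      using nz by (simp add: sgn_div_norm divide_inverse[symmetric] flip: mult.assoc)
    finally show ?thesis by (simp add: scaleR_add_right)
  qed
  note e = this
  have "vector_angle (sgn a) (sgn c) = vector_angle (sgn a) (sgn b) + vector_angle (sgn b) (sgn c)"
    by (rule vector_angle_add_cone_unit[OF _ _ _ _ _ e]) (use nz l(1,2) in \<open>simp_all add: norm_sgn\<close>)
  then show ?thesis by (simp only: vector_angle_sgn)
qed

lemma closed_segment_weighted:
  assumes "0 \<le> s" "0 \<le> t" "0 < s + t" "(s + t) *\<^sub>R x = s *\<^sub>R a + t *\<^sub>R b"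
  shows "x \<in> closed_segment a b"
proof -
  have "(1 / (s + t)) *\<^sub>R ((s + t) *\<^sub>R x) = (1 / (s + t)) *\<^sub>R (s *\<^sub>R a + t *\<^sub>R b)"
    using assms(4) by simp
  then have "x = (s / (s + t)) *\<^sub>R a + (t / (s + t)) *\<^sub>R b"
    using assms(3) by (simp add: scaleR_add_right)
  also have "s / (s + t) = 1 - t / (s + t)" using assms(3) by (simp add: field_simps)
  finally have "x = (1 - t / (s + t)) *\<^sub>R a + (t / (s + t)) *\<^sub>R b" .
  moreover have "0 \<le> t / (s + t)" "t / (s + t) \<le> 1" using assms(1-3) by simp_all
  ultimately show ?thesis unfolding in_segment(1) by blast
qed

section \<open>Angles of triangles and quadrilaterals\<close>

definition point_angle :: "'a::real_inner \<Rightarrow> 'a \<Rightarrow> 'a \<Rightarrow> real"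
  where "point_angle a b c = vector_angle (a - b) (c - b)"

lemma point_angle_commute: "point_angle a b c = point_angle c b a"
  unfolding point_angle_def by (rule vector_angle_commute)

lemma point_angle_bounds: "0 \<le> point_angle a b c" "point_angle a b c \<le> pi"
  unfolding point_angle_def by (rule vector_angle_bounds)+

lemma point_angle_triangle:
  assumes "a \<noteq> p" "b \<noteq> p" "c \<noteq> p"
  shows "point_angle a p c \<le> point_angle a p b + point_angle b p c"
  unfolding point_angle_def using assms by (intro vector_angle_triangle) auto

text \<open>\<open>c - a\<close> is the sum of the side vectors \<open>b - a\<close> and
  \<open>c - b\<close>, so it splits the exterior angle at \<open>b\<close> into the two opposite
  interior angles.\<close>

lemma point_angle_sum:
  assumes "a \<noteq> b" "b \<noteq> c" "a \<noteq> c"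
  shows "point_angle a b c + point_angle b c a + point_angle c a b = pi"
proof -
  have "vector_angle (b - a) (c - b) = vector_angle (b - a) (c - a) + vector_angle (c - a) (c - b)"
    using assms by (intro vector_angle_add_cone[of _ _ _ 1 1]) auto
  moreover have "vector_angle (b - a) (c - b) = pi - point_angle a b c"
    using vector_angle_minus_left[of "a - b" "c - b"] by (simp add: point_angle_def)
  moreover have "vector_angle (c - a) (c - b) = point_angle b c a"
    using vector_angle_minus_left[of "a - c" "c - b"] vector_angle_minus_right[of "a - c" "b - c"]
    by (simp add: point_angle_def vector_angle_commute)
  moreover have "vector_angle (b - a) (c - a) = point_angle c a b"
    by (simp add: point_angle_def vector_angle_commute)
  ultimately show ?thesis by linarith
qed

lemma point_angle_eq_pi:
  assumes "b \<noteq> a" "d \<noteq> a" "point_angle b a d = pi"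
  shows "a \<in> closed_segment b d"
proof -
  let ?u = "b - a" and ?w = "d - a"
  have nz: "norm ?u > 0" "norm ?w > 0" using assms by auto
  have "(?u \<bullet> ?w) / (norm ?u * norm ?w) = - 1"
    using cos_vector_angle[of ?u ?w] assms(3) by (simp add: point_angle_def)
  then have "?u \<bullet> ?w = - (norm ?u * norm ?w)" using nz by (simp add: field_simps)
  then have "(- ?u) \<bullet> ?w = norm (- ?u) * norm ?w"
    by (simp only: inner_minus_left norm_minus_cancel)
  then have "norm (- ?u) *\<^sub>R ?w = norm ?w *\<^sub>R (- ?u)"
    by (simp only: norm_cauchy_schwarz_eq)
  then have "norm ?u *\<^sub>R ?w = - (norm ?w *\<^sub>R ?u)"
    by (simp only: norm_minus_cancel scaleR_minus_right)
  then have "norm ?u *\<^sub>R ?w + norm ?w *\<^sub>R ?u = 0" by simp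
  then have "(norm ?u + norm ?w) *\<^sub>R a = norm ?w *\<^sub>R b + norm ?u *\<^sub>R d"
    by (simp add: algebra_simps)
  then show ?thesis
    using nz by (intro closed_segment_weighted[of "norm ?w" "norm ?u"]) (auto simp: add.commute intro: add_pos_pos)
qed

lemma point_angle_add:
  assumes "a \<noteq> p" "b \<noteq> p" "c \<noteq> p" and meet: "closed_segment a c \<inter> closed_segment p b \<noteq> {}"
  shows "point_angle a p c = point_angle a p b + point_angle b p c"
proof -
  from meet obtain s t where s: "0 \<le> s" "s \<le> 1" and t: "0 \<le> t" "t \<le> 1"
    and eq: "(1 - s) *\<^sub>R a + s *\<^sub>R c = (1 - t) *\<^sub>R p + t *\<^sub>R b"
    by (auto simp: closed_segment_def)
  from eq have eq': "t *\<^sub>R (b - p) = (1 - s) *\<^sub>R (a - p) + s *\<^sub>R (c - p)"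
    by (simp add: algebra_simps)
  show ?thesis
  proof (cases "t = 0")
    case False
    have "(1 / t) *\<^sub>R (t *\<^sub>R (b - p)) = (1 / t) *\<^sub>R ((1 - s) *\<^sub>R (a - p) + s *\<^sub>R (c - p))"
      using eq' by simp
    then have "b - p = ((1 - s) / t) *\<^sub>R (a - p) + (s / t) *\<^sub>R (c - p)"
      using False by (simp add: scaleR_add_right)
    then show ?thesis unfolding point_angle_def
      using s t False assms by (intro vector_angle_add_cone[of _ _ _ "(1 - s) / t" "s / t"]) auto
  next
    \<comment> \<open>The segments meet in \<open>p\<close> itself, so \<open>a\<close> and
      \<open>c\<close> lie in opposite directions from \<open>p\<close>, and their angles with any
      vector are supplementary.\<close>
    case True
    then have e: "(1 - s) *\<^sub>R (a - p) = - (s *\<^sub>R (c - p))"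
      using eq' by (simp add: eq_neg_iff_add_eq_0)
    have "s \<noteq> 0" using e assms by auto
    moreover have "s \<noteq> 1" using e assms by auto
    ultimately have s': "0 < s" "0 < 1 - s" using s by auto
    have sc: "vector_angle (a - p) y = pi - vector_angle (c - p) y" for y
    proof -
      have "vector_angle (a - p) y = vector_angle ((1 - s) *\<^sub>R (a - p)) y"
        using s' by (simp add: vector_angle_scale_left)
      also have "\<dots> = pi - vector_angle (c - p) y"
        unfolding e vector_angle_minus_left using s' by (simp add: vector_angle_scale_left)
      finally show ?thesis .
    qed
    show ?thesis unfolding point_angle_def sc
      using assms by (simp add: vector_angle_self vector_angle_commute)
  qed
qed

lemma point_angle_triangle_eq:
  assumes "a \<noteq> p" "b \<noteq> p" "c \<noteq> p" "point_angle a p c = point_angle a p b + point_angle b p c"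
    "point_angle a p c < pi"
  obtains q k where "0 < k" "q = p + k *\<^sub>R (b - p)" "q \<in> closed_segment a c"
proof -
  obtain l m where lm: "0 \<le> l" "0 \<le> m" "b - p = l *\<^sub>R (a - p) + m *\<^sub>R (c - p)"
    using vector_angle_triangle_eq[of "a - p" "b - p" "c - p"] assms
    by (auto simp: point_angle_def)
  have "l + m \<noteq> 0"
  proof
    assume "l + m = 0"
    then have "l = 0" "m = 0" using lm by auto
    then show False using lm(3) assms(2) by simp
  qed
  then have pos: "0 < l + m" using lm by simp
  define q where "q = p + (1 / (l + m)) *\<^sub>R (b - p)"
  have "(l + m) *\<^sub>R q = (l + m) *\<^sub>R p + (b - p)" using pos by (simp add: q_def algebra_simps)
  also have "\<dots> = l *\<^sub>R a + m *\<^sub>R c" unfolding lm(3) by (simp add: algebra_simps)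
  finally have "q \<in> closed_segment a c"
    using pos lm by (intro closed_segment_weighted) auto
  then show thesis using that[of "1 / (l + m)" q] pos by (simp add: q_def)
qed

text \<open>If the cone conditions at \<open>a\<close> and at \<open>c\<close> hold, the rays from \<open>a\<close> to \<open>c\<close> and from \<open>c\<close> to \<open>a\<close>
  both hit the segment from \<open>b\<close> to \<open>d\<close>; if neither hit lies between \<open>a\<close> and \<open>c\<close>, these two points do.\<close>

lemma quadrilateral_diagonals_meet:
  assumes d: "distinct [a, b, c, d]"
    and sum: "point_angle a b c + point_angle b c d + point_angle c d a + point_angle d a b = 2 * pi"
  shows "closed_segment a c \<inter> closed_segment b d \<noteq> {}"
proof -
  \<comment> \<open>The diagonal from \<open>a\<close> to \<open>c\<close> cuts the quadrilateral
    into two triangles with total angle \<open>2 * pi\<close>, so the triangle inequalities at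
    \<open>a\<close> and at \<open>c\<close> leave no slack.\<close>
  have "point_angle a b c + point_angle b c a + point_angle c a b = pi"
    "point_angle c d a + point_angle d a c + point_angle a c d = pi"
    using d by (auto intro!: point_angle_sum)
  moreover have "point_angle b c d \<le> point_angle b c a + point_angle a c d"
    using d by (intro point_angle_triangle) auto
  moreover have "point_angle b a d \<le> point_angle b a c + point_angle c a d"
    using d by (intro point_angle_triangle) auto
  ultimately have ea: "point_angle b a d = point_angle b a c + point_angle c a d"
    and ec: "point_angle b c d = point_angle b c a + point_angle a c d"
    using sum point_angle_commute[of d a b] point_angle_commute[of c a b] point_angle_commute[of d a c]
    by linarith+
  show ?thesis
  proof (cases "point_angle b a d = pi \<or> point_angle b c d = pi")
    case True
    then have "a \<in> closed_segment b d \<or> c \<in> closed_segment b d"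
      using d point_angle_eq_pi[of b a d] point_angle_eq_pi[of b c d] by auto
    then show ?thesis by auto
  next
    case False
    then have lt: "point_angle b a d < pi" "point_angle b c d < pi"
      using point_angle_bounds by (metis less_eq_real_def)+
    obtain p k where p: "0 < k" "p = a + k *\<^sub>R (c - a)" "p \<in> closed_segment b d"
      using d by (auto intro: point_angle_triangle_eq[OF _ _ _ ea lt(1)])
    obtain q h where q: "0 < h" "q = c + h *\<^sub>R (a - c)" "q \<in> closed_segment b d"
      using d by (auto intro: point_angle_triangle_eq[OF _ _ _ ec lt(2)])
    show ?thesis
    proof (cases "k \<le> 1")
      case True
      then have "p \<in> closed_segment a c"
        using p unfolding closed_segment_def by (intro CollectI exI[of _ k]) (auto simp: algebra_simps)
      then show ?thesis using p by auto
    next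
      case False
      then have k: "1 < k" by simp
      have "(k - 1 + h) *\<^sub>R c = (k - 1) *\<^sub>R q + h *\<^sub>R p"
        unfolding p q by (simp add: algebra_simps)
      then have "c \<in> closed_segment q p"
        using q(1) k by (intro closed_segment_weighted[of "k - 1" h]) simp_all
      then have "c \<in> closed_segment b d" using p(3) q(3) by (metis closed_segment_subset convex_closed_segment subsetD)
      then show ?thesis by auto
    qed
  qed
qed

subsection \<open>Angle sums of closed polygons\<close>

fun path_angles :: "'a::real_inner list \<Rightarrow> real"
  where
    "path_angles (a # b # c # xs) = point_angle a b c + path_angles (b # c # xs)"
  | "path_angles _ = 0"

text \<open>Repeating the first two vertices makes every vertex, the first and the last included,
  the middle of exactly one consecutive triple.\<close>

definition polygon_angles :: "'a::real_inner list \<Rightarrow> real"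
  where "polygon_angles xs = path_angles (xs @ take 2 xs)"

definition diagonals_meet :: "'a::real_inner list \<Rightarrow> bool"
  where "diagonals_meet xs \<longleftrightarrow> (\<forall>a b c d. subseq [a, b, c, d] xs \<longrightarrow>
    closed_segment a c \<inter> closed_segment b d \<noteq> {})"

lemma path_angles_append:
  "path_angles (xs @ a # b # ys) = path_angles (xs @ [a, b]) + path_angles (a # b # ys)"
proof (induction xs rule: path_angles.induct)
  case ("2_3" x y)
  then show ?case by simp
qed simp_all

lemma polygon_angles_rotate1: "2 < length xs \<Longrightarrow> polygon_angles (rotate1 xs) = polygon_angles xs"
proof -
  assume "2 < length xs"
  then obtain y a b t where xs: "xs = y # a # b # t"
    by (metis Suc_le_length_iff Suc_leI numeral_2_eq_2)
  have "polygon_angles (rotate1 xs) = path_angles ((a # b # t) @ y # a # [b])"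
    by (simp add: polygon_angles_def xs)
  also have "\<dots> = path_angles ((a # b # t) @ [y, a]) + point_angle y a b"
    by (subst path_angles_append) simp
  also have "\<dots> = polygon_angles xs"
    by (simp add: polygon_angles_def xs)
  finally show ?thesis .
qed

lemma polygon_angles_rotate: "2 < length xs \<Longrightarrow> polygon_angles (rotate n xs) = polygon_angles xs"
  by (induction n) (simp_all add: polygon_angles_rotate1)

lemma polygon_angles_swap: "2 < length (xs @ ys) \<Longrightarrow> polygon_angles (xs @ ys) = polygon_angles (ys @ xs)"
  by (metis polygon_angles_rotate rotate_append)

lemma polygon_angles_triangle:
  assumes "distinct [a, b, c]" shows "polygon_angles [a, b, c] = pi"
  using point_angle_sum[of a b c] assms by (simp add: polygon_angles_def)

text \<open>Removing the vertex \<open>y\<close> cuts off the triangle \<open>e y a\<close>.\<close>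

lemma polygon_angles_cut:
  assumes "2 < length xs" "distinct (y # xs)"
  obtains a b d e w t where "xs = a # b # t" "xs = w @ [d, e]"
    "polygon_angles (y # xs) - polygon_angles xs - pi
      = (point_angle y a b - (point_angle y a e + point_angle e a b))
      + (point_angle d e y - (point_angle d e a + point_angle a e y))"
proof -
  obtain a b c t where xs: "xs = a # b # c # t"
    using assms by (metis Suc_le_length_iff Suc_leI numeral_2_eq_2)
  obtain w d e where we: "xs = w @ [d, e]"
  proof -
    have "butlast (butlast xs) @ [last (butlast xs), last xs] = xs"
      using assms(1) by (metis append_Cons append_Nil append_assoc append_butlast_last_id append_is_Nil_conv
        butlast.simps(2) list.distinct(1) xs)
    then show thesis using that by metis
  qed
  have "polygon_angles (y # xs) = point_angle y a b + path_angles (w @ d # e # [y, a])"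
    unfolding polygon_angles_def using xs we
    by (metis (no_types, lifting) append_Cons append_Nil append_assoc numeral_2_eq_2
        path_angles.simps(1) take0 take_Suc_Cons)
  also have "\<dots> = point_angle y a b + (path_angles xs + point_angle d e y + point_angle e y a)"
    by (subst path_angles_append) (simp add: we)
  finally have 1: "polygon_angles (y # xs)
      = point_angle y a b + (path_angles xs + point_angle d e y + point_angle e y a)" .
  have "polygon_angles xs = path_angles (w @ d # e # [a, b])"
    unfolding polygon_angles_def using xs we
    by (metis append_Cons append_Nil append_assoc numeral_2_eq_2 take0 take_Suc_Cons)
  also have "\<dots> = path_angles xs + point_angle d e a + point_angle e a b"
    by (subst path_angles_append) (simp add: we)
  finally have 2: "polygon_angles xs = path_angles xs + point_angle d e a + point_angle e a b" .
  have "e \<in> set xs" "y \<notin> set xs" using we assms by auto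
  moreover have "e \<noteq> a"
  proof -
    have "last (b # c # t) = e"
      using xs we by (metis last.simps last_appendR list.distinct(1))
    then have "e \<in> set (b # c # t)" by (metis last_in_set list.distinct(1))
    then show ?thesis using assms(2) xs by auto
  qed
  ultimately have "point_angle e y a + point_angle y a e + point_angle a e y = pi"
    using xs by (intro point_angle_sum) auto
  then show thesis using that[OF xs we] 1 2 by simp
qed

lemma polygon_angles_remove_hd:
  assumes "2 < length xs" "distinct (y # xs)"
  shows "polygon_angles (y # xs) \<le> polygon_angles xs + pi"
proof -
  obtain a b d e w t where xs: "xs = a # b # t" "xs = w @ [d, e]"
    and eq: "polygon_angles (y # xs) - polygon_angles xs - pi
      = (point_angle y a b - (point_angle y a e + point_angle e a b))
      + (point_angle d e y - (point_angle d e a + point_angle a e y))"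
    by (rule polygon_angles_cut[OF assms])
  have n: "y \<noteq> a" "a \<noteq> b" using assms(2) by (auto simp: xs(1))
  have n': "y \<noteq> e" "d \<noteq> e" using assms(2) by (auto simp: xs(2))
  have "t \<noteq> []" using assms(1) xs(1) by auto
  then have "last t = e" using xs by (metis last.simps last_appendR list.distinct(1))
  then have "e \<in> set t" using \<open>t \<noteq> []\<close> last_in_set by blast
  then have "e \<noteq> a" "b \<noteq> a" using assms(2) by (auto simp: xs(1))
  then have "point_angle y a b \<le> point_angle y a e + point_angle e a b"
    "point_angle d e y \<le> point_angle d e a + point_angle a e y"
    using n n' by (auto intro!: point_angle_triangle)
  then show ?thesis using eq by linarith
qed

lemma polygon_angles_remove:
  assumes "2 < length (xs @ zs)" "distinct (xs @ y # zs)"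
  shows "polygon_angles (xs @ y # zs) \<le> polygon_angles (xs @ zs) + pi"
proof -
  have "polygon_angles (xs @ y # zs) = polygon_angles (y # zs @ xs)"
    using assms polygon_angles_swap[of xs "y # zs"] by simp
  also have "\<dots> \<le> polygon_angles (zs @ xs) + pi"
    using assms by (intro polygon_angles_remove_hd) auto
  finally show ?thesis using assms polygon_angles_swap[of xs zs] by simp
qed

lemma polygon_angles_le:
  assumes "2 < length xs" "distinct xs"
  shows "polygon_angles xs \<le> (real (length xs) - 2) * pi"
  using assms
proof (induction xs)
  case (Cons y xs)
  show ?case
  proof (cases "2 < length xs")
    case True
    then have "polygon_angles (y # xs) \<le> (real (length xs) - 2) * pi + pi"
      using Cons polygon_angles_remove_hd[of xs y] by force
    then show ?thesis by (simp add: algebra_simps)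
  next
    case False
    then obtain b c where "xs = [b, c]"
      using Cons.prems(1) by (cases xs; cases "tl xs") auto
    then show ?thesis using Cons.prems(2) polygon_angles_triangle[of y b c] by simp
  qed
qed simp

lemma subseq_remove:
  assumes "subseq ys xs" "length ys < length xs"
  obtains ps q rs where "xs = ps @ q # rs" "subseq ys (ps @ rs)"
proof -
  have "\<exists>ps q rs. xs = ps @ q # rs \<and> subseq ys (ps @ rs)"
    using assms
  proof (induction rule: list_emb.induct)
    case (list_emb_Nil ys)
    then obtain q rs where "ys = q # rs" by (cases ys) auto
    then show ?case by (intro exI[of _ "[]"] exI[of _ q] exI[of _ rs]) auto
  next
    case (list_emb_Cons xs ys y)
    then show ?case by (intro exI[of _ "[]"] exI[of _ y] exI[of _ ys]) auto
  next
    case (list_emb_Cons2 x y xs ys)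
    then obtain ps q rs where "ys = ps @ q # rs" "subseq xs (ps @ rs)" by auto
    then show ?case using list_emb_Cons2
      by (intro exI[of _ "y # ps"] exI[of _ q] exI[of _ rs]) auto
  qed
  then show thesis using that by blast
qed

text \<open>The defect \<open>(n - 2) * pi - polygon_angles\<close> is never negative and does not
  grow when a vertex is removed, so once it is zero it stays zero.\<close>

lemma polygon_angles_eq_subseq:
  assumes "distinct xs" "polygon_angles xs = (real (length xs) - 2) * pi" "subseq ys xs" "2 < length ys"
  shows "polygon_angles ys = (real (length ys) - 2) * pi"
  using assms
proof (induction "length xs" arbitrary: xs rule: less_induct)
  case less
  show ?case
  proof (cases "length ys = length xs")
    case True
    then show ?thesis using less.prems subseq_same_length by blast
  next
    case False
    then have "length ys < length xs" using list_emb_length[OF less.prems(3)] by simp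
    then obtain ps q rs where r: "xs = ps @ q # rs" "subseq ys (ps @ rs)"
      using subseq_remove less.prems(3) by blast
    have l: "2 < length (ps @ rs)" using list_emb_length[OF r(2)] less.prems(4) by simp
    have "polygon_angles xs \<le> polygon_angles (ps @ rs) + pi"
      using polygon_angles_remove[OF l] less.prems(1) r(1) by simp
    then have "(real (length (ps @ rs)) - 2) * pi \<le> polygon_angles (ps @ rs)"
      using less.prems(2) by (simp add: r(1) algebra_simps)
    moreover have "polygon_angles (ps @ rs) \<le> (real (length (ps @ rs)) - 2) * pi"
      using less.prems(1) r(1) by (intro polygon_angles_le l) auto
    ultimately show ?thesis
      using less.hyps[of "ps @ rs"] less.prems r by auto
  qed
qed

lemma polygon_angles_eq_imp_diagonals_meet:
  assumes "distinct xs" "polygon_angles xs = (real (length xs) - 2) * pi"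
  shows "diagonals_meet xs"
  unfolding diagonals_meet_def
proof (intro allI impI)
  fix a b c d assume sub: "subseq [a, b, c, d] xs"
  then have "polygon_angles [a, b, c, d] = 2 * pi"
    using polygon_angles_eq_subseq[OF assms sub] by simp
  then have "point_angle a b c + point_angle b c d + point_angle c d a + point_angle d a b = 2 * pi"
    by (simp add: polygon_angles_def)
  moreover have "distinct [a, b, c, d]" using sub assms(1) by (metis subseq_conv_nths distinct_nthsI)
  ultimately show "closed_segment a c \<inter> closed_segment b d \<noteq> {}"
    by (intro quadrilateral_diagonals_meet)
qed

lemma diagonals_meet_subseq: "diagonals_meet xs \<Longrightarrow> subseq ys xs \<Longrightarrow> diagonals_meet ys"
  unfolding diagonals_meet_def by (blast intro: subseq_order.trans)

text \<open>Removing \<open>y\<close> costs exactly \<open>pi\<close> if both triangle inequalities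
  of \<open>polygon_angles_cut\<close> are equalities. The quadrilaterals \<open>y a b e\<close> and
  \<open>y a d e\<close>, which share the diagonal from \<open>a\<close> to \<open>e\<close>, give
  this.\<close>

lemma diagonals_meet_imp_polygon_angles_eq:
  assumes "2 < length xs" "distinct xs" "diagonals_meet xs"
  shows "polygon_angles xs = (real (length xs) - 2) * pi"
  using assms
proof (induction xs)
  case (Cons y xs)
  show ?case
  proof (cases "2 < length xs")
    case True
    obtain a b d e w t where xs: "xs = a # b # t" "xs = w @ [d, e]"
      and eq: "polygon_angles (y # xs) - polygon_angles xs - pi
        = (point_angle y a b - (point_angle y a e + point_angle e a b))
        + (point_angle d e y - (point_angle d e a + point_angle a e y))"
      by (rule polygon_angles_cut[OF True Cons.prems(2)])
    have t: "t \<noteq> []" using True xs(1) by auto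
    then have "last t = e" using xs by (metis last.simps last_appendR list.distinct(1))
    then have et: "t = butlast t @ [e]" using t by (metis append_butlast_last_id)
    have w: "w \<noteq> []" using True xs(2) by auto
    then obtain w' where w': "w = a # w'" using xs by (cases w) auto
    have "subseq [y, a, b, e] (y # xs)"
      unfolding xs(1) by (subst et) (simp add: subseq_singleton_left)
    then have "closed_segment y b \<inter> closed_segment a e \<noteq> {}"
      using Cons.prems(3) unfolding diagonals_meet_def by blast
    moreover have "subseq [y, a, d, e] (y # xs)"
      unfolding xs(2) w' by (simp add: list_emb_append2)
    then have "closed_segment y d \<inter> closed_segment a e \<noteq> {}"
      using Cons.prems(3) unfolding diagonals_meet_def by blast
    moreover have "distinct (y # a # b # butlast t @ [e])"
      using Cons.prems(2) et by (simp only: xs(1))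
    moreover have "distinct (y # a # w' @ [d, e])"
      using Cons.prems(2) by (simp add: xs(2) w')
    ultimately have "point_angle y a b = point_angle y a e + point_angle e a b"
      "point_angle y e d = point_angle y e a + point_angle a e d"
      by (intro point_angle_add; auto simp: closed_segment_commute)+
    then have "polygon_angles (y # xs) = polygon_angles xs + pi"
      using eq by (simp add: point_angle_commute)
    moreover have "diagonals_meet xs"
      using Cons.prems(3) by (rule diagonals_meet_subseq) auto
    ultimately show ?thesis
      using Cons True by (simp add: algebra_simps)
  next
    case False
    then obtain b c where "xs = [b, c]"
      using Cons.prems(1) by (cases xs; cases "tl xs") auto
    then show ?thesis using Cons.prems(2) polygon_angles_triangle[of y b c] by simp
  qed
qed simp

subsection \<open>Inversion and intersection angles\<close>

text \<open>The inversion in the unit sphere about \<open>v\<close>, translated so that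
  \<open>v\<close> becomes the origin. Images are positive multiples of \<open>x - v\<close>, so
  directions at \<open>v\<close>, and the sides of planes through \<open>v\<close>, can be read off
  them.\<close>

definition inversion :: "'a::real_inner \<Rightarrow> 'a \<Rightarrow> 'a"
  where "inversion v x = (1 / (norm (x - v))\<^sup>2) *\<^sub>R (x - v)"

lemma scaled_inversion: "x \<noteq> v \<Longrightarrow> (norm (x - v))\<^sup>2 *\<^sub>R inversion v x = x - v"
  by (simp add: inversion_def)

lemma inner_inversion_self: "x \<noteq> v \<Longrightarrow> (norm (x - v))\<^sup>2 * (inversion v x \<bullet> inversion v x) = 1"
  by (simp add: inversion_def power2_norm_eq_inner[symmetric] power_mult_distrib power2_eq_square)

lemma inversion_inj: 
  assumes "x \<noteq> v" "y \<noteq> v" "inversion v x = inversion v y" shows "x = y"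
proof -
  have "(norm (x - v))\<^sup>2 = (norm (y - v))\<^sup>2"
    using inner_inversion_self[of x v] inner_inversion_self[of y v] assms
    by (metis mult_cancel_right mult_zero_right zero_neq_one)
  then have "x - v = y - v" using assms by (metis scaled_inversion)
  then show ?thesis by simp
qed

lemma norm_inversion_diff:
  assumes "x \<noteq> v" "y \<noteq> v"
  shows "norm (inversion v x - inversion v y) = norm (x - y) / (norm (x - v) * norm (y - v))"
proof -
  define X Y where "X = x - v" and "Y = y - v"
  have nz: "norm X \<noteq> 0" "norm Y \<noteq> 0" using assms by (auto simp: X_def Y_def)
  have XX: "X \<bullet> X = (norm X)\<^sup>2" "Y \<bullet> Y = (norm Y)\<^sup>2" by (simp_all add: power2_norm_eq_inner)
  have "(norm (inversion v x - inversion v y))\<^sup>2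
      = ((norm Y)\<^sup>2 - 2 * (X \<bullet> Y) + (norm X)\<^sup>2) / ((norm X)\<^sup>2 * (norm Y)\<^sup>2)"
    unfolding power2_norm_eq_inner[of "inversion v x - inversion v y"]
    unfolding inversion_def X_def[symmetric] Y_def[symmetric]
    using nz by (simp add: inner_diff XX inner_commute[of Y X] field_simps power2_eq_square)
  also have "(norm Y)\<^sup>2 - 2 * (X \<bullet> Y) + (norm X)\<^sup>2 = (norm (X - Y))\<^sup>2"
    unfolding power2_norm_eq_inner by (simp add: inner_diff inner_commute)
  also have "\<dots> / ((norm X)\<^sup>2 * (norm Y)\<^sup>2) = (norm (X - Y) / (norm X * norm Y))\<^sup>2"
    by (simp add: power_divide power_mult_distrib)
  finally have "norm (inversion v x - inversion v y) = norm (X - Y) / (norm X * norm Y)"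
    by (rule power2_eq_imp_eq) auto
  then show ?thesis by (simp add: X_def Y_def)
qed

text \<open>The law of cosines turns this angle into an expression that is symmetric in \<open>x\<close> and \<open>y\<close>.\<close>

lemma point_angle_inversion:
  assumes "y \<noteq> x" "z \<noteq> x" "w \<noteq> x" "z \<noteq> y" "w \<noteq> y"
  shows "point_angle (inversion x z) (inversion x y) (inversion x w) =
    arccos (((norm (z - y) * norm (w - x))\<^sup>2 + (norm (w - y) * norm (z - x))\<^sup>2
        - (norm (z - w) * norm (x - y))\<^sup>2)
      / (2 * norm (z - y) * norm (w - y) * norm (z - x) * norm (w - x)))"
proof -
  define Y Z W where "Y = inversion x y" and "Z = inversion x z" and "W = inversion x w"
  have cosine: "(Z - Y) \<bullet> (W - Y) = ((norm (Z - Y))\<^sup>2 + (norm (W - Y))\<^sup>2 - (norm (Z - W))\<^sup>2) / 2"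
    unfolding power2_norm_eq_inner by (simp add: inner_diff inner_commute)
  define p q r s t u where "p = norm (z - y)" and "q = norm (w - y)" and "r = norm (z - w)"
    and "s = norm (z - x)" and "t = norm (w - x)" and "u = norm (x - y)"
  have n: "norm (Z - Y) = p / (s * u)" "norm (W - Y) = q / (t * u)" "norm (Z - W) = r / (s * t)"
    using assms norm_minus_commute[of y x]
    by (simp_all add: Y_def Z_def W_def norm_inversion_diff p_def q_def r_def s_def t_def u_def)
  have nz: "p \<noteq> 0" "q \<noteq> 0" "s \<noteq> 0" "t \<noteq> 0" "u \<noteq> 0"
    using assms by (auto simp: p_def q_def s_def t_def u_def)
  have "(Z - Y) \<bullet> (W - Y) / (norm (Z - Y) * norm (W - Y))
      = ((p * t)\<^sup>2 + (q * s)\<^sup>2 - (r * u)\<^sup>2) / (2 * p * q * s * t)"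
    unfolding cosine n using nz by (simp add: field_simps power2_eq_square)
  then show ?thesis
    unfolding point_angle_def vector_angle_def Y_def Z_def W_def p_def q_def r_def s_def t_def u_def
    by simp
qed

text \<open>The circumcircles of \<open>x y z\<close> and \<open>x y w\<close> meet at the same
  angle in \<open>x\<close> and in \<open>y\<close>. This makes the inverted links at the two ends
  of an edge agree on its \<open>beta\<close>.\<close>

lemma point_angle_inversion_swap:
  assumes "y \<noteq> x" "z \<noteq> x" "w \<noteq> x" "z \<noteq> y" "w \<noteq> y"
  shows "point_angle (inversion x z) (inversion x y) (inversion x w)
    = point_angle (inversion y z) (inversion y x) (inversion y w)"
  using assms point_angle_inversion[of y x z w] point_angle_inversion[of x y z w]
  by (simp add: norm_minus_commute[of x y] add.commute mult_ac)

section \<open>Circumcircles and their tangents\<close>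

lemma cross3_cross3: "cross3 (cross3 u v) w = (u \<bullet> w) *\<^sub>R v - (v \<bullet> w) *\<^sub>R u"
  for u v w :: "real^3"
  by (simp add: cross3_simps forall_3)

lemma circumcenter_properties:
  fixes a b c :: "real^3"
  assumes "cross3 (b - a) (c - a) \<noteq> 0"
  shows "(b - a) \<bullet> (circumcenter a b c - a) = (norm (b - a))\<^sup>2 / 2"
    "(c - a) \<bullet> (circumcenter a b c - a) = (norm (c - a))\<^sup>2 / 2"
proof -
  define B C where "B = b - a" and "C = c - a"
  \<comment> \<open>The Gram determinant of \<open>B\<close> and \<open>C\<close>.\<close>
  define D where "D = (B \<bullet> B) * (C \<bullet> C) - (B \<bullet> C)\<^sup>2"
  have "(norm (cross3 B C))\<^sup>2 = D"
    using norm_cross_dot[of B C] by (simp add: D_def power_mult_distrib power2_norm_eq_inner)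
  moreover have "norm (cross3 B C) \<noteq> 0" using assms by (simp add: B_def C_def)
  ultimately have D: "D \<noteq> 0" by (metis power_eq_0_iff)
  have iff: "dist m a = dist m b \<and> dist m a = dist m c
      \<longleftrightarrow> B \<bullet> (m - a) = (norm B)\<^sup>2 / 2 \<and> C \<bullet> (m - a) = (norm C)\<^sup>2 / 2" for m
  proof -
    have "dist m a = dist m p \<longleftrightarrow> (p - a) \<bullet> (m - a) = (norm (p - a))\<^sup>2 / 2" for p
    proof -
      have "(dist m a)\<^sup>2 - (dist m p)\<^sup>2 = 2 * ((p - a) \<bullet> (m - a)) - (norm (p - a))\<^sup>2"
        unfolding dist_norm power2_norm_eq_inner by (simp add: inner_diff inner_commute)
      then have "(dist m a)\<^sup>2 = (dist m p)\<^sup>2 \<longleftrightarrow> (p - a) \<bullet> (m - a) = (norm (p - a))\<^sup>2 / 2"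
        by (intro iffI; linarith)
      then show ?thesis by simp
    qed
    then show ?thesis by (simp add: B_def C_def)
  qed
  have hull: "m \<in> affine hull {a, b, c} \<longleftrightarrow> (\<exists>s t. m - a = s *\<^sub>R B + t *\<^sub>R C)" for m
  proof
    assume "m \<in> affine hull {a, b, c}"
    then obtain u s t where "m = u *\<^sub>R a + s *\<^sub>R b + t *\<^sub>R c" "u + s + t = 1"
      by (auto simp: affine_hull_3)
    moreover from this have "u = 1 - s - t" by simp
    ultimately have "m - a = s *\<^sub>R B + t *\<^sub>R C" by (simp add: B_def C_def algebra_simps)
    then show "\<exists>s t. m - a = s *\<^sub>R B + t *\<^sub>R C" by blast
  next
    assume "\<exists>s t. m - a = s *\<^sub>R B + t *\<^sub>R C"
    then obtain s t where "m - a = s *\<^sub>R B + t *\<^sub>R C" by blast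
    then have "m = (1 - s - t) *\<^sub>R a + s *\<^sub>R b + t *\<^sub>R c" by (simp add: B_def C_def algebra_simps)
    then show "m \<in> affine hull {a, b, c}"
      unfolding affine_hull_3 by (intro CollectI exI[of _ "1 - s - t"] exI[of _ s] exI[of _ t]) auto
  qed
  \<comment> \<open>Cramer's rule for the two linear equations in \<open>iff\<close>, with
    \<open>m - a\<close> in the span of \<open>B\<close> and \<open>C\<close>.\<close>
  define m0 where "m0 = a + (((C \<bullet> C) * (B \<bullet> B - B \<bullet> C)) / (2 * D)) *\<^sub>R B
    + (((B \<bullet> B) * (C \<bullet> C - B \<bullet> C)) / (2 * D)) *\<^sub>R C"
  have "B \<bullet> (m0 - a) = (norm B)\<^sup>2 / 2"
  proof -
    have "B \<bullet> (m0 - a) = ((C \<bullet> C) * (B \<bullet> B - B \<bullet> C) * (B \<bullet> B) + (B \<bullet> B) * (C \<bullet> C - B \<bullet> C) * (B \<bullet> C)) / (2 * D)"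
      by (simp add: m0_def inner_add_right add_divide_distrib)
    also have "(C \<bullet> C) * (B \<bullet> B - B \<bullet> C) * (B \<bullet> B) + (B \<bullet> B) * (C \<bullet> C - B \<bullet> C) * (B \<bullet> C) = (B \<bullet> B) * D"
      by (simp add: D_def power2_eq_square algebra_simps)
    finally show ?thesis using D by (simp add: power2_norm_eq_inner)
  qed
  moreover have "C \<bullet> (m0 - a) = (norm C)\<^sup>2 / 2"
  proof -
    have "C \<bullet> (m0 - a) = ((C \<bullet> C) * (B \<bullet> B - B \<bullet> C) * (B \<bullet> C) + (B \<bullet> B) * (C \<bullet> C - B \<bullet> C) * (C \<bullet> C)) / (2 * D)"
      by (simp add: m0_def inner_add_right add_divide_distrib inner_commute[of C B])
    also have "(C \<bullet> C) * (B \<bullet> B - B \<bullet> C) * (B \<bullet> C) + (B \<bullet> B) * (C \<bullet> C - B \<bullet> C) * (C \<bullet> C) = (C \<bullet> C) * D"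
      by (simp add: D_def power2_eq_square algebra_simps)
    finally show ?thesis using D by (simp add: power2_norm_eq_inner)
  qed
  moreover have "m0 \<in> affine hull {a, b, c}"
    unfolding hull m0_def
    by (intro exI[of _ "((C \<bullet> C) * (B \<bullet> B - B \<bullet> C)) / (2 * D)"]
        exI[of _ "((B \<bullet> B) * (C \<bullet> C - B \<bullet> C)) / (2 * D)"]) simp
  ultimately have m0: "m0 \<in> affine hull {a, b, c} \<and> dist m0 a = dist m0 b \<and> dist m0 a = dist m0 c"
    using iff by blast
  have uniq: "m = m0" if m: "m \<in> affine hull {a, b, c} \<and> dist m a = dist m b \<and> dist m a = dist m c" for m
  proof -
    obtain s t s' t' where st: "m - a = s *\<^sub>R B + t *\<^sub>R C" "m0 - a = s' *\<^sub>R B + t' *\<^sub>R C"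
      using m m0 hull by blast
    have orth: "B \<bullet> (m - m0) = 0" "C \<bullet> (m - m0) = 0"
      using m m0 iff[of m] iff[of m0] by (simp_all add: inner_diff_right)
    have "m - m0 = (m - a) - (m0 - a)" by simp
    also have "\<dots> = (s - s') *\<^sub>R B + (t - t') *\<^sub>R C" unfolding st by (simp add: algebra_simps)
    finally have e: "m - m0 = (s - s') *\<^sub>R B + (t - t') *\<^sub>R C" .
    have "(m - m0) \<bullet> (m - m0) = ((s - s') *\<^sub>R B + (t - t') *\<^sub>R C) \<bullet> (m - m0)"
      by (subst (1) e) (rule refl)
    also have "\<dots> = 0" by (simp only: inner_add_left inner_scaleR_left orth)
    finally show ?thesis by simp
  qed
  have "circumcenter a b c = m0"
    unfolding circumcenter_def by (rule the_equality, rule m0, rule uniq)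
  with m0 iff[of m0] show "(b - a) \<bullet> (circumcenter a b c - a) = (norm (b - a))\<^sup>2 / 2"
    "(c - a) \<bullet> (circumcenter a b c - a) = (norm (c - a))\<^sup>2 / 2"
    unfolding B_def C_def by blast+
qed

lemma circumcenter_rotate: "circumcenter b c a = circumcenter a b c"
proof -
  have "{b, c, a} = {a, b, c}" by auto
  then show ?thesis unfolding circumcenter_def by (metis (no_types, lifting))
qed

lemma circumcircle_tangent_rotate:
  "circumcircle_tangent b c a p = circumcircle_tangent a b c p"
proof -
  have "cross3 (c - b) (a - b) = cross3 (b - a) (c - a)"
    by (simp add: cross3_simps)
  then show ?thesis by (simp add: circumcircle_tangent_def circumcenter_rotate)
qed

text \<open>Inversion at \<open>a\<close> sends the circumcircle to the line through the images of \<open>b\<close> and \<open>c\<close>.\<close>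

lemma circumcircle_tangent_first:
  assumes "cross3 (b - a) (c - a) \<noteq> 0"
  shows "circumcircle_tangent a b c a
    = ((norm (b - a))\<^sup>2 * (norm (c - a))\<^sup>2 / 2) *\<^sub>R (inversion a b - inversion a c)"
proof -
  define M where "M = circumcenter a b c - a"
  have nz: "b \<noteq> a" "c \<noteq> a" using assms by auto
  have "circumcircle_tangent a b c a = - cross3 (cross3 (b - a) (c - a)) M"
    using cross_minus_right[of "cross3 (b - a) (c - a)" M] by (simp add: circumcircle_tangent_def M_def)
  also have "\<dots> = ((norm (c - a))\<^sup>2 / 2) *\<^sub>R (b - a) - ((norm (b - a))\<^sup>2 / 2) *\<^sub>R (c - a)"
    unfolding cross3_cross3 M_def circumcenter_properties[OF assms] by simp
  also have "\<dots> = ((norm (b - a))\<^sup>2 * (norm (c - a))\<^sup>2 / 2) *\<^sub>R (inversion a b - inversion a c)"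
    using nz by (simp add: inversion_def scaleR_diff_right)
  finally show ?thesis .
qed

text \<open>Both tangents are positive multiples of sides of the inverted link of \<open>x\<close>:
  the first points from the image of \<open>z\<close> to that of \<open>y\<close>, the second from
  the image of \<open>y\<close> on to that of \<open>w\<close>. The angle between them is the
  exterior angle at the image of \<open>y\<close>.\<close>

lemma tangent_angle:
  assumes "cross3 (y - x) (z - x) \<noteq> 0" "cross3 (y - x) (w - x) \<noteq> 0"
  shows "vector_angle (circumcircle_tangent x y z x) (circumcircle_tangent y x w x)
    = pi - point_angle (inversion x z) (inversion x y) (inversion x w)"
proof -
  have nz: "y \<noteq> x" "z \<noteq> x" "w \<noteq> x" using assms by auto
  have "cross3 (w - x) (y - x) \<noteq> 0"
    using assms(2) cross_skew[of "w - x" "y - x"] by simp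
  then have "circumcircle_tangent y x w x
      = ((norm (w - x))\<^sup>2 * (norm (y - x))\<^sup>2 / 2) *\<^sub>R (inversion x w - inversion x y)"
    using circumcircle_tangent_rotate[of x w y x] circumcircle_tangent_first by simp
  moreover have "0 < (norm (w - x))\<^sup>2 * (norm (y - x))\<^sup>2 / 2" "0 < (norm (y - x))\<^sup>2 * (norm (z - x))\<^sup>2 / 2"
    using nz by auto
  ultimately show ?thesis
    using circumcircle_tangent_first[OF assms(1)] 
      vector_angle_minus_left[of "inversion x z - inversion x y" "inversion x w - inversion x y"]
    by (simp add: vector_angle_scale_left vector_angle_scale_right point_angle_def)
qed

subsection \<open>Cycles and local maxima in graphs\<close>

text \<open>Take a longest simple path from \<open>a\<close>. Both neighbours of its end
  \<open>e\<close> lie on it; the one that is not the predecessor of \<open>e\<close> must be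
  \<open>a\<close>, since every inner vertex already has two neighbours. So the path closes up, no
  edge leaves it, and by connectedness it exhausts \<open>N\<close>.\<close>

lemma two_regular_cycle:
  fixes R :: "('a \<times> 'a) set"
  assumes fin: "finite N" and sym: "sym R" and irr: "\<And>x. (x, x) \<notin> R" and RN: "R \<subseteq> N \<times> N"
    and two: "\<And>x. x \<in> N \<Longrightarrow> \<exists>y z. y \<noteq> z \<and> R `` {x} = {y, z}"
    and conn: "\<And>x y. x \<in> N \<Longrightarrow> y \<in> N \<Longrightarrow> (x, y) \<in> R\<^sup>*"
    and a: "a \<in> N"
  obtains xs where "distinct (a # xs)" "set (a # xs) = N" "1 < length xs"
    "successively (\<lambda>x y. (x, y) \<in> R) (a # xs @ [a])"
proof -
  define P where "P l \<longleftrightarrow> l \<noteq> [] \<and> hd l = a \<and> distinct l \<and> set l \<subseteq> N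
    \<and> successively (\<lambda>x y. (x, y) \<in> R) l" for l
  have "length l < Suc (card N)" if "P l" for l
    using that card_mono[OF fin, of "set l"] distinct_card[of l] by (simp add: P_def)
  moreover have "P [a]" using a by (simp add: P_def)
  ultimately obtain l where l: "P l" and max: "\<And>l'. P l' \<Longrightarrow> length l' \<le> length l"
    using ex_has_greatest_nat[of P "[a]" length "Suc (card N)"] by blast
  have lN: "set l \<subseteq> N" and dl: "distinct l" and ne: "l \<noteq> []" and hd: "l ! 0 = a"
    using l by (auto simp: P_def hd_conv_nth)
  have step: "(l ! i, l ! Suc i) \<in> R" if "Suc i < length l" for i
    using l that by (auto simp: P_def successively_conv_nth)
  define n e where "n = length l" and "e = l ! (n - 1)"
  have npos: "0 < n" using ne by (simp add: n_def)
  have e: "e \<in> set l" "e = last l" using ne by (simp_all add: e_def n_def last_conv_nth)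
  have last_closed: "y \<in> set l" if "(e, y) \<in> R" for y
  proof (rule ccontr)
    assume "y \<notin> set l"
    then have "P (l @ [y])"
      using l that RN e(2) ne by (auto simp: P_def successively_append_iff)
    then show False using max by fastforce
  qed
  have uniq: "y \<in> {u, w}" if "x \<in> N" "u \<noteq> w" "(x, u) \<in> R" "(x, w) \<in> R" "(x, y) \<in> R" for x y u w
  proof -
    obtain y' z' where "R `` {x} = {y', z'}" using two \<open>x \<in> N\<close> by blast
    then have "u \<in> {y', z'}" "w \<in> {y', z'}" "y \<in> {y', z'}" using that by auto
    then show ?thesis using \<open>u \<noteq> w\<close> by auto
  qed
  have "n \<noteq> 1"
  proof
    assume "n = 1"
    then have "l = [a]" using hd by (metis One_nat_def length_0_conv length_Suc_conv n_def nth_Cons_0)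
    moreover obtain y where "(a, y) \<in> R" using two[OF a] by blast
    ultimately show False using last_closed[of y] irr e by auto
  qed
  then have n2: "2 \<le> n" using npos by linarith
  define p where "p = l ! (n - 2)"
  have "(p, e) \<in> R" 
  proof -
    have "Suc (n - 2) = n - 1" using n2 by simp
    then show ?thesis using step[of "n - 2"] n2 by (simp add: p_def e_def flip: n_def)
  qed
  then have pe: "(e, p) \<in> R" using sym by (simp add: sym_def)
  have "e \<in> N" using e lN by auto
  then obtain q where q: "q \<noteq> p" "(e, q) \<in> R" using two[of e] by (metis Image_singleton_iff insert_iff)
  then obtain i where i: "i < n" "q = l ! i" using last_closed by (metis in_set_conv_nth n_def)
  have "i \<noteq> n - 1" using q irr i(2) by (auto simp: e_def)
  moreover have "i \<noteq> n - 2" using q i(2) by (auto simp: p_def)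
  ultimately have i2: "Suc i < n - 1" using i(1) by linarith
  have "i = 0"
  proof (rule ccontr)
    assume "i \<noteq> 0"
    then obtain j where j: "i = Suc j" by (cases i) auto
    have qN: "q \<in> N" using i lN n_def by (metis nth_mem subsetD)
    have "(q, l ! j) \<in> R" using step[of j] i(1) sym by (simp add: j i(2) n_def sym_def)
    moreover have "(q, l ! Suc i) \<in> R" using step[of i] i2 by (simp add: i(2) n_def)
    moreover have "(q, e) \<in> R" using q sym by (simp add: sym_def)
    moreover have "l ! j \<noteq> l ! Suc i" "l ! j \<noteq> e" "l ! Suc i \<noteq> e"
      using dl i2 i(1) by (auto simp: j e_def n_def nth_eq_iff_index_eq)
    ultimately show False using uniq[OF qN, of "l ! j" "l ! Suc i" e] by auto
  qed
  then have qa: "q = a" using i hd by simp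
  have n3: "2 < n" using i2 \<open>i = 0\<close> by linarith
  have ea: "(e, a) \<in> R" "(a, e) \<in> R" using q qa sym by (auto simp: sym_def)
  have closed: "y \<in> set l" if x: "x \<in> set l" "(x, y) \<in> R" for x y
  proof -
    obtain k where k: "k < n" "x = l ! k" using x by (metis in_set_conv_nth n_def)
    have xN: "x \<in> N" using x lN by auto
    consider "k = n - 1" | "k = 0" | "0 < k" "Suc k < n" using k(1) by linarith
    then show ?thesis
    proof cases
      case 1
      then show ?thesis using last_closed x k by (simp add: e_def)
    next
      case 2
      have "l ! 1 \<noteq> e" using dl n3 by (auto simp: e_def n_def nth_eq_iff_index_eq)
      moreover have "(x, l ! 1) \<in> R" using step[of 0] 2 k n3 by (simp add: n_def)
      moreover have "(x, e) \<in> R" using ea hd k 2 by simp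
      ultimately have "y \<in> {l ! 1, e}" using uniq[OF xN] x(2) by blast
      then show ?thesis using e n3 by (auto simp: n_def)
    next
      case 3
      then obtain j where j: "k = Suc j" by (cases k) auto
      have "l ! j \<noteq> l ! Suc k" using dl 3 by (auto simp: j n_def nth_eq_iff_index_eq)
      moreover have "(x, l ! j) \<in> R" using step[of j] k sym by (simp add: j n_def sym_def)
      moreover have "(x, l ! Suc k) \<in> R" using step[of k] 3 k by (simp add: n_def)
      ultimately have "y \<in> {l ! j, l ! Suc k}" using uniq[OF xN] x(2) by blast
      then show ?thesis using 3 by (auto simp: n_def j)
    qed
  qed
  have "y \<in> set l" if "(a, y) \<in> R\<^sup>*" for y
    using that
  proof induction
    case base
    then show ?case using hd npos n_def by (metis nth_mem)
  qed (use closed in blast)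
  then have "set l = N" using conn[OF a] lN by blast
  moreover obtain xs where xs: "l = a # xs" using hd ne by (cases l) auto
  moreover have "xs \<noteq> []" using n3 by (auto simp: n_def xs)
  moreover from this have "successively (\<lambda>x y. (x, y) \<in> R) (a # xs @ [a])"
    using l ea e(2) xs by (auto simp: P_def successively_append_iff successively_Cons)
  ultimately show thesis using that[of xs] dl n3 by (simp add: n_def)
qed

text \<open>The lower set \<open>A\<close> of avoided vertices is enlarged one vertex at a time; a walk through the
  new vertex is rerouted through its upper neighbours.\<close>

lemma local_max_imp_global_max:
  fixes f :: "'a \<Rightarrow> real" and E :: "('a \<times> 'a) set"
  assumes fin: "finite V" and EV: "E \<subseteq> V \<times> V" and inj: "inj_on f V" and sym: "sym E"
    and upper: "\<And>w a b. (w, a) \<in> E \<Longrightarrow> (w, b) \<in> E \<Longrightarrow> f w < f a \<Longrightarrow> f w < f b \<Longrightarrow>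
      (a, b) \<in> (E \<inter> {(x, y). f w < f x \<and> f w < f y})\<^sup>*"
    and conn: "\<And>x y. x \<in> V \<Longrightarrow> y \<in> V \<Longrightarrow> (x, y) \<in> E\<^sup>*"
    and v: "v \<in> V" and loc: "\<And>x. (v, x) \<in> E \<Longrightarrow> f x < f v" and p: "p \<in> V"
  shows "f p \<le> f v"
proof (rule ccontr)
  assume pv: "\<not> f p \<le> f v"
  define U where "U A = E \<inter> {(x, y). x \<notin> A \<and> y \<notin> A}" for A
  have reach: "(v, p) \<in> (U A)\<^sup>*"
    if "finite A" "A \<subseteq> V" "\<And>x y. x \<in> A \<Longrightarrow> y \<in> V \<Longrightarrow> f y < f x \<Longrightarrow> y \<in> A" "v \<notin> A" "p \<notin> A" for A
    using that
  proof (induction A rule: finite_ranking_induct[where f = f])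
    case empty
    then show ?case using conn[OF v p] by (simp add: U_def)
  next
    case (insert w A)
    \<comment> \<open>Elements are inserted by increasing \<open>f\<close>, so \<open>A\<close> is
      itself a lower set, and the vertices outside \<open>insert w A\<close> are exactly those above
      \<open>w\<close>.\<close>
    have lower: "x \<in> A \<Longrightarrow> y \<in> V \<Longrightarrow> f y < f x \<Longrightarrow> y \<in> A" for x y
      using insert(2)[of x] insert(5)[of x y] by auto
    show ?case
    proof (cases "w \<in> A")
      case True
      then show ?thesis using insert by (simp add: insert_absorb)
    next
      case False
      have IH: "(v, p) \<in> (U A)\<^sup>*" using insert(3)[OF _ lower] insert(4,6,7) by auto
      have wV: "w \<in> V" using insert(4) by simp
      have above: "x \<notin> insert w A \<longleftrightarrow> f w < f x" if "x \<in> V" for x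
      proof
        assume "x \<notin> insert w A"
        then show "f w < f x"
          using insert(5)[of w x] that inj wV by (metis insertI1 inj_on_def linorder_neqE_linordered_idom)
      next
        assume "f w < f x"
        then show "x \<notin> insert w A" using insert(2)[of x] by auto
      qed
      have UV: "U (insert w A) = E \<inter> {(x, y). f w < f x \<and> f w < f y}"
        unfolding U_def using above EV by auto
      \<comment> \<open>The walk may currently stand at the forbidden vertex \<open>w\<close>. The
        second clause records what is needed to leave it: every upper neighbour of \<open>w\<close>
        is reachable without \<open>w\<close>.\<close>
      have "(z \<noteq> w \<longrightarrow> (v, z) \<in> (U (insert w A))\<^sup>*) \<and>
          (z = w \<longrightarrow> (\<forall>b. (w, b) \<in> E \<and> f w < f b \<longrightarrow> (v, b) \<in> (U (insert w A))\<^sup>*))"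
        if "(v, z) \<in> (U A)\<^sup>*" for z
        using that
      proof induction
        case base
        then show ?case using insert(6) by auto
      next
        case (step y z)
        have E: "(y, z) \<in> E" "y \<notin> A" "z \<notin> A" using step(2) by (auto simp: U_def)
        then have V: "y \<in> V" "z \<in> V" using EV by auto
        consider "y = w" "z = w" | "y = w" "z \<noteq> w" | "y \<noteq> w" "z = w" | "y \<noteq> w" "z \<noteq> w" by blast
        then show ?case
        proof cases
          case 1
          then show ?thesis using step by auto
        next
          case 2
          then show ?thesis using step E V above[of z] by auto
        next
          case 3
          have "(v, b) \<in> (U (insert w A))\<^sup>*" if b: "(w, b) \<in> E" "f w < f b" for b
          proof -
            have "(w, y) \<in> E" using E 3 sym by (auto simp: sym_def)
            moreover have "f w < f y" using above[OF V(1)] E 3 by auto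
            ultimately have "(y, b) \<in> (U (insert w A))\<^sup>*" unfolding UV using upper b by blast
            moreover have "(v, y) \<in> (U (insert w A))\<^sup>*" using step 3 by blast
            ultimately show ?thesis by (rule rtrancl_trans[rotated])
          qed
          then show ?thesis using 3 by auto
        next
          case 4
          then have "(y, z) \<in> U (insert w A)" using E by (auto simp: U_def)
          then show ?thesis using step 4 by (auto intro: rtrancl_into_rtrancl)
        qed
      qed
      then show ?thesis using IH insert(7) by auto
    qed
  qed
  \<comment> \<open>Once everything below \<open>v\<close> is removed, \<open>v\<close> has no
    neighbours left, so no walk to \<open>p\<close> can start.\<close>
  define A where "A = {x \<in> V. f x < f v}"
  have "(v, p) \<in> (U A)\<^sup>*"
    using fin pv by (intro reach) (auto simp: A_def)
  then show False
  proof (cases rule: converse_rtranclE)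
    case base
    then show ?thesis using pv by simp
  next
    case (step y)
    then have "(v, y) \<in> E" "y \<notin> A" by (auto simp: U_def)
    then show ?thesis using loc[of y] EV by (auto simp: A_def)
  qed
qed

subsection \<open>Stars and links of a closed surface\<close>

locale closed_surface =
  fixes K :: "(real^3) set set"
  assumes closed_surface: "closed_simplicial_surface K"
begin

lemma complex: "simplicial_complex K"
  using closed_surface by (simp add: closed_simplicial_surface_def)

lemma finite_complex: "finite K"
  using complex by (simp add: simplicial_complex_def)

lemma simplex_in_complex: "s \<in> K \<Longrightarrow> \<exists>C. \<not> affine_dependent C \<and> s = convex hull C"
  using complex unfolding simplicial_complex_def simplex_def by blast

lemma face_in_complex: "F face_of S \<Longrightarrow> S \<in> K \<Longrightarrow> F \<in> K"
  using complex unfolding simplicial_complex_def by blast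

lemma Int_face_of: "S \<in> K \<Longrightarrow> T \<in> K \<Longrightarrow> (S \<inter> T) face_of S"
  using complex unfolding simplicial_complex_def by blast

lemma subset_in_complex:
  "\<not> affine_dependent S \<Longrightarrow> convex hull S \<in> K \<Longrightarrow> A \<subseteq> S \<Longrightarrow> convex hull A \<in> K"
  by (metis face_in_complex face_of_convex_hull_affine_independent)

lemma vertex_in_simplex:
  assumes "convex hull C \<in> K" "v \<in> convex hull C" "v \<in> verts K"
  shows "v \<in> C"
proof -
  have "(convex hull C \<inter> {v}) face_of convex hull C"
    using assms by (intro Int_face_of) (auto simp: verts_def)
  then have "v extreme_point_of (convex hull C)"
    using assms(2) by (simp add: face_of_singleton)
  then show ?thesis by (rule extreme_point_of_convex_hull)
qed

text \<open>The form in which embeddedness is used later. The common face is spanned by some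
  vertices of \<open>S\<close>; these are vertices of the complex that lie in the other simplex,
  hence belong to \<open>T\<close>.\<close>

lemma hull_Int:
  assumes S: "\<not> affine_dependent S" "convex hull S \<in> K" and T: "\<not> affine_dependent T" "convex hull T \<in> K"
  shows "convex hull S \<inter> convex hull T = convex hull (S \<inter> T)"
proof
  show "convex hull (S \<inter> T) \<subseteq> convex hull S \<inter> convex hull T"
    by (simp add: hull_mono)
  obtain c where c: "c \<subseteq> S" "convex hull S \<inter> convex hull T = convex hull c"
    using Int_face_of[OF S(2) T(2)] face_of_convex_hull_affine_independent[OF S(1)] by blast
  have "c \<subseteq> T"
  proof
    fix x assume x: "x \<in> c"
    then have "x \<in> convex hull T" using c(2) by (metis IntD2 hull_inc)
    moreover have "x \<in> verts K"
      using subset_in_complex[OF S, of "{x}"] x c(1) by (auto simp: verts_def)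
    ultimately show "x \<in> T" using vertex_in_simplex T by blast
  qed
  then show "convex hull S \<inter> convex hull T \<subseteq> convex hull (S \<inter> T)"
    using c by (simp add: hull_mono)
qed

lemma hull_inj:
  fixes S T :: "(real^3) set"
  assumes "\<not> affine_dependent S" "\<not> affine_dependent T" "convex hull S = convex hull T"
  shows "S = T"
  using assms extreme_point_of_convex_hull_affine_independent[of S] extreme_point_of_convex_hull_affine_independent[of T]
  by auto

lemma triangleD:
  assumes "convex hull {x, y, z} \<in> faces K"
  shows "x \<noteq> y" "y \<noteq> z" "x \<noteq> z" "\<not> affine_dependent {x, y, z}" "convex hull {x, y, z} \<in> K"
proof -
  have "2 simplex (convex hull {x, y, z})" using assms by (simp add: faces_def)
  then have dim: "aff_dim {x, y, z} = 2" using aff_dim_simplex by (metis aff_dim_convex_hull)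
  moreover have "aff_dim {x, y, z} \<le> int (card {x, y, z}) - 1"
    by (rule aff_dim_le_card) simp
  ultimately have "3 \<le> card {x, y, z}" by linarith
  moreover have "card {x, y, z} \<le> 3" by (simp add: card_insert_if)
  ultimately have card: "card {x, y, z} = 3" by simp
  then show "\<not> affine_dependent {x, y, z}" using dim by (simp add: affine_independent_iff_card)
  show "x \<noteq> y" "y \<noteq> z" "x \<noteq> z" using card by (auto simp: card_insert_if split: if_splits)
  show "convex hull {x, y, z} \<in> K" using assms by (simp add: faces_def)
qed

lemma triangle_cross:
  assumes "convex hull {v, x, y} \<in> faces K"
  shows "cross3 (x - v) (y - v) \<noteq> 0"
proof -
  have "\<not> collinear {x, v, y}"
    using triangleD[OF assms] collinear_3_eq_affine_dependent[of v x y] by (simp add: insert_commute)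
  then have "\<not> collinear {0, x - v, y - v}" using collinear_3[of x v y] by (simp add: NO_MATCH_def)
  then show ?thesis by (metis cross_eq_0)
qed

lemma face_hull:
  assumes "t \<in> faces K"
  obtains C where "\<not> affine_dependent C" "card C = 3" "t = convex hull C" "finite C"
proof -
  obtain C where C: "\<not> affine_dependent C" "int (card C) = 2 + 1" "t = convex hull C"
    using assms by (auto simp: faces_def simplex_def)
  then show thesis using that aff_independent_finite[OF C(1)] by simp
qed

definition nbrs :: "real^3 \<Rightarrow> (real^3) set"
  where "nbrs v = {x. x \<noteq> v \<and> convex hull {v, x} \<in> K}"

definition link :: "real^3 \<Rightarrow> ((real^3) \<times> (real^3)) set"
  where "link v = {(x, y). convex hull {v, x, y} \<in> faces K}"

lemma nbrs_verts: assumes "x \<in> nbrs v" shows "v \<in> verts K" "x \<in> verts K"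
  using subset_in_complex[of "{v, x}" "{v}"] subset_in_complex[of "{v, x}" "{x}"] assms
  by (auto simp: nbrs_def verts_def)

lemma nbrs_commute: "x \<in> nbrs v \<longleftrightarrow> v \<in> nbrs x"
  by (auto simp: nbrs_def insert_commute)

lemma finite_nbrs: "finite (nbrs v)"
  by (rule finite_subset[OF _ finite_verts[OF complex]]) (use nbrs_verts in blast)

lemma link_swap: "(x, y) \<in> link v \<longleftrightarrow> (y, x) \<in> link v"
  by (simp add: link_def insert_commute)

lemma link_rotate: "(x, y) \<in> link v \<longleftrightarrow> (v, y) \<in> link x"
  by (simp add: link_def insert_commute)

lemma linkD:
  assumes "(x, y) \<in> link v"
  shows "x \<noteq> y" "x \<in> nbrs v" "y \<in> nbrs v" "y \<in> nbrs x"
proof -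
  have t: "convex hull {v, x, y} \<in> faces K" using assms by (simp add: link_def)
  show "x \<noteq> y" "x \<in> nbrs v" "y \<in> nbrs v" "y \<in> nbrs x"
    using triangleD[OF t] subset_in_complex[of "{v, x, y}" "{v, x}"]
      subset_in_complex[of "{v, x, y}" "{v, y}"] subset_in_complex[of "{v, x, y}" "{x, y}"]
    by (auto simp: nbrs_def)
qed

lemma edge_nbrs: "x \<in> nbrs v \<Longrightarrow> convex hull {v, x} \<in> edges K"
  using simplex_convex_hull[of "{v, x}" 1] by (auto simp: nbrs_def edges_def)

lemma edge_at:
  assumes "e \<in> edges K" "v \<in> e" "v \<in> verts K"
  obtains x where "x \<in> nbrs v" "e = convex hull {v, x}"
proof -
  obtain C where C: "int (card C) = 1 + 1" "e = convex hull C" "e \<in> K"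
    using assms(1) by (auto simp: edges_def simplex_def)
  have "v \<in> C" using vertex_in_simplex[of C v] C assms by simp
  moreover have "card C = 2" using C(1) by simp
  ultimately obtain x where "C = {v, x}" "x \<noteq> v"
    by (metis card_2_iff doubleton_eq_iff insertE singletonD)
  then show thesis using that[of x] C by (simp add: nbrs_def)
qed

lemma triangle_at:
  assumes "t \<in> faces K" "v \<in> t" "v \<in> verts K"
  obtains x y where "(x, y) \<in> link v" "t = convex hull {v, x, y}"
proof -
  obtain C where C: "card C = 3" "t = convex hull C" "finite C" using face_hull[OF assms(1)] by metis
  have "v \<in> C" using vertex_in_simplex[of C v] C assms by (simp add: faces_def)
  then have "card (C - {v}) = 2" using C by simp
  then obtain x y where "C - {v} = {x, y}" by (metis card_2_iff)
  then have "C = {v, x, y}" using \<open>v \<in> C\<close> by auto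
  then show thesis using that[of x y] C assms(1) by (simp add: link_def)
qed

lemma triangle_at_edge:
  assumes "t \<in> faces K" "convex hull {v, x} \<subseteq> t" "x \<in> nbrs v"
  obtains y where "(x, y) \<in> link v" "t = convex hull {v, x, y}"
proof -
  have "v \<in> t" "x \<in> t" using assms(2) by (metis hull_inc insertCI subsetD)+
  then obtain a b where ab: "(a, b) \<in> link v" "t = convex hull {v, a, b}"
    using triangle_at[OF assms(1)] nbrs_verts[OF assms(3)] by metis
  have "x \<in> {v, a, b}"
    using vertex_in_simplex[of "{v, a, b}" x] nbrs_verts[OF assms(3)] \<open>x \<in> t\<close> ab assms(1) by (simp add: faces_def)
  then have "x = a \<or> x = b" using assms(3) by (auto simp: nbrs_def)
  then show thesis
  proof
    assume "x = a" then show thesis using that[of b] ab by simp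
  next
    assume "x = b" then show thesis using that[of a] ab link_swap[of a b] by (simp add: insert_commute)
  qed
qed

lemma link_triangle_eq:
  assumes "(x, y) \<in> link v" "(x, z) \<in> link v" "convex hull {v, x, y} = convex hull {v, x, z}"
  shows "y = z"
proof -
  have "\<not> affine_dependent {v, x, y}" "\<not> affine_dependent {v, x, z}"
    using assms(1,2) triangleD(4) by (auto simp: link_def)
  then have "{v, x, y} = {v, x, z}" using hull_inj assms(3) by blast
  then show ?thesis using linkD[OF assms(1)] linkD[OF assms(2)] by (auto simp: nbrs_def)
qed

lemma link_two:
  assumes "x \<in> nbrs v"
  shows "\<exists>y z. y \<noteq> z \<and> link v `` {x} = {y, z}"
proof -
  let ?e = "convex hull {v, x}"
  have "card {t \<in> faces K. ?e \<subseteq> t} = 2"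
    using edge_nbrs[OF assms] closed_surface by (simp add: closed_simplicial_surface_def)
  then obtain s t where st: "s \<noteq> t" "{t \<in> faces K. ?e \<subseteq> t} = {s, t}"
    unfolding card_2_iff by blast
  then have s: "s \<in> faces K" "?e \<subseteq> s" and t: "t \<in> faces K" "?e \<subseteq> t" by blast+
  obtain y where y: "(x, y) \<in> link v" "s = convex hull {v, x, y}" using triangle_at_edge[OF s assms] .
  obtain z where z: "(x, z) \<in> link v" "t = convex hull {v, x, z}" using triangle_at_edge[OF t assms] .
  have "w \<in> {y, z}" if w: "(x, w) \<in> link v" for w
  proof -
    have "convex hull {v, x, w} \<in> {t \<in> faces K. ?e \<subseteq> t}"
      using w hull_mono[of "{v, x}" "{v, x, w}" convex] by (simp add: link_def)
    then have "convex hull {v, x, w} = s \<or> convex hull {v, x, w} = t" using st(2) by blast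
    then show ?thesis using link_triangle_eq[OF w y(1)] link_triangle_eq[OF w z(1)] y(2) z(2) by blast
  qed
  then have "link v `` {x} = {y, z}" using y(1) z(1) by blast
  moreover have "y \<noteq> z" using st(1) y z by blast
  ultimately show ?thesis by blast
qed

lemma nbrs_nonempty: assumes "v \<in> verts K" shows "nbrs v \<noteq> {}"
proof -
  obtain t where "t \<in> faces K" "{v} \<subseteq> t"
    using assms closed_surface unfolding closed_simplicial_surface_def verts_def by blast
  then obtain x y where "(x, y) \<in> link v" using triangle_at[of t v] assms by (metis insert_subset)
  then show ?thesis using linkD by blast
qed

text \<open>Triangles at \<open>v\<close> that share an edge at \<open>v\<close> share its other
  end, so a chain of adjacent triangles gives a path in the link. The induction treats both orders
  of the two vertices opposite \<open>v\<close>.\<close>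

lemma link_connected:
  assumes x: "x \<in> nbrs v" and y: "y \<in> nbrs v"
  shows "(x, y) \<in> (link v)\<^sup>*"
proof -
  have vV: "v \<in> verts K" using nbrs_verts[OF x] by simp
  obtain x' where x': "(x, x') \<in> link v" using link_two[OF x] by blast
  obtain y' where y': "(y, y') \<in> link v" using link_two[OF y] by blast
  have sym: "sym ((link v)\<^sup>*)" by (rule sym_rtrancl) (meson link_swap symI)
  let ?s = "convex hull {v, x, x'}" and ?t = "convex hull {v, y, y'}"
  have faces: "?s \<in> faces K" "?t \<in> faces K" using x' y' by (auto simp: link_def)
  have "v \<in> ?s" "v \<in> ?t" by (simp_all add: hull_inc)
  then have path: "(?s, ?t) \<in> (adjacent_at K v)\<^sup>*"
    using closed_surface vV faces unfolding closed_simplicial_surface_def by blast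
  have "(x, c) \<in> (link v)\<^sup>*" if "(?s, u) \<in> (adjacent_at K v)\<^sup>*" "(c, d) \<in> link v" "u = convex hull {v, c, d}" for u c d
    using that
  proof (induction arbitrary: c d)
    case base
    have "\<not> affine_dependent {v, x, x'}" "\<not> affine_dependent {v, c, d}"
      using x' base(1) triangleD(4) by (auto simp: link_def)
    then have "{v, x, x'} = {v, c, d}" using hull_inj base(2) by blast
    then have "c = x \<or> c = x'" using linkD(2)[OF base(1)] by (auto simp: nbrs_def)
    then show ?case using x' by auto
  next
    case (step t u)
    have adj: "t \<in> faces K" "u \<in> faces K" "v \<in> t" "v \<in> u" "t \<inter> u \<in> edges K"
      using step(2) by (auto simp: adjacent_at_def)
    obtain a b where ab: "(a, b) \<in> link v" "t = convex hull {v, a, b}" using triangle_at adj vV by blast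
    have ind: "\<not> affine_dependent {v, a, b}" "\<not> affine_dependent {v, c, d}"
      using ab step(4) triangleD(4) by (auto simp: link_def)
    have "t \<inter> u = convex hull ({v, a, b} \<inter> {v, c, d})"
      using hull_Int[OF ind(1) _ ind(2)] ab step adj by (simp add: faces_def)
    moreover obtain z where z: "z \<in> nbrs v" "t \<inter> u = convex hull {v, z}"
      using edge_at[OF adj(5)] adj(3,4) vV by blast
    moreover have "\<not> affine_dependent ({v, a, b} \<inter> {v, c, d})"
      by (rule affine_independent_subset[OF ind(1)]) auto
    ultimately have "{v, a, b} \<inter> {v, c, d} = {v, z}"
      using hull_inj[OF _ affine_independent_2] by metis
    moreover have "z \<noteq> v" using z by (simp add: nbrs_def)
    ultimately have "z \<in> {a, b}" "z \<in> {c, d}" by auto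
    moreover have "(x, a) \<in> (link v)\<^sup>*" "(x, b) \<in> (link v)\<^sup>*"
      using step(3)[OF ab] step(3)[of b a] ab link_swap by (auto simp: insert_commute)
    ultimately have "(x, z) \<in> (link v)\<^sup>*" by auto
    moreover have "(z, c) \<in> (link v)\<^sup>*"
      using \<open>z \<in> {c, d}\<close> step(4) link_swap by auto
    ultimately show ?case by (rule rtrancl_trans)
  qed
  then show ?thesis using path y' by blast
qed

definition link_cycle :: "real^3 \<Rightarrow> (real^3) list \<Rightarrow> bool"
  where "link_cycle v xs \<longleftrightarrow> distinct xs \<and> 2 < length xs \<and> set xs = nbrs v
    \<and> successively (\<lambda>x y. (x, y) \<in> link v) (xs @ [hd xs])"

lemma link_cycle_exists:
  assumes "a \<in> nbrs v"
  obtains xs where "link_cycle v (a # xs)"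
proof -
  obtain xs where "distinct (a # xs)" "set (a # xs) = nbrs v" "1 < length xs"
    "successively (\<lambda>x y. (x, y) \<in> link v) (a # xs @ [a])"
  proof (rule two_regular_cycle[of "nbrs v" "link v" a])
    show "sym (link v)" by (meson link_swap symI)
    show "link v \<subseteq> nbrs v \<times> nbrs v" by (auto dest: linkD)
    show "(x, x) \<notin> link v" for x by (auto dest: linkD)
  qed (use finite_nbrs link_two link_connected assms in auto)
  then show thesis using that[of xs] by (simp add: link_cycle_def)
qed

text \<open>The description in \<open>beta\<close> must give one value for all labellings of the
  edge: exchanging the opposite vertices is symmetry of the angle, exchanging the ends of the edge
  is \<open>point_angle_inversion_swap\<close>.\<close>

lemma beta_eq:
  assumes y: "(x, y) \<in> link v" and z: "(x, z) \<in> link v" and yz: "y \<noteq> z"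
  shows "beta K (convex hull {v, x}) = pi - point_angle (inversion v y) (inversion v x) (inversion v z)"
proof -
  let ?e = "convex hull {v, x}"
  have x: "x \<in> nbrs v" using linkD[OF y] by simp
  have third: "w \<in> {y, z}" if "(x, w) \<in> link v" for w
  proof -
    obtain y' z' where "link v `` {x} = {y', z'}" using link_two[OF x] by blast
    then have "y \<in> {y', z'}" "z \<in> {y', z'}" "w \<in> {y', z'}" using that y z by auto
    then show ?thesis using yz by auto
  qed
  have angle: "vector_angle (circumcircle_tangent a b c a) (circumcircle_tangent b a d a)
      = pi - point_angle (inversion a c) (inversion a b) (inversion a d)"
    if "(b, c) \<in> link a" "(b, d) \<in> link a" for a b c d
    using that triangle_cross by (intro tangent_angle) (auto simp: link_def)
  have faces: "convex hull {v, x, y} \<in> faces K" "convex hull {x, v, z} \<in> faces K"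
    using y z by (auto simp: link_def insert_commute)
  show ?thesis unfolding beta_def
  proof (rule the_equality)
    show "\<exists>x' y' z' w. ?e = convex hull {x', y'} \<and> z' \<noteq> w \<and> convex hull {x', y', z'} \<in> faces K \<and>
      convex hull {y', x', w} \<in> faces K \<and>
      pi - point_angle (inversion v y) (inversion v x) (inversion v z)
        = vector_angle (circumcircle_tangent x' y' z' x') (circumcircle_tangent y' x' w x')"
      by (intro exI[of _ v] exI[of _ x] exI[of _ y] exI[of _ z] conjI refl yz faces angle[OF y z, symmetric])
  next
    fix b assume "\<exists>x' y' z' w. ?e = convex hull {x', y'} \<and> z' \<noteq> w \<and> convex hull {x', y', z'} \<in> faces K \<and>
      convex hull {y', x', w} \<in> faces K \<and>
      b = vector_angle (circumcircle_tangent x' y' z' x') (circumcircle_tangent y' x' w x')"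
    then obtain x' y' z' w where e: "?e = convex hull {x', y'}" and ne: "z' \<noteq> w"
      and f: "(y', z') \<in> link x'" "(y', w) \<in> link x'"
      and b: "b = vector_angle (circumcircle_tangent x' y' z' x') (circumcircle_tangent y' x' w x')"
      by (auto simp: link_def insert_commute)
    have b': "b = pi - point_angle (inversion x' z') (inversion x' y') (inversion x' w)"
      using angle[OF f] b by simp
    have "{x', y'} = {v, x}" using hull_inj[OF affine_independent_2 affine_independent_2] e by metis
    then consider "x' = v" "y' = x" | "x' = x" "y' = v" by (metis doubleton_eq_iff)
    then show "b = pi - point_angle (inversion v y) (inversion v x) (inversion v z)"
    proof cases
      case 1
      then have "z' \<in> {y, z}" "w \<in> {y, z}" using third f by auto
      then show ?thesis using b' 1 ne point_angle_commute by auto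
    next
      case 2
      then have f': "(x, z') \<in> link v" "(x, w) \<in> link v" using f link_rotate by auto
      then have "z' \<in> {y, z}" "w \<in> {y, z}" using third by auto
      moreover have "b = pi - point_angle (inversion v z') (inversion v x) (inversion v w)"
        using b' 2 point_angle_inversion_swap[of x v z' w] linkD[OF f'(1)] linkD[OF f'(2)]
        by (auto simp: nbrs_def)
      ultimately show ?thesis using ne point_angle_commute by auto
    qed
  qed
qed

end

subsection \<open>The energy at a vertex\<close>

text \<open>The decompositions in the hypothesis are the consecutive triples of \<open>l\<close>;
  their middle entries form \<open>butlast (tl l)\<close>.\<close>

lemma path_angles_map:
  assumes "\<And>us p q r ws. l = us @ p # q # r # ws \<Longrightarrow> f q = point_angle (g p) (g q) (g r)"
  shows "path_angles (map g l) = sum_list (map f (butlast (tl l)))"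
  using assms
proof (induction l)
  case (Cons a l)
  show ?case
  proof (cases "\<exists>b c ws. l = b # c # ws")
    case True
    then obtain b c ws where l: "l = b # c # ws" by blast
    have "path_angles (map g l) = sum_list (map f (butlast (tl l)))"
    proof (rule Cons.IH)
      fix us p q r ws assume "l = us @ p # q # r # ws"
      then show "f q = point_angle (g p) (g q) (g r)" using Cons.prems[of "a # us"] by simp
    qed
    moreover have "f b = point_angle (g a) (g b) (g c)" using Cons.prems[of "[]"] l by simp
    ultimately show ?thesis by (simp add: l)
  next
    case False
    then have "l = [] \<or> (\<exists>b. l = [b])" by (metis neq_Nil_conv)
    then show ?thesis by auto
  qed
qed simp

lemma successively_rtrancl:
  "successively (\<lambda>x y. (x, y) \<in> R) (x # xs) \<Longrightarrow> (x, last (x # xs)) \<in> R\<^sup>*"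
proof (induction xs arbitrary: x)
  case (Cons y xs)
  then have "(x, y) \<in> R" "(y, last (y # xs)) \<in> R\<^sup>*" by auto
  then show ?case by (simp add: converse_rtrancl_into_rtrancl)
qed simp

context closed_surface
begin

lemma link_cycle_consecutive:
  assumes "link_cycle v xs" "xs @ take 2 xs = us @ p # q # r # ws"
  shows "(p, q) \<in> link v" "(q, r) \<in> link v" "p \<noteq> r"
proof -
  obtain a b t where xs: "xs = a # b # t"
    using assms(1) unfolding link_cycle_def by (metis Suc_le_length_iff Suc_leI numeral_2_eq_2)
  have "successively (\<lambda>x y. (x, y) \<in> link v) ((a # b # t @ [a]) @ [b])"
    using assms(1) by (subst successively_append_iff) (simp add: link_cycle_def xs)
  then have "successively (\<lambda>x y. (x, y) \<in> link v) (us @ p # q # r # ws)"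
    using assms(2) by (simp only: xs take_Suc_Cons numeral_2_eq_2 take0 append_Cons append_Nil append_assoc)
  then show "(p, q) \<in> link v" "(q, r) \<in> link v"
    by (auto simp: successively_append_iff)
  let ?l = "xs @ take 2 xs" and ?n = "length xs" and ?i = "length us"
  have n: "2 < ?n" and d: "distinct xs" using assms(1) by (auto simp: link_cycle_def)
  have "length ?l = ?n + 2" using n by simp
  then have i: "?i + 2 < ?n + 2" using assms(2) by simp
  have "p = ?l ! ?i" "r = ?l ! (?i + 2)" by (simp_all add: assms(2) nth_append)
  then have "p = xs ! ?i" "r = (if ?i + 2 < ?n then xs ! (?i + 2) else xs ! (?i + 2 - ?n))"
    using i by (simp_all add: nth_append)
  \<comment> \<open>Positions two apart stay different modulo the length, because the cycle has more
    than two entries.\<close>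
  moreover have "(if ?i + 2 < ?n then ?i + 2 else ?i + 2 - ?n) \<noteq> ?i"
    "(if ?i + 2 < ?n then ?i + 2 else ?i + 2 - ?n) < ?n" using n i by auto
  ultimately show "p \<noteq> r" using d i by (auto simp: nth_eq_iff_index_eq split: if_splits)
qed

lemma inversion_inj_on: "inj_on (inversion v) (nbrs v)"
  by (rule inj_onI) (auto simp: nbrs_def intro: inversion_inj)

lemma willmore_at_link_cycle:
  assumes xs: "link_cycle v xs"
  shows "willmore_at K v = (real (length xs) - 2) * pi - polygon_angles (map (inversion v) xs)"
proof -
  have set: "set xs = nbrs v" and d: "distinct xs" and len: "2 < length xs"
    using xs by (auto simp: link_cycle_def)
  then have "nbrs v \<noteq> {}" by auto
  then have vV: "v \<in> verts K" using nbrs_verts by blast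
  have edges: "{e \<in> edges K. v \<in> e} = (\<lambda>x. convex hull {v, x}) ` nbrs v"
  proof
    show "{e \<in> edges K. v \<in> e} \<subseteq> (\<lambda>x. convex hull {v, x}) ` nbrs v"
      using edge_at[OF _ _ vV] by blast
    show "(\<lambda>x. convex hull {v, x}) ` nbrs v \<subseteq> {e \<in> edges K. v \<in> e}"
      using edge_nbrs by (auto simp: hull_inc)
  qed
  have inj: "inj_on (\<lambda>x. convex hull {v, x}) (nbrs v)"
  proof (rule inj_onI)
    fix x y assume "convex hull {v, x} = convex hull {v, y}" "x \<in> nbrs v" "y \<in> nbrs v"
    moreover from this(1) have "{v, x} = {v, y}"
      using hull_inj[OF affine_independent_2 affine_independent_2] by blast
    ultimately show "x = y" by (auto simp: nbrs_def)
  qed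
  define f where "f x = pi - beta K (convex hull {v, x})" for x
  have "polygon_angles (map (inversion v) xs) = path_angles (map (inversion v) (xs @ take 2 xs))"
    by (simp add: polygon_angles_def take_map)
  also have "\<dots> = sum_list (map f (butlast (tl (xs @ take 2 xs))))"
  proof (rule path_angles_map)
    fix us p q r ws assume "xs @ take 2 xs = us @ p # q # r # ws"
    note c = link_cycle_consecutive[OF xs this]
    show "f q = point_angle (inversion v p) (inversion v q) (inversion v r)"
      unfolding f_def using beta_eq[of q p v r] c link_swap[of p q v] by simp
  qed
  \<comment> \<open>The inner entries of the closed-up list are \<open>xs\<close> rotated by
    one.\<close>
  also have "\<dots> = sum_list (map f xs)"
  proof -
    obtain a b t where "xs = a # b # t"
      using len by (metis Suc_le_length_iff Suc_leI numeral_2_eq_2)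
    then show ?thesis by (simp add: butlast_append)
  qed
  also have "\<dots> = (\<Sum>x\<in>nbrs v. f x)" using sum_list_distinct_conv_sum_set[OF d] set by simp
  also have "\<dots> = real (length xs) * pi - (\<Sum>x\<in>nbrs v. beta K (convex hull {v, x}))"
    using distinct_card[OF d] set by (simp add: f_def sum_subtractf)
  also have "(\<Sum>x\<in>nbrs v. beta K (convex hull {v, x})) = (\<Sum>e | e \<in> edges K \<and> v \<in> e. beta K e)"
    unfolding edges by (simp add: sum.reindex[OF inj])
  finally show ?thesis by (simp add: willmore_at_def algebra_simps)
qed

lemma distinct_link_inversion:
  assumes "link_cycle v xs" shows "distinct (map (inversion v) xs)"
  using assms inversion_inj_on by (simp add: link_cycle_def distinct_map)

lemma willmore_at_nonneg:
  assumes "v \<in> verts K" shows "0 \<le> willmore_at K v"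
proof -
  obtain xs where xs: "link_cycle v xs"
    using nbrs_nonempty[OF assms] link_cycle_exists by blast
  then have "2 < length xs" by (simp add: link_cycle_def)
  then show ?thesis
    using polygon_angles_le[OF _ distinct_link_inversion[OF xs]] willmore_at_link_cycle[OF xs] by simp
qed

lemma willmore_at_eq_0_iff:
  assumes xs: "link_cycle v xs"
  shows "willmore_at K v = 0 \<longleftrightarrow> diagonals_meet (map (inversion v) xs)"
proof -
  have "2 < length xs" using xs by (simp add: link_cycle_def)
  then show ?thesis
    using polygon_angles_eq_imp_diagonals_meet[OF distinct_link_inversion[OF xs]]
      diagonals_meet_imp_polygon_angles_eq[OF _ distinct_link_inversion[OF xs]]
      willmore_at_link_cycle[OF xs] by auto
qed

lemma willmore_nonneg: "0 \<le> willmore K"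
  unfolding willmore_def using willmore_at_nonneg by (simp add: sum_nonneg)

lemma willmore_eq_0_iff: "willmore K = 0 \<longleftrightarrow> (\<forall>v\<in>verts K. willmore_at K v = 0)"
  unfolding willmore_def using willmore_at_nonneg finite_verts[OF complex]
  by (simp add: sum_nonneg_eq_0_iff)

section \<open>The graph of vertices and edges\<close>

definition adjacency :: "((real^3) \<times> (real^3)) set"
  where "adjacency = {(x, y). y \<in> nbrs x}"

lemma adjacency_verts: "adjacency \<subseteq> verts K \<times> verts K"
  using nbrs_verts by (auto simp: adjacency_def)

lemma sym_adjacency: "sym adjacency"
  using nbrs_commute by (auto simp: sym_def adjacency_def)

lemma vertex_set_of_simplex:
  assumes "\<not> affine_dependent C" "convex hull C \<in> K" shows "C \<subseteq> verts K"
proof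
  fix x assume "x \<in> C"
  then show "x \<in> verts K" using subset_in_complex[OF assms, of "{x}"] by (simp add: verts_def)
qed

lemma simplex_reachable:
  assumes "\<not> affine_dependent C" "convex hull C \<in> K" "x \<in> C" "y \<in> C"
  shows "(x, y) \<in> adjacency\<^sup>*"
proof (cases "x = y")
  case False
  then have "(x, y) \<in> adjacency"
    using subset_in_complex[OF assms(1,2), of "{x, y}"] assms(3,4) by (auto simp: adjacency_def nbrs_def)
  then show ?thesis by blast
qed simp

text \<open>Otherwise the simplices with a vertex in one component and those with a vertex outside
  it form two closed sets that cover the connected surface. They are disjoint, because simplices
  with a common point share a vertex.\<close>

lemma adjacency_connected:
  assumes x: "x \<in> verts K" and y: "y \<in> verts K"
  shows "(x, y) \<in> adjacency\<^sup>*"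
proof (rule ccontr)
  assume xy: "(x, y) \<notin> adjacency\<^sup>*"
  define A where "A = {z \<in> verts K. (x, z) \<in> adjacency\<^sup>*}"
  define B where "B = verts K - A"
  define star where "star V = \<Union>{s \<in> K. \<exists>v\<in>V. v \<in> s}" for V
  have closed: "closed (star V)" for V
  proof -
    have "closed s" if "s \<in> K" for s
      using complex that closed_simplex unfolding simplicial_complex_def by blast
    then show ?thesis unfolding star_def using finite_complex by (intro closed_Union) auto
  qed
  have cover: "\<Union>K \<subseteq> star A \<union> star B"
  proof
    fix z assume "z \<in> \<Union>K"
    then obtain s where s: "s \<in> K" "z \<in> s" by blast
    then obtain C where C: "\<not> affine_dependent C" "s = convex hull C" using simplex_in_complex by blast
    then obtain c where c: "c \<in> C" using s by (metis all_not_in_conv convex_hull_empty)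
    then have "c \<in> verts K" using vertex_set_of_simplex C s by blast
    moreover have "c \<in> s" using c C by (simp add: hull_inc)
    ultimately show "z \<in> star A \<union> star B" using s unfolding star_def B_def by blast
  qed
  have disjoint: "star A \<inter> star B = {}"
  proof (rule ccontr)
    assume "star A \<inter> star B \<noteq> {}"
    then obtain z s t a b where z: "s \<in> K" "t \<in> K" "z \<in> s" "z \<in> t" "a \<in> A" "a \<in> s" "b \<in> B" "b \<in> t"
      unfolding star_def by blast
    obtain C D where C: "\<not> affine_dependent C" "s = convex hull C"
      and D: "\<not> affine_dependent D" "t = convex hull D" using simplex_in_complex z(1,2) by metis
    have "z \<in> convex hull (C \<inter> D)"
      using hull_Int[of C D] C D z by auto
    then obtain c where c: "c \<in> C" "c \<in> D" by (metis IntE all_not_in_conv convex_hull_empty)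
    have aV: "a \<in> verts K" "b \<in> verts K" using z by (auto simp: A_def B_def)
    then have "a \<in> C" "b \<in> D" using vertex_in_simplex C D z by blast+
    then have "(a, c) \<in> adjacency\<^sup>*" "(c, b) \<in> adjacency\<^sup>*"
      using simplex_reachable C D z c by metis+
    moreover have "(x, a) \<in> adjacency\<^sup>*" using z by (simp add: A_def)
    ultimately have "(x, b) \<in> adjacency\<^sup>*" by (meson rtrancl_trans)
    then show False using z aV by (simp add: A_def B_def)
  qed
  have "x \<in> star A" "y \<in> star B" using x y xy by (auto simp: star_def A_def B_def verts_def)
  moreover have "x \<in> \<Union>K" "y \<in> \<Union>K" using x y by (auto simp: verts_def)
  moreover have "connected (\<Union>K)" using closed_surface by (simp add: closed_simplicial_surface_def)
  ultimately show False
    using closed[of A] closed[of B] cover disjoint unfolding connected_closed by blast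
qed

end

section \<open>Quadratic functions on the vertices and their local maxima\<close>

lemma generic_direction:
  fixes V :: "'b::euclidean_space set"
  assumes "finite V"
  obtains u where "\<And>x y. x \<in> V \<Longrightarrow> y \<in> V \<Longrightarrow> x \<noteq> y \<Longrightarrow> u \<bullet> x \<noteq> u \<bullet> y"
proof -
  define D where "D = (\<lambda>(x, y). {u. (x - y) \<bullet> u = 0}) ` {(x, y). x \<in> V \<and> y \<in> V \<and> x \<noteq> y}"
  have "finite {(x, y). x \<in> V \<and> y \<in> V \<and> x \<noteq> y}"
    by (rule finite_subset[of _ "V \<times> V"]) (use assms in auto)
  then have "negligible (\<Union>D)"
    unfolding D_def by (intro negligible_Union) (auto intro!: negligible_hyperplane)
  then have "\<Union>D \<noteq> UNIV" using non_negligible_UNIV by metis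
  then obtain u where "u \<notin> \<Union>D" by blast
  show thesis
  proof (rule that)
    fix x y assume "x \<in> V" "y \<in> V" "x \<noteq> y"
    then have "(x - y) \<bullet> u \<noteq> 0" using \<open>u \<notin> \<Union>D\<close> unfolding D_def by blast
    then show "u \<bullet> x \<noteq> u \<bullet> y" by (auto simp: inner_diff_right inner_commute)
  qed
qed

lemma segments_separated:
  fixes a b c d w :: "'a::real_inner"
  assumes "closed_segment a c \<inter> closed_segment b d \<noteq> {}"
    "k < a \<bullet> w" "k < c \<bullet> w" "b \<bullet> w \<le> k" "d \<bullet> w \<le> k"
  shows False
proof -
  obtain z where z: "z \<in> closed_segment a c" "z \<in> closed_segment b d" using assms(1) by blast
  have "closed_segment a c \<subseteq> {x. k < w \<bullet> x}"
    using assms by (intro closed_segment_subset convex_halfspace_gt) (auto simp: inner_commute)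
  moreover have "closed_segment b d \<subseteq> {x. w \<bullet> x \<le> k}"
    using assms by (intro closed_segment_subset convex_halfspace_le) (auto simp: inner_commute)
  ultimately show False using z by force
qed

text \<open>One family for two purposes: \<alpha> = 0 gives the linear functions that test face
  planes, other values have spheres as level sets. Up to constants the family is closed under adding
  multiples of \<open>(norm (x - v))\<^sup>2\<close>, as the perturbation requires.\<close>

definition quadric :: "real \<Rightarrow> 'a::real_inner \<Rightarrow> 'a \<Rightarrow> real"
  where "quadric \<alpha> u x = \<alpha> * (norm x)\<^sup>2 + u \<bullet> x"

lemma quadric_diff:
  "quadric \<alpha> u x - quadric \<alpha> u v = \<alpha> * (norm (x - v))\<^sup>2 + (x - v) \<bullet> (u + (2 * \<alpha>) *\<^sub>R v)"
  unfolding quadric_def power2_norm_eq_inner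
  by (simp add: inner_diff inner_add inner_commute algebra_simps)

text \<open>Inversion at \<open>v\<close> turns the level sets of the quadric through \<open>v\<close>, spheres or planes, into planes.\<close>

lemma quadric_inversion:
  assumes "x \<noteq> v"
  shows "quadric \<alpha> u x - quadric \<alpha> u v
    = (norm (x - v))\<^sup>2 * (\<alpha> + inversion v x \<bullet> (u + (2 * \<alpha>) *\<^sub>R v))"
proof -
  have "(x - v) \<bullet> w = (norm (x - v))\<^sup>2 * (inversion v x \<bullet> w)" for w
    by (subst scaled_inversion[OF assms, symmetric]) simp
  then show ?thesis unfolding quadric_diff by (simp add: algebra_simps)
qed

lemma quadric_less_iff:
  assumes "x \<noteq> v"
  shows "quadric \<alpha> u v < quadric \<alpha> u x \<longleftrightarrow> - \<alpha> < inversion v x \<bullet> (u + (2 * \<alpha>) *\<^sub>R v)"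
proof -
  have "0 < (norm (x - v))\<^sup>2" using assms by simp
  then have "0 < quadric \<alpha> u x - quadric \<alpha> u v \<longleftrightarrow> 0 < \<alpha> + inversion v x \<bullet> (u + (2 * \<alpha>) *\<^sub>R v)"
    unfolding quadric_inversion[OF assms] by (simp add: zero_less_mult_iff)
  then show ?thesis by linarith
qed

context closed_surface
begin

text \<open>The link cycle consists of two arcs between \<open>a\<close> and \<open>b\<close>. If
  each contained a neighbour that is not above \<open>w\<close>, these two together with
  \<open>a\<close> and \<open>b\<close> would form a quadrilateral in the inverted link whose
  diagonals are separated by a plane. So one arc lies entirely above \<open>w\<close>.\<close>

lemma upper_link_connected:
  fixes f :: "real^3 \<Rightarrow> real" and \<alpha> u
  defines "f \<equiv> quadric \<alpha> u"
  assumes W: "willmore_at K w = 0" and a: "a \<in> nbrs w" "f w < f a" and b: "b \<in> nbrs w" "f w < f b"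
  shows "(a, b) \<in> (adjacency \<inter> {(x, y). f w < f x \<and> f w < f y})\<^sup>*"
proof (cases "a = b")
  case False
  let ?R = "adjacency \<inter> {(x, y). f w < f x \<and> f w < f y}"
  have sym: "sym (?R\<^sup>*)"
    using sym_adjacency by (intro sym_rtrancl) (auto simp: sym_def)
  obtain xs where xs: "link_cycle w (a # xs)" using link_cycle_exists[OF a(1)] .
  have "b \<in> set xs" using b(1) False xs by (auto simp: link_cycle_def)
  then obtain qs rs where split: "xs = qs @ b # rs" by (meson split_list)
  have chain: "successively (\<lambda>x y. (x, y) \<in> link w) ((a # qs @ [b]) @ rs @ [a])"
    "successively (\<lambda>x y. (x, y) \<in> link w) ((a # qs) @ (b # rs @ [a]))"
    using xs by (auto simp: link_cycle_def split)
  have reach: "(x, last (x # l)) \<in> ?R\<^sup>*"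
    if "successively (\<lambda>x y. (x, y) \<in> link w) (x # l)" "\<forall>y\<in>set (x # l). f w < f y" for x l
    using that(2) by (intro successively_rtrancl successively_mono[OF that(1)])
      (auto simp: adjacency_def dest: linkD(4))
  have meet: "diagonals_meet (map (inversion w) (a # qs @ b # rs))"
    using W willmore_at_eq_0_iff[OF xs] by (simp add: split)
  show ?thesis
  proof (cases "\<forall>q\<in>set qs. f w < f q")
    case True
    then have "(a, last (a # qs @ [b])) \<in> ?R\<^sup>*"
      using a b chain(1) unfolding successively_append_iff by (intro reach) auto
    then show ?thesis by simp
  next
    case False
    then obtain q where q: "q \<in> set qs" "f q \<le> f w" by (auto simp: not_less)
    have "f w < f r" if "r \<in> set rs" for r
    proof (rule ccontr)
      assume r: "\<not> f w < f r"
      have "subseq (map (inversion w) ([a] @ [q] @ [b] @ [r])) (map (inversion w) ([a] @ qs @ [b] @ rs))"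
        using q that by (intro subseq_map list_emb_append_mono) (simp_all add: subseq_singleton_left)
      then have "closed_segment (inversion w a) (inversion w b) \<inter> closed_segment (inversion w q) (inversion w r) \<noteq> {}"
        using meet unfolding diagonals_meet_def by simp
      moreover have "q \<noteq> w" "r \<noteq> w" "a \<noteq> w" "b \<noteq> w"
        using q that xs split by (auto simp: link_cycle_def nbrs_def)
      ultimately show False
        using a(2) b(2) q(2) r unfolding f_def not_less[symmetric]
        by (auto simp: quadric_less_iff intro: segments_separated[where k = "- \<alpha>"])
    qed
    then have "(b, last (b # rs @ [a])) \<in> ?R\<^sup>*"
      using a b chain(2) unfolding successively_append_iff by (intro reach) auto
    then show ?thesis using sym by (simp add: sym_def)
  qed
qed simp

lemma local_max_imp_global_max_inj:
  assumes W: "\<And>v. v \<in> verts K \<Longrightarrow> willmore_at K v = 0"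
    and v: "v \<in> verts K" and p: "p \<in> verts K" and inj: "inj_on (quadric \<alpha> u) (verts K)"
    and loc: "\<And>x. x \<in> nbrs v \<Longrightarrow> quadric \<alpha> u x < quadric \<alpha> u v"
  shows "quadric \<alpha> u p \<le> quadric \<alpha> u v"
proof (rule local_max_imp_global_max[OF finite_verts[OF complex] adjacency_verts inj sym_adjacency])
  fix w a b assume "(w, a) \<in> adjacency" "(w, b) \<in> adjacency"
    "quadric \<alpha> u w < quadric \<alpha> u a" "quadric \<alpha> u w < quadric \<alpha> u b"
  then show "(a, b) \<in> (adjacency \<inter> {(x, y). quadric \<alpha> u w < quadric \<alpha> u x \<and> quadric \<alpha> u w < quadric \<alpha> u y})\<^sup>*"
    using adjacency_verts by (intro upper_link_connected W) (auto simp: adjacency_def)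
qed (use adjacency_connected v p loc in \<open>auto simp: adjacency_def\<close>)

text \<open>A linear term \<epsilon> g with generic g gives the vertices distinct values. For small
  positive \<epsilon> it preserves the finitely many strict inequalities at \<open>v\<close> as well
  as the supposed counterexample \<open>p\<close>.\<close>

lemma strict_local_max_imp_global_max:
  assumes W: "\<And>v. v \<in> verts K \<Longrightarrow> willmore_at K v = 0"
    and v: "v \<in> verts K" and p: "p \<in> verts K"
    and loc: "\<And>x. x \<in> nbrs v \<Longrightarrow> quadric \<alpha> u x < quadric \<alpha> u v"
  shows "quadric \<alpha> u p \<le> quadric \<alpha> u v"
proof (rule ccontr)
  assume "\<not> quadric \<alpha> u p \<le> quadric \<alpha> u v"
  then have pv: "quadric \<alpha> u v < quadric \<alpha> u p" by simp
  obtain g where g: "\<And>x y. x \<in> verts K \<Longrightarrow> y \<in> verts K \<Longrightarrow> x \<noteq> y \<Longrightarrow> g \<bullet> x \<noteq> g \<bullet> y"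
    using generic_direction[OF finite_verts[OF complex]] by metis
  define f where "f \<epsilon> = quadric \<alpha> (u + \<epsilon> *\<^sub>R g)" for \<epsilon> :: real
  have f: "f \<epsilon> x = quadric \<alpha> u x + \<epsilon> * (g \<bullet> x)" for \<epsilon> x
    by (simp add: f_def quadric_def inner_add_left)
  have lim: "((\<lambda>\<epsilon>. f \<epsilon> x - f \<epsilon> y) \<longlongrightarrow> quadric \<alpha> u x - quadric \<alpha> u y) (at_right 0)" for x y
    unfolding f by (auto intro!: tendsto_eq_intros)
  have less: "eventually (\<lambda>\<epsilon>. f \<epsilon> x < f \<epsilon> y) (at_right 0)" if "quadric \<alpha> u x < quadric \<alpha> u y" for x y
    using order_tendstoD(1)[OF lim[of y x], of 0] that by (simp add: eventually_mono)
  have "eventually (\<lambda>\<epsilon>. f \<epsilon> x \<noteq> f \<epsilon> y) (at_right 0)" if "x \<in> verts K" "y \<in> verts K" "x \<noteq> y" for x y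
  proof -
    consider "quadric \<alpha> u x < quadric \<alpha> u y" | "quadric \<alpha> u y < quadric \<alpha> u x"
      | "quadric \<alpha> u x = quadric \<alpha> u y" by linarith
    then show ?thesis
    proof cases
      case 1
      then show ?thesis by (rule eventually_mono[OF less]) simp
    next
      case 2
      then show ?thesis by (rule eventually_mono[OF less]) simp
    next
      case 3
      show ?thesis
        by (rule eventually_mono[OF eventually_at_right_less]) (use g[OF that] 3 in \<open>simp add: f\<close>)
    qed
  qed
  then have inj: "eventually (\<lambda>\<epsilon>. \<forall>x\<in>verts K. \<forall>y\<in>verts K. x \<noteq> y \<longrightarrow> f \<epsilon> x \<noteq> f \<epsilon> y) (at_right 0)"
    using finite_verts[OF complex] by (intro eventually_ball_finite ballI) (auto intro: eventually_mono)
  have "eventually (\<lambda>\<epsilon>. \<forall>x\<in>nbrs v. f \<epsilon> x < f \<epsilon> v) (at_right 0)"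
    using finite_nbrs loc by (intro eventually_ball_finite ballI less) auto
  then have "eventually (\<lambda>\<epsilon>. False) (at_right (0::real))"
    using inj less[OF pv]
  proof eventually_elim
    case (elim \<epsilon>)
    then have "f \<epsilon> p \<le> f \<epsilon> v"
      unfolding f_def by (intro local_max_imp_global_max_inj[OF W v p]) (auto simp: inj_on_def)
    then show False using elim by simp
  qed
  then show False by simp
qed

text \<open>Subtracting \<open>\<epsilon> * (norm (x - v))\<^sup>2\<close> makes the maximum at
  \<open>v\<close> strict; expanded, and without its constant, the result is again a
  \<open>quadric\<close>. Then \<epsilon> tends to 0.\<close>

lemma weak_local_max_imp_global_max:
  assumes W: "\<And>v. v \<in> verts K \<Longrightarrow> willmore_at K v = 0"
    and v: "v \<in> verts K" and p: "p \<in> verts K"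
    and loc: "\<And>x. x \<in> nbrs v \<Longrightarrow> quadric \<alpha> u x \<le> quadric \<alpha> u v"
  shows "quadric \<alpha> u p \<le> quadric \<alpha> u v"
proof -
  have eq: "quadric (\<alpha> - \<epsilon>) (u + (2 * \<epsilon>) *\<^sub>R v) x - quadric (\<alpha> - \<epsilon>) (u + (2 * \<epsilon>) *\<^sub>R v) v
      = quadric \<alpha> u x - quadric \<alpha> u v - \<epsilon> * (norm (x - v))\<^sup>2" for \<epsilon> x
    unfolding quadric_diff by (simp add: algebra_simps)
  have le: "quadric \<alpha> u p - quadric \<alpha> u v \<le> \<epsilon> * (norm (p - v))\<^sup>2" if "0 < \<epsilon>" for \<epsilon>
  proof -
    have "quadric (\<alpha> - \<epsilon>) (u + (2 * \<epsilon>) *\<^sub>R v) p \<le> quadric (\<alpha> - \<epsilon>) (u + (2 * \<epsilon>) *\<^sub>R v) v"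
    proof (rule strict_local_max_imp_global_max[OF W v p])
      fix x assume "x \<in> nbrs v"
      then have "0 < \<epsilon> * (norm (x - v))\<^sup>2" "quadric \<alpha> u x \<le> quadric \<alpha> u v"
        using that loc by (auto simp: nbrs_def)
      then show "quadric (\<alpha> - \<epsilon>) (u + (2 * \<epsilon>) *\<^sub>R v) x < quadric (\<alpha> - \<epsilon>) (u + (2 * \<epsilon>) *\<^sub>R v) v"
        using eq[of \<epsilon> x] by linarith
    qed
    then show ?thesis using eq[of \<epsilon> p] by linarith
  qed
  show ?thesis
  proof (cases "p = v")
    case False
    then have pos: "0 < (norm (p - v))\<^sup>2" by simp
    have "quadric \<alpha> u p - quadric \<alpha> u v \<le> 0 + e" if "0 < e" for e
      using le[of "e / (norm (p - v))\<^sup>2"] that pos by simp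
    then have "quadric \<alpha> u p - quadric \<alpha> u v \<le> 0" by (rule field_le_epsilon)
    then show ?thesis by simp
  qed simp
qed

end

subsection \<open>Surfaces of energy zero\<close>

text \<open>If no plane contained the vertices, four of them would be affinely independent, and then
  even the lines carrying the diagonals of their quadrilateral would be disjoint. Filtering the list
  by an affine basis keeps the cyclic order.\<close>

lemma diagonals_meet_imp_coplanar:
  fixes ys :: "(real^3) list"
  assumes ys: "distinct ys" "diagonals_meet ys"
  obtains n k where "n \<noteq> 0" "\<And>y. y \<in> set ys \<Longrightarrow> n \<bullet> y = k"
proof (cases "aff_dim (set ys) < 3")
  case True
  then obtain n k where "n \<noteq> 0" "set ys \<subseteq> {x. n \<bullet> x = k}"
    using aff_lowdim_subset_hyperplane[of "set ys"] by auto
  then show thesis using that by blast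
next
  case False
  obtain B where B: "B \<subseteq> set ys" "\<not> affine_dependent B" "affine hull (set ys) = affine hull B"
    using affine_basis_exists by metis
  have "aff_dim (set ys) = aff_dim B" using B(3) by (metis aff_dim_affine_hull)
  then have "4 \<le> card B" using B(2) False aff_dim_affine_independent[OF B(2)] by linarith
  moreover have "set (filter (\<lambda>y. y \<in> B) ys) = B" using B(1) by auto
  ultimately have "4 \<le> length (filter (\<lambda>y. y \<in> B) ys)" by (metis card_length le_trans)
  then obtain a b c d l where l: "filter (\<lambda>y. y \<in> B) ys = a # b # c # d # l"
    by (auto simp: eval_nat_numeral Suc_le_length_iff)
  have "subseq [a, b, c, d] (filter (\<lambda>y. y \<in> B) ys)" unfolding l by simp
  then have "subseq [a, b, c, d] ys" by (meson subseq_filter_left subseq_order.trans)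
  then have "closed_segment a c \<inter> closed_segment b d \<noteq> {}"
    using ys(2) unfolding diagonals_meet_def by blast
  moreover have "distinct (a # b # c # d # l)" "set (a # b # c # d # l) \<subseteq> B"
    unfolding l[symmetric] using ys(1) by auto
  then have "affine hull {a, c} \<inter> affine hull {b, d} = {}"
    by (intro disjoint_affine_hull[OF B(2)]) auto
  ultimately show thesis
    using convex_hull_subset_affine_hull[of "{a, c}"] convex_hull_subset_affine_hull[of "{b, d}"]
    by (auto simp: segment_convex_hull)
qed

lemma vector_eq_0_if_orthogonal:
  fixes d n u :: "real^3"
  assumes "n \<bullet> d = 0" "u \<bullet> d = 0" "cross3 n u \<bullet> d = 0" "cross3 n u \<noteq> 0"
  shows "d = 0"
  using assms norm_and_cross_eq_0[of "cross3 n u" d] by (simp add: cross3_cross3)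

section \<open>Directions at a vertex and flat stars\<close>

lemma cone_in_triangle:
  fixes v p q :: "'a::real_vector"
  assumes "0 \<le> l" "0 \<le> m" "0 \<le> \<epsilon>" "\<epsilon> * (l + m) \<le> 1"
  shows "v + \<epsilon> *\<^sub>R (l *\<^sub>R (p - v) + m *\<^sub>R (q - v)) \<in> convex hull {v, p, q}"
proof -
  have "v + \<epsilon> *\<^sub>R (l *\<^sub>R (p - v) + m *\<^sub>R (q - v))
      = (1 - \<epsilon> * l - \<epsilon> * m) *\<^sub>R v + (\<epsilon> * l) *\<^sub>R p + (\<epsilon> * m) *\<^sub>R q"
    by (simp add: algebra_simps)
  moreover have "0 \<le> 1 - \<epsilon> * l - \<epsilon> * m" using assms by (simp add: algebra_simps)
  ultimately show ?thesis
    using assms unfolding convex_hull_3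
    by (intro CollectI exI[of _ "1 - \<epsilon> * l - \<epsilon> * m"] exI[of _ "\<epsilon> * l"] exI[of _ "\<epsilon> * m"]) auto
qed

context closed_surface
begin

text \<open>A direction common to the cones at \<open>v\<close> over two triangles becomes, when
  shortened, a common point of the triangles, hence a point of their common face. The summand 1 in
  the denominator of \<epsilon> covers vanishing coefficients.\<close>

lemma cone_Int:
  assumes pq: "(p, q) \<in> link v" and rs: "(r, s) \<in> link v"
    and nn: "0 \<le> l" "0 \<le> m" "0 \<le> l'" "0 \<le> m'"
    and z: "z = l *\<^sub>R (p - v) + m *\<^sub>R (q - v)" "z = l' *\<^sub>R (r - v) + m' *\<^sub>R (s - v)"
  obtains \<epsilon> where "0 < \<epsilon>" "v + \<epsilon> *\<^sub>R z \<in> convex hull ({v, p, q} \<inter> {v, r, s})"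
proof -
  define \<epsilon> where "\<epsilon> = 1 / (l + m + l' + m' + 1)"
  have \<epsilon>: "0 < \<epsilon>" "\<epsilon> * (l + m) \<le> 1" "\<epsilon> * (l' + m') \<le> 1"
    using nn by (simp_all add: \<epsilon>_def divide_le_eq)
  have "v + \<epsilon> *\<^sub>R z \<in> convex hull {v, p, q}"
    unfolding z(1) using nn \<epsilon> by (intro cone_in_triangle) auto
  moreover have "v + \<epsilon> *\<^sub>R z \<in> convex hull {v, r, s}"
    unfolding z(2) using nn \<epsilon> by (intro cone_in_triangle) auto
  moreover have "convex hull {v, p, q} \<inter> convex hull {v, r, s} = convex hull ({v, p, q} \<inter> {v, r, s})"
    using pq rs triangleD by (intro hull_Int) (auto simp: link_def)
  ultimately show thesis using that[OF \<epsilon>(1)] by blast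
qed

text \<open>The neighbour of \<open>v\<close> whose direction is extreme in the plane would have both of its
  triangles at \<open>v\<close> on the same side.\<close>

lemma star_not_in_half_plane:
  assumes v: "v \<in> verts K" and n: "\<And>x. x \<in> nbrs v \<Longrightarrow> n \<bullet> (x - v) = 0" "n \<noteq> 0"
    and u: "\<And>x. x \<in> nbrs v \<Longrightarrow> u \<bullet> (x - v) < 0"
  shows False
proof -
  \<comment> \<open>\<open>y x\<close> is the point where the ray from \<open>v\<close> towards
    \<open>x\<close> meets the line on which \<open>u\<close> equals -1, with \<open>v\<close> as
    origin; \<open>g\<close> is the direction of this line and measures the position on it.\<close>
  define \<kappa> where "\<kappa> x = - (1 / (u \<bullet> (x - v)))" for x
  define y where "y x = \<kappa> x *\<^sub>R (x - v)" for x
  define g where "g = cross3 n u"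
  have \<kappa>: "0 < \<kappa> x" if "x \<in> nbrs v" for x using u[OF that] by (simp add: \<kappa>_def)
  have y: "n \<bullet> y x = 0" "u \<bullet> y x = - 1" if "x \<in> nbrs v" for x
    using u[OF that] n(1)[OF that] by (simp_all add: y_def \<kappa>_def)
  obtain x0 where "x0 \<in> nbrs v" using nbrs_nonempty[OF v] by blast
  then have "cross3 g (y x0) = n"
    using y by (simp add: g_def cross3_cross3)
  then have g: "g \<noteq> 0" using n(2) by auto
  have "Max ((\<lambda>x. g \<bullet> y x) ` nbrs v) \<in> (\<lambda>x. g \<bullet> y x) ` nbrs v"
    using finite_nbrs \<open>x0 \<in> nbrs v\<close> by (intro Max_in) auto
  then obtain x where x: "x \<in> nbrs v" "g \<bullet> y x = Max ((\<lambda>x. g \<bullet> y x) ` nbrs v)" by auto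
  have max: "g \<bullet> y z \<le> g \<bullet> y x" if "z \<in> nbrs v" for z
    unfolding x(2) using finite_nbrs that by (intro Max_ge) auto
  have strict: "g \<bullet> y z < g \<bullet> y x" if z: "(x, z) \<in> link v" for z
  proof (rule ccontr)
    note zn = linkD(3)[OF z]
    assume "\<not> g \<bullet> y z < g \<bullet> y x"
    then have "g \<bullet> (y z - y x) = 0" using max[OF zn] by (simp add: inner_diff_right)
    then have "y z - y x = 0"
      using y[OF zn] y[OF x(1)] g unfolding g_def
      by (intro vector_eq_0_if_orthogonal[of n _ u]) (simp_all add: inner_diff_right)
    then have "\<kappa> z *\<^sub>R (z - v) = \<kappa> x *\<^sub>R (x - v)" by (simp add: y_def)
    then have "cross3 (x - v) (\<kappa> z *\<^sub>R (z - v)) = 0" by (simp add: cross_mult_right)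
    then show False
      using triangle_cross[of v x z] z \<kappa>[OF zn] by (simp add: link_def cross_mult_right)
  qed
  \<comment> \<open>Of the two link neighbours of the extreme \<open>x\<close>, let \<open>a\<close>
    be the one closer to it on the line. Then the direction of \<open>a\<close> lies in the cone of
    the triangle \<open>v x b\<close>, but this triangle and \<open>v a x\<close> meet only in the
    edge from \<open>v\<close> to \<open>x\<close>.\<close>
  have no: False
    if a: "(x, a) \<in> link v" and b: "(x, b) \<in> link v" and ab: "a \<noteq> b" and le: "g \<bullet> y b \<le> g \<bullet> y a" for a b
  proof -
    note an = linkD(3)[OF a] and bn = linkD(3)[OF b]
    define s where "s = (g \<bullet> y a - g \<bullet> y b) / (g \<bullet> y x - g \<bullet> y b)"
    have lt: "g \<bullet> y a < g \<bullet> y x" using strict[OF a] .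
    then have s: "0 \<le> s" "s < 1" using le by (simp_all add: s_def)
    have seq: "s * (g \<bullet> y x - g \<bullet> y b) = g \<bullet> y a - g \<bullet> y b" using lt le by (simp add: s_def)
    have "y a - ((1 - s) *\<^sub>R y b + s *\<^sub>R y x) = 0"
    proof (rule vector_eq_0_if_orthogonal[of n _ u])
      show "cross3 n u \<bullet> (y a - ((1 - s) *\<^sub>R y b + s *\<^sub>R y x)) = 0"
        using seq by (simp add: inner_diff_right inner_add_right algebra_simps flip: g_def)
    qed (use y[OF an] y[OF bn] y[OF x(1)] g in \<open>simp_all add: inner_diff_right inner_add_right g_def\<close>)
    then have e: "y a = (s * \<kappa> x) *\<^sub>R (x - v) + ((1 - s) * \<kappa> b) *\<^sub>R (b - v)" by (simp add: y_def)
    obtain a' where a': "(a, a') \<in> link v" "a' \<noteq> x"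
      using link_two[OF an] by (metis Image_singleton_iff insert_iff)
    have e': "y a = \<kappa> a *\<^sub>R (a - v) + 0 *\<^sub>R (x - v)" by (simp add: y_def)
    have ax: "(a, x) \<in> link v" using a link_swap by blast
    obtain \<epsilon> where \<epsilon>: "0 < \<epsilon>" "v + \<epsilon> *\<^sub>R y a \<in> convex hull ({v, a, x} \<inter> {v, x, b})"
      using cone_Int[OF ax b _ _ _ _ e' e] \<kappa>[OF an] \<kappa>[OF x(1)] \<kappa>[OF bn] s by auto
    have "{v, a, x} \<inter> {v, x, b} = {v, x}"
      using ab an linkD(1)[OF a] by (auto simp: nbrs_def)
    then obtain t where t: "v + \<epsilon> *\<^sub>R y a = (1 - t) *\<^sub>R v + t *\<^sub>R x"
      using \<epsilon>(2) by (auto simp: segment_convex_hull[symmetric] closed_segment_def)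
    then have "\<epsilon> *\<^sub>R y a = t *\<^sub>R (x - v)" by (simp add: algebra_simps)
    then have "(\<epsilon> * \<kappa> a) *\<^sub>R (a - v) = t *\<^sub>R (x - v)" by (simp add: y_def)
    then have "cross3 (x - v) ((\<epsilon> * \<kappa> a) *\<^sub>R (a - v)) = 0" by (simp only: cross_mult_right cross_refl) simp
    then show False
      using triangle_cross[of v x a] a \<kappa>[OF an] \<epsilon>(1) by (simp add: link_def cross_mult_right)
  qed
  obtain a b where "a \<noteq> b" "link v `` {x} = {a, b}" using link_two[OF x(1)] by blast
  then have "(x, a) \<in> link v" "(x, b) \<in> link v" by blast+
  then show False using no[of a b] no[of b a] \<open>a \<noteq> b\<close> linear[of "g \<bullet> y a" "g \<bullet> y b"] by blast
qed

text \<open>At a vertex of maximal norm all edges point strictly inwards, because balls are strictly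
  convex. If the vertices were coplanar, its star would lie in an open half-plane.\<close>

lemma verts_not_coplanar:
  assumes "n \<noteq> 0" "\<And>p. p \<in> verts K \<Longrightarrow> n \<bullet> p = k" shows False
proof -
  have ne: "verts K \<noteq> {}"
  proof -
    obtain s where "s \<in> K" using closed_surface by (auto simp: closed_simplicial_surface_def)
    then obtain t where "t \<in> faces K" using closed_surface unfolding closed_simplicial_surface_def by blast
    then obtain C where C: "\<not> affine_dependent C" "card C = 3" "t = convex hull C" "t \<in> K"
      using face_hull by (metis (no_types, lifting) faces_def mem_Collect_eq)
    then have "C \<noteq> {}" by auto
    then show ?thesis using vertex_set_of_simplex C by blast
  qed
  have "Max (norm ` verts K) \<in> norm ` verts K"
    using finite_verts[OF complex] ne by (intro Max_in) auto
  then obtain v where v: "v \<in> verts K" "norm v = Max (norm ` verts K)" by auto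
  have max: "norm p \<le> norm v" if "p \<in> verts K" for p
    unfolding v(2) using finite_verts[OF complex] that by (intro Max_ge) auto
  show False
  proof (rule star_not_in_half_plane[OF v(1), of n v])
    fix x assume x: "x \<in> nbrs v"
    then have xV: "x \<in> verts K" "x \<noteq> v" using nbrs_verts by (auto simp: nbrs_def)
    show "n \<bullet> (x - v) = 0" using assms(2)[OF xV(1)] assms(2)[OF v(1)] by (simp add: inner_diff_right)
    have "(norm x)\<^sup>2 = (norm v)\<^sup>2 + 2 * (v \<bullet> (x - v)) + (norm (x - v))\<^sup>2"
      unfolding power2_norm_eq_inner by (simp add: inner_diff inner_commute)
    moreover have "(norm x)\<^sup>2 \<le> (norm v)\<^sup>2" using max[OF xV(1)] by simp
    moreover have "0 < (norm (x - v))\<^sup>2" using xV(2) by simp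
    ultimately show "v \<bullet> (x - v) < 0" by linarith
  qed (rule assms(1))
qed

text \<open>The pivot of the theorem: zero energy, inscribed convexity and the Delaunay condition
  are each shown equivalent to it. It speaks only of vertices and planes of triangles, so neither a
  convex body nor the topology of the surface has to be known in advance.\<close>

definition supported :: bool
  where "supported \<longleftrightarrow> (\<exists>c r. 0 < r \<and> verts K \<subseteq> sphere c r) \<and>
    (\<forall>t\<in>faces K. \<exists>a b. a \<noteq> 0 \<and> t \<subseteq> {x. a \<bullet> x = b} \<and> (\<forall>p\<in>verts K. a \<bullet> p \<le> b))"

lemma verts_nonempty: "verts K \<noteq> {}"
  using verts_not_coplanar[of "axis 1 1" 0] by (auto simp: axis_eq_0_iff)

lemma willmore_eq_0_imp_sphere:
  assumes W: "\<And>v. v \<in> verts K \<Longrightarrow> willmore_at K v = 0"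
  shows "\<exists>c r. 0 < r \<and> verts K \<subseteq> sphere c r"
proof -
  obtain v where v: "v \<in> verts K" using verts_nonempty by blast
  obtain xs where xs: "link_cycle v xs" using nbrs_nonempty[OF v] link_cycle_exists by blast
  obtain n k where n: "n \<noteq> 0" "\<And>y. y \<in> set (map (inversion v) xs) \<Longrightarrow> n \<bullet> y = k"
    using diagonals_meet_imp_coplanar[OF distinct_link_inversion[OF xs]] willmore_at_eq_0_iff[OF xs] W[OF v]
    by metis
  then have plane: "inversion v x \<bullet> n = k" if "x \<in> nbrs v" for x
    using n(2)[of "inversion v x"] that xs by (simp add: link_cycle_def inner_commute)
  \<comment> \<open>With \<alpha> = - k the linear part is chosen so that
    \<open>u + (2 * \<alpha>) *\<^sub>R v = n\<close>; the level set through \<open>v\<close> is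
    then the preimage of the plane of the inverted link.\<close>
  have level: "quadric (- k) (n + (2 * k) *\<^sub>R v) x - quadric (- k) (n + (2 * k) *\<^sub>R v) v
      = - k * (norm (x - v))\<^sup>2 + (x - v) \<bullet> n" for x
    unfolding quadric_diff by (simp add: algebra_simps)
  have nb: "quadric (- k) (n + (2 * k) *\<^sub>R v) x = quadric (- k) (n + (2 * k) *\<^sub>R v) v" if "x \<in> nbrs v" for x
    using quadric_inversion[of x v "- k" "n + (2 * k) *\<^sub>R v"] plane[OF that] that
    by (simp add: nbrs_def algebra_simps)
  \<comment> \<open>The function is constant on the star of \<open>v\<close>, so both it and its
    negative have a weak local maximum there.\<close>
  have minus: "quadric (- \<alpha>) (- u) x = - quadric \<alpha> u x" for \<alpha> and u x :: "real^3"
    by (simp add: quadric_def)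
  have const: "quadric (- k) (n + (2 * k) *\<^sub>R v) p = quadric (- k) (n + (2 * k) *\<^sub>R v) v" if p: "p \<in> verts K" for p
  proof (rule antisym)
    show "quadric (- k) (n + (2 * k) *\<^sub>R v) p \<le> quadric (- k) (n + (2 * k) *\<^sub>R v) v"
      using nb by (intro weak_local_max_imp_global_max[OF W v p]) auto
    have "quadric (- (- k)) (- (n + (2 * k) *\<^sub>R v)) p \<le> quadric (- (- k)) (- (n + (2 * k) *\<^sub>R v)) v"
      using nb by (intro weak_local_max_imp_global_max[OF W v p]) (simp_all only: minus)
    then show "quadric (- k) (n + (2 * k) *\<^sub>R v) v \<le> quadric (- k) (n + (2 * k) *\<^sub>R v) p"
      unfolding minus by simp
  qed
  have eq: "k * (norm (p - v))\<^sup>2 = (p - v) \<bullet> n" if "p \<in> verts K" for p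
    using level[of p] const[OF that] by simp
  have k: "k \<noteq> 0"
  proof
    assume "k = 0"
    then have "n \<bullet> p = n \<bullet> v" if "p \<in> verts K" for p
      using eq[OF that] by (simp add: inner_diff_left inner_commute[of n])
    then show False using verts_not_coplanar[OF n(1)] by blast
  qed
  have norm_diff_scale: "(norm (x - s *\<^sub>R y))\<^sup>2 = (norm x)\<^sup>2 - 2 * s * (x \<bullet> y) + s\<^sup>2 * (norm y)\<^sup>2"
    for s and x y :: "real^3"
    unfolding power2_norm_eq_inner by (simp add: inner_diff inner_commute power2_eq_square algebra_simps)
  \<comment> \<open>Centre and radius come from completing the square in \<open>eq\<close>; for k =
    0 that equation would describe a plane.\<close>
  define c where "c = v + (1 / (2 * k)) *\<^sub>R n"
  have "verts K \<subseteq> sphere c (norm n / (2 * \<bar>k\<bar>))"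
  proof
    fix p assume "p \<in> verts K"
    have "(dist c p)\<^sup>2 = (norm ((p - v) - (1 / (2 * k)) *\<^sub>R n))\<^sup>2"
      by (simp add: c_def dist_norm norm_minus_commute algebra_simps)
    also have "\<dots> = (norm (p - v))\<^sup>2 - 2 * (1 / (2 * k)) * ((p - v) \<bullet> n) + (1 / (2 * k))\<^sup>2 * (norm n)\<^sup>2"
      by (rule norm_diff_scale)
    also have "\<dots> = (norm n / (2 * \<bar>k\<bar>))\<^sup>2"
      using k by (simp add: power_divide power_mult_distrib flip: eq[OF \<open>p \<in> verts K\<close>])
    finally have "dist c p = norm n / (2 * \<bar>k\<bar>)" by (rule power2_eq_imp_eq) auto
    then show "p \<in> sphere c (norm n / (2 * \<bar>k\<bar>))" by simp
  qed
  moreover have "0 < norm n / (2 * \<bar>k\<bar>)" using n(1) k by simp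
  ultimately show ?thesis by blast
qed

text \<open>Reversing a cycle is avoided: if \<open>b\<close> does not follow \<open>a\<close> it
  precedes \<open>a\<close>, and the cycle is rotated to begin with \<open>b\<close>,
  \<open>a\<close>. This is why the edge is recovered only as a set.\<close>

lemma link_cycle_edge:
  assumes "(a, b) \<in> link v"
  obtains p q xs where "{p, q} = {a, b}" "link_cycle v (p # q # xs)"
proof -
  obtain xs where xs: "link_cycle v (a # xs)" using link_cycle_exists linkD(2)[OF assms] by blast
  obtain c ys where ys: "xs = c # ys" using xs by (cases xs) (auto simp: link_cycle_def)
  obtain zs d where zs: "xs = zs @ [d]" using ys by (metis append_butlast_last_id list.distinct(1))
  show thesis
  proof (cases "c = b")
    case True
    then show thesis using that[of a b ys] xs ys by simp
  next
    case False
    have c: "(a, c) \<in> link v" using xs ys by (simp add: link_cycle_def)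
    have "successively (\<lambda>x y. (x, y) \<in> link v) ((a # zs) @ [d, a])" using xs zs by (simp add: link_cycle_def)
    then have d: "(d, a) \<in> link v" and zd: "successively (\<lambda>x y. (x, y) \<in> link v) ((a # zs) @ [d])"
      unfolding successively_append_iff by simp_all
    have "c \<noteq> d"
    proof
      assume "c = d"
      have "length xs \<noteq> 1" using xs by (simp add: link_cycle_def)
      then have "ys \<noteq> []" using ys by auto
      then have "d \<in> set ys" using ys zs by (metis last.simps last_in_set last_snoc)
      then show False using xs ys \<open>c = d\<close> by (simp add: link_cycle_def)
    qed
    obtain y z where "link v `` {a} = {y, z}" using link_two linkD(2)[OF assms] by blast
    then have "c \<in> {y, z}" "d \<in> {y, z}" "b \<in> {y, z}" using c d link_swap assms by blast+
    then have "d = b" using \<open>c \<noteq> d\<close> False by auto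
    then have "link_cycle v (b # a # zs)"
      using xs zs d zd by (auto simp: link_cycle_def successively_append_iff)
    then show thesis using that[of b a zs] by (simp add: insert_commute)
  qed
qed


text \<open>If neighbours \<open>j\<close> and \<open>k\<close> of \<open>v\<close> lay strictly on
  different sides of the plane of \<open>v p q\<close>, a quadrilateral on the consecutive vertices
  \<open>p\<close>, \<open>q\<close> and on \<open>j\<close>, \<open>k\<close> would have disjoint
  diagonals in the inverted link. So the star of \<open>v\<close> lies on one side, and a linear
  function with a weak local maximum at \<open>v\<close> has a global one.\<close>

lemma willmore_eq_0_imp_face_supported:
  assumes W: "\<And>v. v \<in> verts K \<Longrightarrow> willmore_at K v = 0" and t: "t \<in> faces K"
  shows "\<exists>a b. a \<noteq> 0 \<and> t \<subseteq> {x. a \<bullet> x = b} \<and> (\<forall>p\<in>verts K. a \<bullet> p \<le> b)"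
proof -
  obtain C where C: "\<not> affine_dependent C" "card C = 3" "t = convex hull C" using face_hull[OF t] by metis
  obtain v where "v \<in> C" using C(2) by fastforce
  then have v: "v \<in> verts K" "v \<in> t" using vertex_set_of_simplex[of C] C t by (auto simp: faces_def hull_inc)
  obtain a b where ab: "(a, b) \<in> link v" "t = convex hull {v, a, b}" using triangle_at[OF t v(2,1)] .
  obtain p q xs where pq: "{p, q} = {a, b}" and cyc: "link_cycle v (p # q # xs)"
    using link_cycle_edge[OF ab(1)] .
  define n where "n = cross3 (p - v) (q - v)"
  have tpq: "t = convex hull {v, p, q}" using ab(2) by (simp only: pq)
  have n: "n \<noteq> 0" using triangle_cross[of v p q] t tpq by (simp add: n_def)
  have n0: "n \<bullet> (p - v) = 0" "n \<bullet> (q - v) = 0" by (simp_all add: n_def dot_cross_self)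
  have ineq: "\<not> (n \<bullet> inversion v j < 0 \<and> 0 < n \<bullet> inversion v k)" if "j \<in> nbrs v" "k \<in> nbrs v" for j k
  proof
    assume jk: "n \<bullet> inversion v j < 0 \<and> 0 < n \<bullet> inversion v k"
    have p0: "n \<bullet> inversion v p = 0" "n \<bullet> inversion v q = 0" using n0 by (simp_all add: inversion_def)
    have pqn: "p \<in> nbrs v" "q \<in> nbrs v" "p \<noteq> q" using cyc by (auto simp: link_cycle_def)
    have meet: "diagonals_meet (map (inversion v) (p # q # xs))"
      using W[OF v(1)] willmore_at_eq_0_iff[OF cyc] by simp
    \<comment> \<open>\<open>n\<close> vanishes at the images of \<open>p\<close> and
      \<open>q\<close> and has opposite signs at \<open>y\<close> and \<open>z\<close>. A common
      point of the diagonals would have to be the starting point of both.\<close>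
    have no: False if "closed_segment (inversion v p) y \<inter> closed_segment (inversion v q) z \<noteq> {}"
      "n \<bullet> y \<noteq> 0" "n \<bullet> z \<noteq> 0" "(n \<bullet> y < 0) = (0 < n \<bullet> z)" for y z
    proof -
      obtain s t where s: "0 \<le> s" "0 \<le> t"
        and e: "(1 - s) *\<^sub>R inversion v p + s *\<^sub>R y = (1 - t) *\<^sub>R inversion v q + t *\<^sub>R z"
        using \<open>_ \<noteq> {}\<close> by (auto simp: closed_segment_def)
      then have "n \<bullet> ((1 - s) *\<^sub>R inversion v p + s *\<^sub>R y) = n \<bullet> ((1 - t) *\<^sub>R inversion v q + t *\<^sub>R z)" by simp
      then have st: "s * (n \<bullet> y) = t * (n \<bullet> z)" by (simp add: inner_add_right p0)
      have "s = 0 \<and> t = 0"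
      proof (cases "n \<bullet> y < 0")
        case True
        then have z: "0 < n \<bullet> z" using that(4) by simp
        have "s * (n \<bullet> y) \<le> 0" "0 \<le> t * (n \<bullet> z)" using s True z by (simp_all add: mult_nonneg_nonpos)
        then show ?thesis using st True z by auto
      next
        case False
        then have z: "n \<bullet> z < 0" "0 < n \<bullet> y" using that by auto
        have "t * (n \<bullet> z) \<le> 0" "0 \<le> s * (n \<bullet> y)" using s z by (simp_all add: mult_nonneg_nonpos)
        then show ?thesis using st z by auto
      qed
      then have "inversion v p = inversion v q" using e by simp
      then show False using pqn inversion_inj_on by (simp add: inj_on_def)
    qed
    have "j \<noteq> p" "j \<noteq> q" "k \<noteq> p" "k \<noteq> q" using jk p0 by auto
    moreover have "set (p # q # xs) = nbrs v" using cyc unfolding link_cycle_def by blast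
    ultimately have "j \<in> set xs" "k \<in> set xs" using that by auto
    moreover have "j \<noteq> k" using jk by auto
    ultimately have "subseq [j, k] xs \<or> subseq [k, j] xs"
    proof -
      obtain us ws where xs: "xs = us @ j # ws" using \<open>j \<in> set xs\<close> by (meson split_list)
      consider "k \<in> set us" | "k \<in> set ws" using \<open>k \<in> set xs\<close> \<open>j \<noteq> k\<close> xs by auto
      then show ?thesis
      proof cases
        case 1
        then have "subseq ([k] @ [j]) (us @ j # ws)"
          by (intro list_emb_append_mono) (auto simp: subseq_singleton_left)
        then show ?thesis using xs by simp
      next
        case 2
        then have "subseq [j, k] (j # ws)" by (simp add: subseq_singleton_left)
        then show ?thesis using xs by (simp add: list_emb_append2)
      qed
    qed
    then have "subseq (map (inversion v) [p, q, j, k]) (map (inversion v) (p # q # xs))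
      \<or> subseq (map (inversion v) [p, q, k, j]) (map (inversion v) (p # q # xs))"
      by (intro disj_forward[OF _ subseq_map subseq_map]) auto
    then show False
      using meet no[of "inversion v j" "inversion v k"] no[of "inversion v k" "inversion v j"] jk
      unfolding diagonals_meet_def by auto
  qed
  have sign: "n \<bullet> inversion v x = (n \<bullet> (x - v)) / (norm (x - v))\<^sup>2" for x by (simp add: inversion_def)
  have sides: "(\<forall>x\<in>nbrs v. n \<bullet> (x - v) \<le> 0) \<or> (\<forall>x\<in>nbrs v. 0 \<le> n \<bullet> (x - v))"
  proof (rule ccontr)
    assume "\<not> ?thesis"
    then obtain j k where jk: "j \<in> nbrs v" "n \<bullet> (j - v) < 0" "k \<in> nbrs v" "0 < n \<bullet> (k - v)"
      by (auto simp: not_le)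
    moreover have "0 < (norm (j - v))\<^sup>2" "0 < (norm (k - v))\<^sup>2" using jk by (auto simp: nbrs_def)
    ultimately show False using ineq[of j k] unfolding sign by (simp add: divide_neg_pos)
  qed
  obtain m where m: "m = n \<or> m = - n" "\<And>x. x \<in> nbrs v \<Longrightarrow> m \<bullet> (x - v) \<le> 0"
    using sides
  proof
    assume "\<forall>x\<in>nbrs v. n \<bullet> (x - v) \<le> 0" then show thesis using that[of n] by blast
  next
    assume "\<forall>x\<in>nbrs v. 0 \<le> n \<bullet> (x - v)" then show thesis using that[of "- n"] by simp
  qed
  have "m \<bullet> x \<le> m \<bullet> v" if "x \<in> verts K" for x
    using weak_local_max_imp_global_max[OF W v(1) that, of 0 m] m(2)
    by (simp add: quadric_def inner_diff_right)
  moreover have "t \<subseteq> {x. m \<bullet> x = m \<bullet> v}"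
    unfolding tpq using m(1) n0
    by (intro hull_minimal convex_hyperplane) (auto simp: inner_diff_right)
  moreover have "m \<noteq> 0" using m(1) n by auto
  ultimately show ?thesis by blast
qed

lemma willmore_eq_0_imp_supported: "willmore K = 0 \<Longrightarrow> supported"
  using willmore_eq_0_iff willmore_eq_0_imp_sphere willmore_eq_0_imp_face_supported
  unfolding supported_def by blast

end

subsection \<open>Vanishing of the energy for inscribed convex surfaces\<close>

lemma subseq_Cons_nth:
  assumes "subseq (a # as) ys"
  obtains i where "i < length ys" "ys ! i = a" "subseq as (drop (Suc i) ys)"
proof -
  obtain us vs where "ys = us @ a # vs" "subseq as vs"
    using list_emb_ConsD[OF assms] by auto
  then show thesis using that[of "length us"] by simp
qed

lemma subseq_four_nth:
  assumes "subseq [a, b, c, d] ys"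
  obtains i j k l where "i < j" "j < k" "k < l" "l < length ys"
    "ys ! i = a" "ys ! j = b" "ys ! k = c" "ys ! l = d"
proof -
  obtain i where i: "i < length ys" "ys ! i = a" "subseq [b, c, d] (drop (Suc i) ys)"
    using subseq_Cons_nth[OF assms] .
  obtain j where j: "j < length (drop (Suc i) ys)" "drop (Suc i) ys ! j = b"
      "subseq [c, d] (drop (Suc j) (drop (Suc i) ys))"
    using subseq_Cons_nth[OF i(3)] .
  obtain k where k: "k < length (drop (Suc j) (drop (Suc i) ys))"
      "drop (Suc j) (drop (Suc i) ys) ! k = c" "subseq [d] (drop (Suc k) (drop (Suc j) (drop (Suc i) ys)))"
    using subseq_Cons_nth[OF j(3)] .
  obtain l where l: "l < length (drop (Suc k) (drop (Suc j) (drop (Suc i) ys)))"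
      "drop (Suc k) (drop (Suc j) (drop (Suc i) ys)) ! l = d"
    using subseq_Cons_nth[OF k(3)] by metis
  show thesis
    by (rule that[of i "Suc i + j" "Suc i + (Suc j + k)" "Suc i + (Suc j + (Suc k + l))"])
      (use i j k l in \<open>simp_all add: less_diff_conv add_ac\<close>)
qed

lemma sign_change:
  fixes h :: "nat \<Rightarrow> real"
  assumes "i < j" "h i < 0" "0 < h j"
  obtains p where "i \<le> p" "p < j" "h p < 0" "0 \<le> h (Suc p)"
proof -
  have "\<exists>p. i \<le> p \<and> p < j \<and> h p < 0 \<and> 0 \<le> h (Suc p)"
    using assms
  proof (induction "j - i" arbitrary: i)
    case (Suc n)
    show ?case
    proof (cases "0 \<le> h (Suc i)")
      case True
      then show ?thesis using Suc.prems by blast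
    next
      case False
      then have "Suc i < j" using Suc.prems by (metis less_asym' not_le Suc_lessI)
      then obtain p where "Suc i \<le> p \<and> p < j \<and> h p < 0 \<and> 0 \<le> h (Suc p)"
        using Suc.hyps(1)[of "Suc i"] Suc_diff_Suc[OF Suc.prems(1)] Suc.hyps(2) Suc.prems(3) False
        by (metis Suc_inject not_le)
      then show ?thesis by (meson Suc_leD)
    qed
  qed simp
  then show thesis using that by blast
qed

lemma segment_zero:
  fixes G :: "'a::real_inner"
  assumes "G \<bullet> a < 0" "0 \<le> G \<bullet> b"
  obtains z where "z \<in> closed_segment a b" "G \<bullet> z = 0"
proof -
  define s where "s = (G \<bullet> a) / (G \<bullet> a - G \<bullet> b)"
  have d: "G \<bullet> a - G \<bullet> b < 0" using assms by simp
  have s: "0 \<le> s" "s \<le> 1" using d assms by (simp_all add: s_def zero_le_divide_iff divide_le_eq)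
  have "s * (G \<bullet> a - G \<bullet> b) = G \<bullet> a" using d by (simp add: s_def)
  then have "G \<bullet> ((1 - s) *\<^sub>R a + s *\<^sub>R b) = 0" by (simp add: inner_add_right algebra_simps)
  then show thesis using that s unfolding closed_segment_def by blast
qed

lemma sign_change_segment:
  fixes G :: "'a::real_inner"
  assumes "i < j" "G \<bullet> y i \<noteq> 0" "(G \<bullet> y i < 0) = (0 < G \<bullet> y j)" "G \<bullet> y j \<noteq> 0"
  obtains p z where "i \<le> p" "p < j" "z \<in> closed_segment (y p) (y (Suc p))" "G \<bullet> z = 0"
proof (cases "G \<bullet> y i < 0")
  case True
  then obtain p where "i \<le> p" "p < j" "G \<bullet> y p < 0" "0 \<le> G \<bullet> y (Suc p)"
    using sign_change[of i j "\<lambda>p. G \<bullet> y p"] assms by metis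
  then show thesis using segment_zero[of G "y p" "y (Suc p)"] that by metis
next
  case False
  then have "- G \<bullet> y i < 0" "0 < - G \<bullet> y j" using assms by auto
  then obtain p where p: "i \<le> p" "p < j" "- G \<bullet> y p < 0" "0 \<le> - G \<bullet> y (Suc p)"
    using sign_change[of i j "\<lambda>p. - G \<bullet> y p"] assms(1) by metis
  obtain z where "z \<in> closed_segment (y p) (y (Suc p))" "- G \<bullet> z = 0"
    using segment_zero[OF p(3,4)] .
  then show thesis using that p by simp
qed

text \<open>The line through \<open>z\<close> in direction \<open>d\<close> lies in the planes of \<open>G\<close> and \<open>n\<close>, so \<open>n\<close> is a
  multiple of \<open>G\<close>, which separates \<open>A\<close> from \<open>B\<close>.\<close>

lemma supporting_line_no_separation:
  fixes m n G d z A B :: "real^3"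
  assumes m: "m \<bullet> z = 1" "m \<bullet> d = 0" and d: "d \<noteq> 0" and G: "G \<bullet> z = 0" "G \<bullet> d = 0"
    and n: "n \<bullet> z = 0" "n \<bullet> d = 0" "n \<noteq> 0"
    and AB: "G \<bullet> A < 0" "0 < G \<bullet> B" "n \<bullet> A \<le> 0" "n \<bullet> B \<le> 0"
  shows False
proof -
  define C where "C = cross3 G n"
  have Cz: "cross3 C z = 0" "cross3 C d = 0" by (simp_all add: C_def cross3_cross3 G n)
  have "(C \<bullet> m) *\<^sub>R z - (z \<bullet> m) *\<^sub>R C = 0" "(C \<bullet> m) *\<^sub>R d - (d \<bullet> m) *\<^sub>R C = 0"
    using Cz cross3_cross3[of C z m] cross3_cross3[of C d m] by simp_all
  then have "C = (C \<bullet> m) *\<^sub>R z" "(C \<bullet> m) *\<^sub>R d = 0" using m by (simp_all add: inner_commute)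
  then have "C = 0" using d by auto
  then have "(G \<bullet> A) *\<^sub>R n - (n \<bullet> A) *\<^sub>R G = 0"
    using cross3_cross3[of G n A] by (simp add: C_def)
  then have eq: "(G \<bullet> A) *\<^sub>R n = (n \<bullet> A) *\<^sub>R G" by simp
  then have "B \<bullet> ((G \<bullet> A) *\<^sub>R n) = B \<bullet> ((n \<bullet> A) *\<^sub>R G)" by simp
  then have e: "(G \<bullet> A) * (n \<bullet> B) = (n \<bullet> A) * (G \<bullet> B)" by (simp add: inner_commute)
  have "0 \<le> (G \<bullet> A) * (n \<bullet> B)" "(n \<bullet> A) * (G \<bullet> B) \<le> 0"
    using AB by (simp_all add: mult_nonpos_nonpos mult_nonpos_nonneg)
  then have "n \<bullet> A = 0" using e AB(2) by (simp add: mult_eq_0_iff)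
  then show False using eq AB(1) n(3) by simp
qed

context closed_surface
begin

lemma link_cycle_nth:
  assumes "link_cycle v xs" "Suc p < length xs"
  shows "(xs ! p, xs ! Suc p) \<in> link v"
proof -
  have "successively (\<lambda>x y. (x, y) \<in> link v) xs"
    using assms(1) by (auto simp: link_cycle_def successively_append_iff)
  then show ?thesis using assms(2) by (simp add: successively_conv_nth)
qed

text \<open>Inversion keeps directions at \<open>v\<close>, so a common point of two sides lies in
  the cones over both triangles, and by \<open>cone_Int\<close> over their common face: it is the
  apex or on the ray through a common vertex. The equation \<open>m \<bullet> z = 1\<close> excludes
  the apex and fixes the point on the ray.\<close>

lemma link_sides_disjoint:
  assumes xs: "link_cycle v xs" and pq: "p < q" "Suc q < length xs"
    and m: "\<And>x. x \<in> nbrs v \<Longrightarrow> m \<bullet> inversion v x = 1"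
    and z: "z \<in> closed_segment (inversion v (xs ! p)) (inversion v (xs ! Suc p))"
      "z \<in> closed_segment (inversion v (xs ! q)) (inversion v (xs ! Suc q))"
  shows "q = Suc p \<and> z = inversion v (xs ! q)"
proof -
  have d: "distinct xs" and set: "set xs = nbrs v" using xs by (auto simp: link_cycle_def)
  define a b c e where "a = xs ! p" and "b = xs ! Suc p" and "c = xs ! q" and "e = xs ! Suc q"
  have nb: "a \<in> nbrs v" "b \<in> nbrs v" "c \<in> nbrs v" "e \<in> nbrs v"
    unfolding a_def b_def c_def e_def set[symmetric] using pq by (simp_all add: nth_mem)
  have ne: "a \<noteq> b" "a \<noteq> c" "a \<noteq> e" "b \<noteq> e" "c \<noteq> e" "b = c \<longleftrightarrow> q = Suc p"
    unfolding a_def b_def c_def e_def using pq by (subst nth_eq_iff_index_eq[OF d]; simp; linarith?)+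
  have link: "(a, b) \<in> link v" "(c, e) \<in> link v"
    unfolding a_def b_def c_def e_def using pq by (auto intro!: link_cycle_nth[OF xs])
  have cone: "\<exists>l l'. 0 \<le> l \<and> 0 \<le> l' \<and> y = l *\<^sub>R (x - v) + l' *\<^sub>R (x' - v)"
    if y: "y \<in> closed_segment (inversion v x) (inversion v x')" for y x x'
  proof -
    obtain s where s: "0 \<le> s" "s \<le> 1" "y = (1 - s) *\<^sub>R inversion v x + s *\<^sub>R inversion v x'"
      using y by (auto simp: closed_segment_def)
    then show ?thesis
      by (intro exI[of _ "(1 - s) / (norm (x - v))\<^sup>2"] exI[of _ "s / (norm (x' - v))\<^sup>2"])
        (auto simp: inversion_def)
  qed
  have mz: "m \<bullet> z = 1"
  proof -
    obtain s where "z = (1 - s) *\<^sub>R inversion v a + s *\<^sub>R inversion v b"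
      using z(1) by (auto simp: closed_segment_def a_def b_def)
    then show ?thesis using m nb by (simp add: inner_add_right)
  qed
  obtain l l' where l: "0 \<le> l" "0 \<le> l'" "z = l *\<^sub>R (a - v) + l' *\<^sub>R (b - v)"
    using cone z(1) unfolding a_def b_def by metis
  obtain k k' where k: "0 \<le> k" "0 \<le> k'" "z = k *\<^sub>R (c - v) + k' *\<^sub>R (e - v)"
    using cone z(2) unfolding c_def e_def by metis
  obtain \<epsilon> where \<epsilon>: "0 < \<epsilon>" "v + \<epsilon> *\<^sub>R z \<in> convex hull ({v, a, b} \<inter> {v, c, e})"
    using cone_Int[OF link l(1,2) k(1,2) l(3) k(3)] .
  show ?thesis
  proof (cases "b = c")
    case False
    then have "{v, a, b} \<inter> {v, c, e} = {v}" using ne nb by (auto simp: nbrs_def)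
    then have "v + \<epsilon> *\<^sub>R z \<in> convex hull {v}" using \<epsilon>(2) by (simp only:)
    then have "\<epsilon> *\<^sub>R z = 0" by simp
    then show ?thesis using \<epsilon>(1) mz by simp
  next
    case True
    then have "{v, a, b} \<inter> {v, c, e} = {v, b}" using ne nb by (auto simp: nbrs_def)
    then have "v + \<epsilon> *\<^sub>R z \<in> convex hull {v, b}" using \<epsilon>(2) by (simp only:)
    then obtain t where "v + \<epsilon> *\<^sub>R z = (1 - t) *\<^sub>R v + t *\<^sub>R b"
      by (auto simp: segment_convex_hull[symmetric] closed_segment_def)
    then have "\<epsilon> *\<^sub>R z = t *\<^sub>R (b - v)" by (simp add: algebra_simps)
    also have "\<dots> = (t * (norm (b - v))\<^sup>2) *\<^sub>R inversion v b"
      using nb scaled_inversion[of b v] by (simp add: nbrs_def flip: scaleR_scaleR)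
    finally have e: "\<epsilon> *\<^sub>R z = (t * (norm (b - v))\<^sup>2) *\<^sub>R inversion v b" .
    then have "m \<bullet> (\<epsilon> *\<^sub>R z) = m \<bullet> ((t * (norm (b - v))\<^sup>2) *\<^sub>R inversion v b)" by simp
    then have "\<epsilon> = t * (norm (b - v))\<^sup>2" using mz m[OF nb(2)] by simp
    then have "\<epsilon> *\<^sub>R z = \<epsilon> *\<^sub>R inversion v b" using e by (simp only:)
    then have "z = inversion v b" using \<epsilon>(1) by simp
    then show ?thesis using True ne by (simp add: c_def)
  qed
qed

lemma supported_imp_willmore_eq_0_at:
  assumes S: supported and v: "v \<in> verts K"
  shows "willmore_at K v = 0"
proof -
  obtain xs where xs: "link_cycle v xs" using nbrs_nonempty[OF v] link_cycle_exists by blast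
  have set: "set xs = nbrs v" using xs by (simp add: link_cycle_def)
  obtain c r where sphere: "verts K \<subseteq> sphere c r" using S by (auto simp: supported_def)
  \<comment> \<open>Inversion at \<open>v\<close> maps the sphere with centre \<open>c\<close>
    through \<open>v\<close> to the plane on which \<open>m\<close> takes the value 1.\<close>
  define m where "m = 2 *\<^sub>R (c - v)"
  have m: "m \<bullet> inversion v x = 1" if "x \<in> nbrs v" for x
  proof -
    have "x \<in> verts K" "x \<noteq> v" using that nbrs_verts by (auto simp: nbrs_def)
    then have "dist c x = r" "dist c v = r" using sphere v by (metis mem_sphere subsetD)+
    then have "norm (x - c) = norm (v - c)" by (simp add: dist_norm norm_minus_commute)
    then have "(norm ((x - v) - (c - v)))\<^sup>2 = (norm (c - v))\<^sup>2" by (simp add: norm_minus_commute)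
    moreover have "(norm ((x - v) - (c - v)))\<^sup>2 = (norm (x - v))\<^sup>2 - m \<bullet> (x - v) + (norm (c - v))\<^sup>2"
      unfolding power2_norm_eq_inner m_def by (simp add: inner_diff inner_commute algebra_simps)
    ultimately have "m \<bullet> (x - v) = (norm (x - v))\<^sup>2" by linarith
    then show ?thesis using \<open>x \<noteq> v\<close> by (simp add: inversion_def)
  qed
  define y where "y p = inversion v (xs ! p)" for p
  have my: "m \<bullet> y p = 1" if "p < length xs" for p
    unfolding y_def by (rule m) (use that in \<open>simp flip: set\<close>)
  have "diagonals_meet (map (inversion v) xs)"
    unfolding diagonals_meet_def
  proof (intro allI impI notI)
    fix A B C D
    assume sub: "subseq [A, B, C, D] (map (inversion v) xs)"
      and disj: "closed_segment A C \<inter> closed_segment B D = {}"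
    obtain i j k l where ijkl: "i < j" "j < k" "k < l" "l < length (map (inversion v) xs)"
      "map (inversion v) xs ! i = A" "map (inversion v) xs ! j = B"
      "map (inversion v) xs ! k = C" "map (inversion v) xs ! l = D"
      using subseq_four_nth[OF sub] .
    then have len: "l < length xs" and Y: "A = y i" "B = y j" "C = y k" "D = y l"
      by (auto simp: y_def)
    obtain g b where gb: "\<forall>x\<in>closed_segment A C. g \<bullet> x < b" "\<forall>x\<in>closed_segment B D. b < g \<bullet> x"
      using separating_hyperplane_compact_closed[of "closed_segment A C" "closed_segment B D"] disj by auto
    \<comment> \<open>Because \<open>m\<close> is 1 on all images, the affine separation by
      \<open>g\<close> and \<open>b\<close> becomes a matter of the sign of a linear
      function.\<close>
    define G where "G = g - b *\<^sub>R m"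
    have G: "G \<bullet> A < 0" "0 < G \<bullet> B" "G \<bullet> C < 0" "0 < G \<bullet> D"
      using gb my ijkl len by (auto simp: G_def Y inner_diff_left)
    \<comment> \<open>\<open>G\<close> changes sign from \<open>A\<close> to \<open>B\<close>, from
      \<open>B\<close> to \<open>C\<close> and from \<open>C\<close> to \<open>D\<close>, so the
      line where \<open>G\<close> is 0 and \<open>m\<close> is 1 meets sides in three of the four
      arcs.\<close>
    obtain p1 z1 where z1: "i \<le> p1" "p1 < j" "z1 \<in> closed_segment (y p1) (y (Suc p1))" "G \<bullet> z1 = 0"
      using sign_change_segment[of i j G y] ijkl(1) G by (auto simp: Y)
    obtain p2 z2 where z2: "j \<le> p2" "p2 < k" "z2 \<in> closed_segment (y p2) (y (Suc p2))" "G \<bullet> z2 = 0"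
      using sign_change_segment[of j k G y] ijkl(2) G by (auto simp: Y)
    obtain p3 z3 where z3: "k \<le> p3" "p3 < l" "z3 \<in> closed_segment (y p3) (y (Suc p3))" "G \<bullet> z3 = 0"
      using sign_change_segment[of k l G y] ijkl(3) G by (auto simp: Y)
    have side: "q = Suc p \<and> z = y q" if "p < q" "Suc q < length xs"
      "z \<in> closed_segment (y p) (y (Suc p))" "z \<in> closed_segment (y q) (y (Suc q))" for p q z
      using link_sides_disjoint[OF xs _ _ m] that unfolding y_def by blast
    have z12: "z1 \<noteq> z2"
    proof
      assume "z1 = z2"
      then have "p2 = Suc p1 \<and> z1 = y p2" using side[of p1 p2 z1] z1 z2 ijkl len by auto
      then have "z1 = y j" using z1 z2 by (metis Suc_leI le_antisym)
      then show False using z1(4) G Y by simp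
    qed
    have z23: "z2 \<noteq> z3"
    proof
      assume "z2 = z3"
      then have "p3 = Suc p2 \<and> z2 = y p3" using side[of p2 p3 z2] z2 z3 ijkl len by auto
      then have "z2 = y k" using z2 z3 by (metis Suc_leI le_antisym)
      then show False using z2(4) G Y by simp
    qed
    have z13: "z1 \<noteq> z3"
    proof
      assume "z1 = z3"
      then have "p3 = Suc p1" using side[of p1 p3 z1] z1 z3 ijkl len by auto
      then show False using z1 z3 ijkl by simp
    qed
    define Z where "Z = {z. G \<bullet> z = 0 \<and> (\<exists>p. Suc p < length xs \<and> z \<in> closed_segment (y p) (y (Suc p)))}"
    have "Suc p1 < length xs" "Suc p2 < length xs" "Suc p3 < length xs"
      using z1(2) z2(2) z3(2) ijkl(2,3) len by linarith+
    then have Z: "z1 \<in> Z" "z2 \<in> Z" "z3 \<in> Z"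
      unfolding Z_def using z1(3,4) z2(3,4) z3(3,4) by blast+
    have mZ: "m \<bullet> z = 1" if "z \<in> Z" for z
    proof -
      obtain p s where "Suc p < length xs" "z = (1 - s) *\<^sub>R y p + s *\<^sub>R y (Suc p)"
        using \<open>z \<in> Z\<close> by (auto simp: Z_def closed_segment_def)
      then show ?thesis using my by (simp add: inner_add_right)
    qed
    have GZ: "G \<bullet> z = 0" if "z \<in> Z" for z using that by (simp add: Z_def)
    \<comment> \<open>The direction of that line. \<open>G\<close>, \<open>m\<close> and
      \<open>E\<close> are linearly independent, so \<open>E\<close> distinguishes and orders the
      three points.\<close>
    define E where "E = cross3 G m"
    have E: "E \<noteq> 0"
    proof
      assume "E = 0"
      then have "(G \<bullet> A) *\<^sub>R m - G = 0" "(G \<bullet> B) *\<^sub>R m - G = 0"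
        using cross3_cross3[of G m A] cross3_cross3[of G m B] my ijkl len by (simp_all add: E_def Y)
      then have "(G \<bullet> A) *\<^sub>R m = (G \<bullet> B) *\<^sub>R m" by simp
      then have "m = 0" using G by auto
      then show False using my[of i] ijkl len by simp
    qed
    have eqZ: "z = z'" if "G \<bullet> z = G \<bullet> z'" "m \<bullet> z = m \<bullet> z'" "E \<bullet> z = E \<bullet> z'" for z z'
    proof -
      have "z - z' = 0"
        using that E unfolding E_def
        by (intro vector_eq_0_if_orthogonal[of G _ m]) (simp_all add: inner_diff_right)
      then show ?thesis by simp
    qed
    \<comment> \<open>The face plane over the side through the middle point \<open>z\<close> has all
      images on one side and contains \<open>z\<close>. It therefore contains the outer points as
      well, and with them the whole line, which nevertheless separates \<open>A\<close> from
      \<open>B\<close>.\<close>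
    have middle: False if "z \<in> Z" "z' \<in> Z" "z'' \<in> Z" "E \<bullet> z' < E \<bullet> z" "E \<bullet> z < E \<bullet> z''" for z z' z''
    proof -
      obtain p where p: "Suc p < length xs" "z \<in> closed_segment (y p) (y (Suc p))"
        using \<open>z \<in> Z\<close> by (auto simp: Z_def)
      let ?t = "convex hull {v, xs ! p, xs ! Suc p}"
      have "?t \<in> faces K" using link_cycle_nth[OF xs p(1)] by (simp add: link_def)
      then obtain n b where n: "n \<noteq> 0" "?t \<subseteq> {x. n \<bullet> x = b}" "\<forall>x\<in>verts K. n \<bullet> x \<le> b"
        using S by (auto simp: supported_def)
      have nv: "n \<bullet> v = b" "n \<bullet> (xs ! p) = b" "n \<bullet> (xs ! Suc p) = b"
        using n(2) by (metis (mono_tags, lifting) hull_inc insertCI mem_Collect_eq subsetD)+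
      have le: "n \<bullet> y q \<le> 0" if "q < length xs" for q
      proof -
        have "xs ! q \<in> verts K" using that set nbrs_verts by (metis nth_mem)
        then have "n \<bullet> (xs ! q - v) \<le> 0" using n(3) nv by (simp add: inner_diff_right)
        then show ?thesis by (simp add: y_def inversion_def divide_nonpos_nonneg)
      qed
      have leZ: "n \<bullet> w \<le> 0" if "w \<in> Z" for w
      proof -
        obtain q s where "Suc q < length xs" "0 \<le> s" "s \<le> 1" "w = (1 - s) *\<^sub>R y q + s *\<^sub>R y (Suc q)"
          using \<open>w \<in> Z\<close> by (auto simp: Z_def closed_segment_def)
        then show ?thesis using le[of q] le[of "Suc q"]
          by (simp add: inner_add_right add_nonpos_nonpos mult_nonneg_nonpos)
      qed
      have "n \<bullet> y p = 0" "n \<bullet> y (Suc p) = 0" using nv by (simp_all add: y_def inversion_def inner_diff_right)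
      then have nz: "n \<bullet> z = 0" using p(2) by (auto simp: closed_segment_def inner_add_right)
      define t where "t = (E \<bullet> z - E \<bullet> z') / (E \<bullet> z'' - E \<bullet> z')"
      have t: "0 < t" "t < 1" using that by (simp_all add: t_def)
      have "t * (E \<bullet> z'' - E \<bullet> z') = E \<bullet> z - E \<bullet> z'" using that by (simp add: t_def)
      then have zt: "z = (1 - t) *\<^sub>R z' + t *\<^sub>R z''"
        using mZ[OF that(1)] mZ[OF that(2)] mZ[OF that(3)] GZ[OF that(1)] GZ[OF that(2)] GZ[OF that(3)]
        by (intro eqZ) (simp_all add: inner_add_right algebra_simps)
      then have "n \<bullet> z = (1 - t) * (n \<bullet> z') + t * (n \<bullet> z'')" by (simp add: inner_add_right)
      moreover have "(1 - t) * (n \<bullet> z') \<le> 0" "t * (n \<bullet> z'') \<le> 0"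
        using t leZ that by (simp_all add: mult_nonneg_nonpos)
      ultimately have "(1 - t) * (n \<bullet> z') = 0" "t * (n \<bullet> z'') = 0" using nz by linarith+
      then have "n \<bullet> z' = 0" "n \<bullet> z'' = 0" using t by auto
      moreover have "z'' \<noteq> z'" using that(4,5) by auto
      ultimately show False
        using supporting_line_no_separation[of m z' "z'' - z'" G n A B] mZ[OF that(2)] mZ[OF that(3)]
          GZ[OF that(2)] GZ[OF that(3)] that(4,5) n(1) G(1,2) le[of i] le[of j] ijkl(1-3) len
        by (auto simp: inner_diff_right Y)
    qed
    have ne: "E \<bullet> z \<noteq> E \<bullet> z'" if "z \<in> Z" "z' \<in> Z" "z \<noteq> z'" for z z'
      using eqZ[of z z'] that(3) mZ[OF that(1)] mZ[OF that(2)] GZ[OF that(1)] GZ[OF that(2)] by auto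
    have "E \<bullet> z1 \<noteq> E \<bullet> z2" "E \<bullet> z2 \<noteq> E \<bullet> z3" "E \<bullet> z1 \<noteq> E \<bullet> z3"
      using ne Z z12 z23 z13 by blast+
    then consider "E \<bullet> z1 < E \<bullet> z2 \<and> E \<bullet> z2 < E \<bullet> z3" | "E \<bullet> z1 < E \<bullet> z3 \<and> E \<bullet> z3 < E \<bullet> z2"
      | "E \<bullet> z2 < E \<bullet> z1 \<and> E \<bullet> z1 < E \<bullet> z3" | "E \<bullet> z2 < E \<bullet> z3 \<and> E \<bullet> z3 < E \<bullet> z1"
      | "E \<bullet> z3 < E \<bullet> z1 \<and> E \<bullet> z1 < E \<bullet> z2" | "E \<bullet> z3 < E \<bullet> z2 \<and> E \<bullet> z2 < E \<bullet> z1"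
      by linarith
    then show False using middle Z by cases blast+
  qed
  then show ?thesis using willmore_at_eq_0_iff[OF xs] by simp
qed

lemma supported_imp_willmore_eq_0: "supported \<Longrightarrow> willmore K = 0"
  using supported_imp_willmore_eq_0_at willmore_eq_0_iff by blast

end

subsection \<open>Inscribed convex surfaces\<close>

lemma cross3_cycle: "cross3 b c \<bullet> a = cross3 a b \<bullet> c" for a b c :: "real^3"
  by (simp add: cross3_simps)

lemma cramer_cross3:
  "(cross3 a b \<bullet> c) *\<^sub>R x = (cross3 b c \<bullet> x) *\<^sub>R a + (cross3 c a \<bullet> x) *\<^sub>R b + (cross3 a b \<bullet> x) *\<^sub>R c"
  for a b c x :: "real^3"
  by (simp add: cross3_simps forall_3)

lemma cross3_coordinates:
  fixes a b c x :: "real^3"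
  assumes "cross3 a b \<bullet> c \<noteq> 0"
  shows "x = ((cross3 b c \<bullet> x) / (cross3 a b \<bullet> c)) *\<^sub>R a + ((cross3 c a \<bullet> x) / (cross3 a b \<bullet> c)) *\<^sub>R b
    + ((cross3 a b \<bullet> x) / (cross3 a b \<bullet> c)) *\<^sub>R c"
proof -
  have "x = (1 / (cross3 a b \<bullet> c)) *\<^sub>R ((cross3 a b \<bullet> c) *\<^sub>R x)" using assms by simp
  also have "\<dots> = ((cross3 b c \<bullet> x) / (cross3 a b \<bullet> c)) *\<^sub>R a + ((cross3 c a \<bullet> x) / (cross3 a b \<bullet> c)) *\<^sub>R b
    + ((cross3 a b \<bullet> x) / (cross3 a b \<bullet> c)) *\<^sub>R c"
    by (subst cramer_cross3) (simp add: scaleR_add_right)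
  finally show ?thesis .
qed

text \<open>Points strictly between an interior point and a frontier point of a convex set are
  interior, so the nearer of two frontier points on a ray would be interior.\<close>

lemma ray_frontier_unique:
  fixes H :: "'a::euclidean_space set"
  assumes H: "convex H" "closed H" and u: "u \<in> interior H" and x: "x \<in> frontier H" and y: "y \<in> frontier H"
    and k: "0 \<le> k" "y - u = k *\<^sub>R (x - u)"
  shows "x = y"
proof -
  have below: False if "p \<in> frontier H" "q \<in> frontier H" "0 \<le> t" "t < 1" "q - u = t *\<^sub>R (p - u)" for p q t
  proof (cases "t = 0")
    case True
    then show ?thesis using that u by (simp add: frontier_def)
  next
    case False
    have "p \<noteq> u" using that u by (auto simp: frontier_def)
    moreover have "q = (1 - t) *\<^sub>R u + t *\<^sub>R p" using that(5) by (simp add: algebra_simps)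
    ultimately have "q \<in> open_segment u p"
      using that(3,4) False unfolding in_segment by (intro conjI exI[of _ t]) auto
    moreover have "p \<in> closure H" using that(1) by (simp add: frontier_def)
    ultimately have "q \<in> interior H" using in_interior_closure_convex_segment[OF H(1) u] by blast
    then show False using that(2) by (simp add: frontier_def)
  qed
  have "\<not> k < 1" using below[OF x y k(1) _ k(2)] by blast
  moreover have "\<not> 1 < k"
  proof
    assume "1 < k"
    then have "x - u = (1 / k) *\<^sub>R (y - u)" using k(2) by simp
    then show False using below[OF y x, of "1 / k"] \<open>1 < k\<close> by simp
  qed
  ultimately show ?thesis using k(2) by (metis add_diff_cancel_right' diff_add_cancel linorder_less_linear scaleR_one)
qed

lemma conic_hull_triangle:
  fixes u :: "'a::real_vector"
  assumes "0 \<le> \<alpha>" "0 \<le> \<beta>" "0 \<le> \<gamma>"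
  shows "\<alpha> *\<^sub>R (a - u) + \<beta> *\<^sub>R (b - u) + \<gamma> *\<^sub>R (c - u) \<in> conic hull ((\<lambda>x. x - u) ` (convex hull {a, b, c}))"
proof (cases "\<alpha> + \<beta> + \<gamma> = 0")
  case True
  then have "\<alpha> = 0" "\<beta> = 0" "\<gamma> = 0" using assms by linarith+
  moreover have "a \<in> convex hull {a, b, c}" by (simp add: hull_inc)
  ultimately show ?thesis
    unfolding conic_hull_explicit by (intro CollectI exI[of _ 0] exI[of _ "a - u"]) auto
next
  case False
  define s where "s = \<alpha> + \<beta> + \<gamma>"
  have s: "0 < s" using False assms by (simp add: s_def)
  define x where "x = (\<alpha> / s) *\<^sub>R a + (\<beta> / s) *\<^sub>R b + (\<gamma> / s) *\<^sub>R c"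
  have "\<alpha> / s + \<beta> / s + \<gamma> / s = 1" using s by (simp add: s_def flip: add_divide_distrib)
  then have "x \<in> convex hull {a, b, c}"
    using assms s unfolding convex_hull_3 x_def
    by (intro CollectI exI[of _ "\<alpha> / s"] exI[of _ "\<beta> / s"] exI[of _ "\<gamma> / s"]) simp
  moreover have "s *\<^sub>R (x - u) = \<alpha> *\<^sub>R (a - u) + \<beta> *\<^sub>R (b - u) + \<gamma> *\<^sub>R (c - u)"
    using s by (simp add: x_def scaleR_diff_right scaleR_add_right) (simp add: s_def algebra_simps)
  ultimately show ?thesis
    unfolding conic_hull_explicit using s by (intro CollectI exI[of _ s] exI[of _ "x - u"]) auto
qed

lemma conic_hull_triangleE:
  fixes u :: "'a::real_vector"
  assumes "x \<in> conic hull ((\<lambda>x. x - u) ` (convex hull {a, b, c}))"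
  obtains \<alpha> \<beta> \<gamma> where "0 \<le> \<alpha>" "0 \<le> \<beta>" "0 \<le> \<gamma>" "x = \<alpha> *\<^sub>R (a - u) + \<beta> *\<^sub>R (b - u) + \<gamma> *\<^sub>R (c - u)"
proof -
  obtain k y where k: "0 \<le> k" "y \<in> convex hull {a, b, c}" "x = k *\<^sub>R (y - u)"
    using assms unfolding conic_hull_explicit by auto
  obtain p q r where p: "0 \<le> p" "0 \<le> q" "0 \<le> r" "p + q + r = 1" "y = p *\<^sub>R a + q *\<^sub>R b + r *\<^sub>R c"
    using k(2) unfolding convex_hull_3 by auto
  have "u = (p + q + r) *\<^sub>R u" using p(4) by simp
  then have "y - u = p *\<^sub>R (a - u) + q *\<^sub>R (b - u) + r *\<^sub>R (c - u)"
    unfolding p(5) by (simp add: algebra_simps)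
  then have "x = (k * p) *\<^sub>R (a - u) + (k * q) *\<^sub>R (b - u) + (k * r) *\<^sub>R (c - u)"
    unfolding k(3) by (simp add: scaleR_add_right)
  then show thesis using that p k(1) by (metis mult_nonneg_nonneg)
qed

context closed_surface
begin

abbreviation "H \<equiv> convex hull (verts K)"

lemma polytope_H: "polytope H"
  unfolding polytope_def using finite_verts[OF complex] by blast

lemma closed_H: "closed H"
  by (simp add: polytope_H polytope_imp_closed)

lemma interior_H_nonempty: "interior H \<noteq> {}"
proof
  assume "interior H = {}"
  then obtain n k where n: "n \<noteq> 0" "H \<subseteq> {x. n \<bullet> x = k}"
    using empty_interior_subset_hyperplane[OF convex_convex_hull] by metis
  then have "n \<bullet> p = k" if "p \<in> verts K" for p using that by (auto dest: hull_inc)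
  then show False using verts_not_coplanar[OF n(1)] by blast
qed

lemma simplex_subset_H:
  assumes "s \<in> K" shows "s \<subseteq> H"
proof -
  obtain C where "\<not> affine_dependent C" "s = convex hull C" using simplex_in_complex[OF assms] by blast
  then show ?thesis using vertex_set_of_simplex assms by (simp add: hull_mono)
qed

lemma face_plane:
  assumes S: supported and t: "t \<in> faces K"
  obtains n b where "n \<noteq> 0" "t \<subseteq> {x. n \<bullet> x = b}" "H \<subseteq> {x. n \<bullet> x \<le> b}" "interior H \<subseteq> {x. n \<bullet> x < b}"
proof -
  obtain n b where n: "n \<noteq> 0" "t \<subseteq> {x. n \<bullet> x = b}" "\<forall>p\<in>verts K. n \<bullet> p \<le> b"
    using S t by (auto simp: supported_def)
  have H: "H \<subseteq> {x. n \<bullet> x \<le> b}" using n(3) by (intro hull_minimal convex_halfspace_le) auto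
  then have "interior H \<subseteq> interior {x. n \<bullet> x \<le> b}" by (rule interior_mono)
  then show thesis using that[OF n(1,2) H] n(1) by (simp add: interior_halfspace_le)
qed

lemma face_subset_frontier:
  assumes S: supported and t: "t \<in> faces K" shows "t \<subseteq> frontier H"
proof
  fix x assume x: "x \<in> t"
  obtain n b where "n \<noteq> 0" "t \<subseteq> {x. n \<bullet> x = b}" "H \<subseteq> {x. n \<bullet> x \<le> b}" "interior H \<subseteq> {x. n \<bullet> x < b}"
    using face_plane[OF assms] .
  then have "x \<notin> interior H" using x by auto
  moreover have "x \<in> closure H" using simplex_subset_H[of t] t x closure_subset by (auto simp: faces_def)
  ultimately show "x \<in> frontier H" by (simp add: frontier_def)
qed

lemma complex_subset_frontier:
  assumes S: supported shows "\<Union>K \<subseteq> frontier H"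
proof
  fix x assume "x \<in> \<Union>K"
  then obtain s where s: "s \<in> K" "x \<in> s" by blast
  then obtain t where "t \<in> faces K" "s \<subseteq> t"
    using closed_surface unfolding closed_simplicial_surface_def by blast
  then show "x \<in> frontier H" using face_subset_frontier[OF S] s by blast
qed

text \<open>A vanishing determinant puts \<open>u\<close> into the plane of the triangle. This plane
  supports \<open>H\<close>, so it contains no interior point.\<close>

lemma face_determinant:
  assumes S: supported and u: "u \<in> interior H" and t: "convex hull {a, b, c} \<in> faces K"
  shows "cross3 (a - u) (b - u) \<bullet> (c - u) \<noteq> 0"
proof
  assume 0: "cross3 (a - u) (b - u) \<bullet> (c - u) = 0"
  define N where "N = cross3 (b - a) (c - a)"
  have "N \<bullet> (a - u) = cross3 (a - u) (b - u) \<bullet> (c - u)"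
    by (simp add: N_def cross3_simps)
  then have N: "N \<bullet> (a - u) = 0" "N \<noteq> 0" using 0 triangle_cross[OF t] by (simp_all add: N_def)
  obtain n k where n: "n \<noteq> 0" "convex hull {a, b, c} \<subseteq> {x. n \<bullet> x = k}" "interior H \<subseteq> {x. n \<bullet> x < k}"
    using face_plane[OF S t] by metis
  have nk: "n \<bullet> a = k" "n \<bullet> b = k" "n \<bullet> c = k"
    using n(2) by (metis (mono_tags, lifting) hull_inc insertCI mem_Collect_eq subsetD)+
  have "n \<bullet> u < k" using n(3) u by blast
  then have pos: "n \<bullet> (a - u) \<noteq> 0" using nk by (simp add: inner_diff_right)
  have "cross3 N n = 0" unfolding N_def cross3_cross3
    using nk by (simp add: inner_commute[of _ n] inner_diff_right)
  then have "(N \<bullet> (a - u)) *\<^sub>R n - (n \<bullet> (a - u)) *\<^sub>R N = 0"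
    using cross3_cross3[of N n "a - u"] by simp
  then show False using N pos by simp
qed

text \<open>If \<open>c\<close> and \<open>d\<close> were on the same side of the plane through
  \<open>u\<close>, \<open>a\<close>, \<open>b\<close>, the cones over both triangles would contain
  a direction close to \<open>(a - u) + (b - u)\<close> off that plane. Its ray meets the frontier
  only once, hence in a common point of the triangles; but this lies on the edge, so in the
  plane.\<close>

lemma adjacent_faces_opposite:
  assumes S: supported and u: "u \<in> interior H"
    and c: "convex hull {a, b, c} \<in> faces K" and d: "convex hull {a, b, d} \<in> faces K" and cd: "c \<noteq> d"
  shows "(cross3 (a - u) (b - u) \<bullet> (c - u)) * (cross3 (a - u) (b - u) \<bullet> (d - u)) < 0"
proof (rule ccontr)
  define A B C D where "A = a - u" and "B = b - u" and "C = c - u" and "D = d - u"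
  assume "\<not> ?thesis"
  moreover have nz: "cross3 A B \<bullet> C \<noteq> 0" "cross3 A B \<bullet> D \<noteq> 0"
    using face_determinant[OF S u c] face_determinant[OF S u d] by (simp_all add: A_def B_def C_def D_def)
  ultimately have pos: "0 < (cross3 A B \<bullet> C) * (cross3 A B \<bullet> D)"
    by (simp add: A_def B_def C_def D_def not_less less_le)
  define \<rho> where "\<rho> = (cross3 A B \<bullet> C) / (cross3 A B \<bullet> D)"
  have \<rho>: "0 < \<rho>" using pos by (simp add: \<rho>_def zero_less_divide_iff zero_less_mult_iff)
  obtain \<gamma>1 \<gamma>2 where C: "C = \<gamma>1 *\<^sub>R A + \<gamma>2 *\<^sub>R B + \<rho> *\<^sub>R D"
    using cross3_coordinates[OF nz(2), of C] unfolding \<rho>_def by blast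
  \<comment> \<open>So small that the coefficients of \<open>A\<close> and \<open>B\<close> in
    \<open>x2\<close> remain nonnegative.\<close>
  define \<eta> where "\<eta> = 1 / (1 + \<bar>\<gamma>1\<bar> + \<bar>\<gamma>2\<bar>)"
  have \<eta>: "0 < \<eta>" by (simp add: \<eta>_def add_pos_nonneg)
  have small: "0 \<le> 1 + \<eta> * g" if "\<bar>g\<bar> \<le> 1 + \<bar>\<gamma>1\<bar> + \<bar>\<gamma>2\<bar>" for g
  proof -
    have "\<eta> * \<bar>g\<bar> \<le> \<eta> * (1 + \<bar>\<gamma>1\<bar> + \<bar>\<gamma>2\<bar>)" using that \<eta> by (intro mult_left_mono) auto
    also have "\<dots> = 1"
    proof -
      have "1 + \<bar>\<gamma>1\<bar> + \<bar>\<gamma>2\<bar> \<noteq> 0" by linarith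
      then show ?thesis by (simp add: \<eta>_def)
    qed
    finally have "\<bar>\<eta> * g\<bar> \<le> 1" using \<eta> by (simp add: abs_mult)
    then show ?thesis by linarith
  qed
  define x where "x = 1 *\<^sub>R A + 1 *\<^sub>R B + \<eta> *\<^sub>R C"
  have x2: "x = (1 + \<eta> * \<gamma>1) *\<^sub>R A + (1 + \<eta> * \<gamma>2) *\<^sub>R B + (\<eta> * \<rho>) *\<^sub>R D"
    unfolding x_def by (subst C) (simp add: algebra_simps)
  have D0: "cross3 A B \<bullet> A = 0" "cross3 A B \<bullet> B = 0" by (simp_all add: dot_cross_self)
  have Dx: "cross3 A B \<bullet> x \<noteq> 0" using nz \<eta> by (simp add: x_def inner_add_right D0)
  have "x \<in> conic hull ((\<lambda>x. x - u) ` (convex hull {a, b, c}))"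
    using \<eta> unfolding x_def A_def B_def C_def by (intro conic_hull_triangle) auto
  then obtain k1 y1 where y1: "0 \<le> k1" "y1 \<in> convex hull {a, b, c}" "x = k1 *\<^sub>R (y1 - u)"
    unfolding conic_hull_explicit by auto
  have "x \<in> conic hull ((\<lambda>x. x - u) ` (convex hull {a, b, d}))"
    using \<eta> \<rho> unfolding x2 A_def B_def D_def by (intro conic_hull_triangle small) auto
  then obtain k2 y2 where y2: "0 \<le> k2" "y2 \<in> convex hull {a, b, d}" "x = k2 *\<^sub>R (y2 - u)"
    unfolding conic_hull_explicit by auto
  have "k2 \<noteq> 0" using Dx y2(3) by auto
  then have ey: "y2 - u = (k1 / k2) *\<^sub>R (y1 - u)"
  proof -
    have "(1 / k2) *\<^sub>R (k2 *\<^sub>R (y2 - u)) = (1 / k2) *\<^sub>R (k1 *\<^sub>R (y1 - u))" using y1(3) y2(3) by simp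
    then show ?thesis using \<open>k2 \<noteq> 0\<close> by simp
  qed
  have ef: "y1 \<in> frontier H" "y2 \<in> frontier H"
    using face_subset_frontier[OF S c] face_subset_frontier[OF S d] y1(2) y2(2) by auto
  have "0 \<le> k1 / k2" using y1(1) y2(1) by simp
  then have "y1 = y2"
    using ray_frontier_unique[OF convex_convex_hull closed_H u ef _ ey] by blast
  moreover have "convex hull {a, b, c} \<inter> convex hull {a, b, d} = convex hull ({a, b, c} \<inter> {a, b, d})"
    using triangleD[OF c] triangleD[OF d] by (intro hull_Int) auto
  moreover have "{a, b, c} \<inter> {a, b, d} = {a, b}"
    using cd triangleD[OF c] triangleD[OF d] by auto
  ultimately have "y1 \<in> convex hull {a, b}" using y1(2) y2(2) by auto
  then obtain s where "y1 = (1 - s) *\<^sub>R a + s *\<^sub>R b"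
    by (auto simp: segment_convex_hull[symmetric] closed_segment_def)
  then have "y1 - u = (1 - s) *\<^sub>R A + s *\<^sub>R B" by (simp add: A_def B_def algebra_simps)
  then have "cross3 A B \<bullet> x = 0" unfolding y1(3) by (simp add: inner_add_right D0)
  then show False using Dx by simp
qed

section \<open>Cones over the faces seen from an interior point\<close>

definition face_cones :: "real^3 \<Rightarrow> (real^3) set"
  where "face_cones u = (\<Union>t\<in>faces K. conic hull ((\<lambda>x. x - u) ` t))"

lemma face_cones_triangle:
  "convex hull {a, b, c} \<in> faces K \<Longrightarrow> 0 \<le> \<alpha> \<Longrightarrow> 0 \<le> \<beta> \<Longrightarrow> 0 \<le> \<gamma> \<Longrightarrow>
    \<alpha> *\<^sub>R (a - u) + \<beta> *\<^sub>R (b - u) + \<gamma> *\<^sub>R (c - u) \<in> face_cones u"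
  unfolding face_cones_def by (rule UN_I) (auto intro: conic_hull_triangle)

lemma face_cones_interior_face:
  assumes S: supported and u: "u \<in> interior H" and t: "convex hull {a, b, c} \<in> faces K"
    and pos: "0 < \<alpha>" "0 < \<beta>" "0 < \<gamma>"
  shows "\<alpha> *\<^sub>R (a - u) + \<beta> *\<^sub>R (b - u) + \<gamma> *\<^sub>R (c - u) \<in> interior (face_cones u)"
proof -
  define A B C where "A = a - u" and "B = b - u" and "C = c - u"
  define \<Delta> where "\<Delta> = cross3 A B \<bullet> C"
  have nz: "\<Delta> \<noteq> 0" using face_determinant[OF S u t] by (simp add: \<Delta>_def A_def B_def C_def)
  have cyc: "cross3 B C \<bullet> A = \<Delta>" "cross3 C A \<bullet> B = \<Delta>"
    unfolding \<Delta>_def by (metis cross3_cycle)+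
  define U where "U = {y. 0 < cross3 B C \<bullet> y / \<Delta> \<and> 0 < cross3 C A \<bullet> y / \<Delta> \<and> 0 < cross3 A B \<bullet> y / \<Delta>}"
  have "open U"
    unfolding U_def using nz by (intro open_Collect_conj open_Collect_less continuous_intros) auto
  moreover have "U \<subseteq> face_cones u"
  proof
    fix y assume y: "y \<in> U"
    show "y \<in> face_cones u"
      using y cross3_coordinates[of A B C y] nz face_cones_triangle[OF t, of "cross3 B C \<bullet> y / \<Delta>" "cross3 C A \<bullet> y / \<Delta>" "cross3 A B \<bullet> y / \<Delta>" u]
      by (simp add: U_def \<Delta>_def A_def B_def C_def)
  qed
  moreover have "\<alpha> *\<^sub>R A + \<beta> *\<^sub>R B + \<gamma> *\<^sub>R C \<in> U"
    using pos nz by (simp add: U_def inner_add_right cyc dot_cross_self flip: \<Delta>_def)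
  ultimately show ?thesis unfolding A_def B_def C_def by (meson interiorI)
qed

text \<open>Near the direction of an inner edge point the coordinates along \<open>a\<close> and
  \<open>b\<close> stay positive for both adjacent triangles. As \<open>c\<close> and
  \<open>d\<close> are on opposite sides, the third coordinate is nonnegative for at least one of
  them.\<close>

lemma face_cones_interior_edge:
  assumes S: supported and u: "u \<in> interior H" and t: "convex hull {a, b, c} \<in> faces K"
    and pos: "0 < \<alpha>" "0 < \<beta>"
  shows "\<alpha> *\<^sub>R (a - u) + \<beta> *\<^sub>R (b - u) \<in> interior (face_cones u)"
proof -
  have "(b, c) \<in> link a" using t by (simp add: link_def)
  then obtain d where d: "(b, d) \<in> link a" "d \<noteq> c"
    using link_two[OF linkD(2)] by (metis Image_singleton_iff insert_iff)
  then have td: "convex hull {a, b, d} \<in> faces K" by (simp add: link_def)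
  define A B C D where "A = a - u" and "B = b - u" and "C = c - u" and "D = d - u"
  have opp: "(cross3 A B \<bullet> C) * (cross3 A B \<bullet> D) < 0"
    using adjacent_faces_opposite[OF S u t td d(2)[symmetric]] by (simp add: A_def B_def C_def D_def)
  then have nz: "cross3 A B \<bullet> C \<noteq> 0" "cross3 A B \<bullet> D \<noteq> 0" by auto
  define V where "V E = {y. 0 < cross3 B E \<bullet> y / (cross3 A B \<bullet> E) \<and> 0 < cross3 E A \<bullet> y / (cross3 A B \<bullet> E)}" for E
  have op: "open (V E)" if "cross3 A B \<bullet> E \<noteq> 0" for E
    unfolding V_def using that by (intro open_Collect_conj open_Collect_less continuous_intros) auto
  have mem: "\<alpha> *\<^sub>R A + \<beta> *\<^sub>R B \<in> V E" if "cross3 A B \<bullet> E \<noteq> 0" for E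
  proof -
    have "cross3 B E \<bullet> A = cross3 A B \<bullet> E" "cross3 E A \<bullet> B = cross3 A B \<bullet> E"
      by (metis cross3_cycle)+
    then show ?thesis using that pos by (simp add: V_def inner_add_right dot_cross_self)
  qed
  have cone: "y \<in> face_cones u"
    if "convex hull {a, b, e} \<in> faces K" "y \<in> V (e - u)" "cross3 A B \<bullet> (e - u) \<noteq> 0"
      "0 \<le> cross3 A B \<bullet> y / (cross3 A B \<bullet> (e - u))" for y e
    using that cross3_coordinates[OF that(3), of y]
      face_cones_triangle[OF that(1), of "cross3 B (e - u) \<bullet> y / (cross3 A B \<bullet> (e - u))"
        "cross3 (e - u) A \<bullet> y / (cross3 A B \<bullet> (e - u))" "cross3 A B \<bullet> y / (cross3 A B \<bullet> (e - u))" u]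
    by (simp add: V_def A_def B_def)
  have "V C \<inter> V D \<subseteq> face_cones u"
  proof
    fix y assume y: "y \<in> V C \<inter> V D"
    have "0 \<le> cross3 A B \<bullet> y / (cross3 A B \<bullet> C) \<or> 0 \<le> cross3 A B \<bullet> y / (cross3 A B \<bullet> D)"
      using opp by (auto simp: zero_le_divide_iff mult_less_0_iff)
    then show "y \<in> face_cones u"
      using cone[OF t, of y] cone[OF td, of y] y nz by (auto simp: C_def D_def)
  qed
  then show ?thesis
    using op[OF nz(1)] op[OF nz(2)] mem[OF nz(1)] mem[OF nz(2)]
    unfolding A_def B_def by (meson IntI interiorI open_Int)
qed

text \<open>Off the rays through the vertices at least two coordinates are positive, which leaves
  only inner points of faces and of edges. Excluding these rays avoids an analysis of whole vertex
  stars.\<close>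

lemma face_cones_interior:
  assumes S: supported and u: "u \<in> interior H" and x: "x \<in> face_cones u"
    and ray: "\<And>w k. w \<in> verts K \<Longrightarrow> x \<noteq> k *\<^sub>R (w - u)"
  shows "x \<in> interior (face_cones u)"
proof -
  obtain t where t: "t \<in> faces K" "x \<in> conic hull ((\<lambda>x. x - u) ` t)"
    using x by (auto simp: face_cones_def)
  obtain C where C: "card C = 3" "t = convex hull C" "\<not> affine_dependent C" using face_hull[OF t(1)] by metis
  then obtain a b c where abc: "C = {a, b, c}" by (metis card_3_iff)
  have V: "a \<in> verts K" "b \<in> verts K" "c \<in> verts K"
    using vertex_set_of_simplex[of C] C t(1) abc by (auto simp: faces_def)
  have f: "convex hull {a, b, c} \<in> faces K" "convex hull {b, c, a} \<in> faces K" "convex hull {c, a, b} \<in> faces K"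
    using t(1) C(2) abc by (simp_all add: insert_commute)
  obtain \<alpha> \<beta> \<gamma> where n: "0 \<le> \<alpha>" "0 \<le> \<beta>" "0 \<le> \<gamma>"
    and xe: "x = \<alpha> *\<^sub>R (a - u) + \<beta> *\<^sub>R (b - u) + \<gamma> *\<^sub>R (c - u)"
    using t(2) C(2) abc conic_hull_triangleE by metis
  have two: "\<not> (\<alpha> = 0 \<and> \<beta> = 0)" "\<not> (\<beta> = 0 \<and> \<gamma> = 0)" "\<not> (\<alpha> = 0 \<and> \<gamma> = 0)"
    using ray[OF V(1), of \<alpha>] ray[OF V(2), of \<beta>] ray[OF V(3), of \<gamma>] xe by auto
  consider "\<gamma> = 0" | "\<alpha> = 0" | "\<beta> = 0" | "\<alpha> \<noteq> 0" "\<beta> \<noteq> 0" "\<gamma> \<noteq> 0" by blast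
  then show ?thesis
  proof cases
    case 1
    then show ?thesis using face_cones_interior_edge[OF S u f(1), of \<alpha> \<beta>] two n xe by auto
  next
    case 2
    then show ?thesis using face_cones_interior_edge[OF S u f(2), of \<beta> \<gamma>] two n xe by auto
  next
    case 3
    then show ?thesis using face_cones_interior_edge[OF S u f(3), of \<gamma> \<alpha>] two n xe by (auto simp: add.commute)
  next
    case 4
    then show ?thesis using face_cones_interior_face[OF S u f(1), of \<alpha> \<beta> \<gamma>] n xe by auto
  qed
qed

lemma closed_face_cones:
  assumes S: supported and u: "u \<in> interior H"
  shows "closed (face_cones u)"
proof -
  have "finite (faces K)" using finite_complex by (simp add: faces_def)
  moreover have "closed (conic hull ((\<lambda>x. x - u) ` t))" if t: "t \<in> faces K" for t
  proof (rule closed_conic_hull, rule disjI2, rule conjI)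
    have "compact t" using t compact_simplex by (auto simp: faces_def)
    then show "compact ((\<lambda>x. x - u) ` t)"
      by (intro compact_continuous_image continuous_intros)
    have "u \<notin> t" using face_subset_frontier[OF S t] u by (auto simp: frontier_def)
    then show "0 \<notin> (\<lambda>x. x - u) ` t" by auto
  qed
  ultimately show ?thesis unfolding face_cones_def by (intro closed_UN) auto
qed

text \<open>A generic segment avoids the rays through the vertices, so it cannot leave the union of the
  cones over the faces.\<close>

lemma face_cones_UNIV:
  assumes S: supported and u: "u \<in> interior H"
  shows "face_cones u = UNIV"
proof (rule ccontr)
  assume "face_cones u \<noteq> UNIV"
  then obtain q where q: "q \<notin> face_cones u" by blast
  \<comment> \<open>\<open>n\<close> is normal to a plane through the origin that contains
    \<open>q\<close> and the ray through \<open>w\<close>. A segment to \<open>q\<close> from a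
    point \<open>p\<close> off all these planes can meet a vertex ray only at
    \<open>q\<close>.\<close>
  have "\<exists>n. n \<noteq> 0 \<and> n \<bullet> q = 0 \<and> n \<bullet> (w - u) = 0" for w
  proof (cases "cross3 q (w - u) = 0")
    case False
    then show ?thesis by (intro exI[of _ "cross3 q (w - u)"]) (simp add: dot_cross_self)
  next
    case True
    obtain n where n: "n \<noteq> 0" "orthogonal q n" using orthogonal_to_vector_exists[of q] by auto
    show ?thesis
    proof (cases "q = 0")
      case True
      obtain n' where "n' \<noteq> 0" "orthogonal (w - u) n'" using orthogonal_to_vector_exists[of "w - u"] by auto
      then show ?thesis using True by (auto simp: orthogonal_def inner_commute)
    next
      case False
      have "(q \<bullet> q) *\<^sub>R (w - u) - ((w - u) \<bullet> q) *\<^sub>R q = 0"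
        using True cross3_cross3[of q "w - u" q] by simp
      then have "n \<bullet> ((q \<bullet> q) *\<^sub>R (w - u) - ((w - u) \<bullet> q) *\<^sub>R q) = 0" by simp
      then have "n \<bullet> (w - u) = 0" using n False by (simp add: inner_diff_right[of n "_ *\<^sub>R _"] orthogonal_def inner_commute)
      then show ?thesis using n by (auto simp: orthogonal_def inner_commute)
    qed
  qed
  then obtain n where n: "\<And>w. n w \<noteq> 0" "\<And>w. n w \<bullet> q = 0" "\<And>w. n w \<bullet> (w - u) = 0" by metis
  obtain v where v: "v \<in> verts K" using verts_nonempty by blast
  obtain x where "x \<in> nbrs v" using nbrs_nonempty[OF v] by blast
  then obtain y where "(x, y) \<in> link v" using link_two by blast
  then have t: "convex hull {v, x, y} \<in> faces K" by (simp add: link_def)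
  have ne: "interior (face_cones u) \<noteq> {}"
    using face_cones_interior_face[OF S u t, of 1 1 1] by auto
  have "negligible (\<Union>w\<in>verts K. {x. n w \<bullet> x = 0})"
    using finite_verts[OF complex] n(1) by (intro negligible_Union) (auto intro!: negligible_hyperplane)
  then have "\<not> interior (face_cones u) \<subseteq> (\<Union>w\<in>verts K. {x. n w \<bullet> x = 0})"
    using open_not_negligible[OF open_interior ne] negligible_subset by blast
  then obtain p where p: "p \<in> interior (face_cones u)" "\<And>w. w \<in> verts K \<Longrightarrow> n w \<bullet> p \<noteq> 0" by blast
  have int: "x \<in> interior (face_cones u)" if x: "x \<in> closed_segment p q" "x \<in> face_cones u" for x
  proof (rule face_cones_interior[OF S u x(2)])
    fix w k assume w: "w \<in> verts K"
    obtain s where s: "x = (1 - s) *\<^sub>R p + s *\<^sub>R q" using x(1) by (auto simp: closed_segment_def)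
    show "x \<noteq> k *\<^sub>R (w - u)"
    proof
      assume "x = k *\<^sub>R (w - u)"
      then have "n w \<bullet> x = 0" using n(3)[of w] by simp
      then have "(1 - s) * (n w \<bullet> p) = 0" using n(2)[of w] by (simp add: s inner_add_right)
      then have "s = 1" using p(2)[OF w] by simp
      then show False using s x(2) q by simp
    qed
  qed
  have "closed_segment p q \<subseteq> interior (face_cones u) \<union> - face_cones u" using int by blast
  moreover have "interior (face_cones u) \<inter> - face_cones u \<inter> closed_segment p q = {}"
    using interior_subset by blast
  moreover have "open (- face_cones u)" using closed_face_cones[OF S u] by (simp add: open_Compl)
  moreover have "connected (closed_segment p q)" by simp
  ultimately have "interior (face_cones u) \<inter> closed_segment p q = {} \<or> - face_cones u \<inter> closed_segment p q = {}"
    by (intro connectedD) auto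
  then show False using p(1) q by (metis ComplI IntI emptyE ends_in_segment)
qed

lemma frontier_subset_complex:
  assumes S: supported shows "frontier H \<subseteq> \<Union>K"
proof
  fix z assume z: "z \<in> frontier H"
  obtain u where u: "u \<in> interior H" using interior_H_nonempty by blast
  then have "z - u \<in> face_cones u" using face_cones_UNIV[OF S] by simp
  then obtain t k x where t: "t \<in> faces K" "x \<in> t" "0 \<le> k" "z - u = k *\<^sub>R (x - u)"
    unfolding face_cones_def conic_hull_explicit by blast
  have "x \<in> frontier H" using face_subset_frontier[OF S t(1)] t(2) by blast
  then have "x = z"
    by (rule ray_frontier_unique[OF convex_convex_hull closed_H u _ z t(3,4)])
  then show "z \<in> \<Union>K" using t by (auto simp: faces_def)
qed

section \<open>Convex boundaries and Delaunay triangulations\<close>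

lemma supported_imp_convex_polyhedral_surface: "supported \<Longrightarrow> convex_polyhedral_surface K"
  unfolding convex_polyhedral_surface_def
  using polytope_H interior_H_nonempty complex_subset_frontier frontier_subset_complex by blast

lemma supported_imp_inscribed: "supported \<Longrightarrow> inscribed_in_sphere K"
  by (auto simp: supported_def inscribed_in_sphere_def)

text \<open>A hyperplane supporting \<open>P\<close> at a relative interior point of a triangle cuts
  \<open>P\<close> in a face of \<open>P\<close>, and a face that contains such a point contains the
  whole triangle.\<close>

lemma convex_inscribed_imp_supported:
  assumes "convex_polyhedral_surface K" "inscribed_in_sphere K"
  shows supported
proof -
  obtain P where P: "polytope P" "interior P \<noteq> {}" "\<Union>K = frontier P"
    using assms(1) by (auto simp: convex_polyhedral_surface_def)
  have cP: "convex P" "closed P" using P(1) by (simp_all add: polytope_imp_convex polytope_imp_closed)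
  have KP: "\<Union>K \<subseteq> P" using P(3) cP(2) frontier_subset_closed by metis
  have "\<exists>a b. a \<noteq> 0 \<and> t \<subseteq> {x. a \<bullet> x = b} \<and> (\<forall>p\<in>verts K. a \<bullet> p \<le> b)" if t: "t \<in> faces K" for t
  proof -
    have tP: "t \<subseteq> P" "t \<subseteq> frontier P" using KP P(3) t by (auto simp: faces_def)
    have "convex t" using t convex_simplex by (auto simp: faces_def)
    moreover have "t \<noteq> {}" using t by (auto simp: faces_def)
    ultimately obtain x where x: "x \<in> rel_interior t" using rel_interior_eq_empty by blast
    then have xt: "x \<in> t" using rel_interior_subset by blast
    have xP: "x \<in> P" using tP(1) xt by blast
    have "x \<notin> rel_interior P" using tP(2) xt P(2) by (auto simp: rel_interior_nonempty_interior frontier_def)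
    then obtain a where a: "a \<noteq> 0" "\<And>y. y \<in> P \<Longrightarrow> a \<bullet> x \<le> a \<bullet> y"
      using supporting_hyperplane_rel_boundary[OF cP(1) xP] by metis
    have face: "(P \<inter> {y. a \<bullet> y = a \<bullet> x}) face_of P"
      using a(2) by (intro face_of_Int_supporting_hyperplane_ge cP(1)) auto
    have "t \<subseteq> P \<inter> {y. a \<bullet> y = a \<bullet> x}"
      by (rule subset_of_face_of[OF face tP(1)]) (use x xP in blast)
    moreover have "(- a) \<bullet> p \<le> - (a \<bullet> x)" if "p \<in> verts K" for p
      using a(2)[of p] KP that by (auto simp: verts_def)
    ultimately show ?thesis using a(1) by (intro exI[of _ "- a"] exI[of _ "- (a \<bullet> x)"]) auto
  qed
  then show ?thesis using assms(2) unfolding supported_def inscribed_in_sphere_def by blast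
qed

lemma supported_imp_homeomorphic_sphere:
  fixes c :: "real^3"
  assumes S: supported and r: "0 < r"
  shows "\<Union>K homeomorphic sphere c r"
proof -
  have "aff_dim H = aff_dim (cball c r)"
    using interior_H_nonempty r by (simp add: aff_dim_nonempty_interior del: aff_dim_convex_hull)
  then have "rel_frontier H homeomorphic rel_frontier (cball c r)"
    using polytope_imp_bounded[OF polytope_H]
    by (intro homeomorphic_rel_frontiers_convex_bounded_sets) auto
  moreover have "rel_frontier H = frontier H" "rel_frontier (cball c r) = frontier (cball c r)"
    using interior_H_nonempty r by (simp_all add: rel_frontier_nonempty_interior)
  moreover have "\<Union>K = frontier H"
    using complex_subset_frontier[OF S] frontier_subset_complex[OF S] by blast
  ultimately show ?thesis using r by simp
qed

text \<open>Since all vertices lie on the sphere, an empty open cap means that no vertex lies beyond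
  the plane of the triangle. The topological sphere comes from the boundary of the convex body
  \<open>H\<close>.\<close>

lemma supported_iff_delaunay: "supported \<longleftrightarrow> delaunay_triangulation_of_sphere K"
proof
  assume S: supported
  then obtain c r where cr: "0 < r" "verts K \<subseteq> sphere c r" by (auto simp: supported_def)
  have "\<exists>a b. a \<noteq> 0 \<and> t \<subseteq> {x. a \<bullet> x = b} \<and> verts K \<inter> {x \<in> sphere c r. b < a \<bullet> x} = {}"
    if "t \<in> faces K" for t
  proof -
    obtain a b where "a \<noteq> 0" "t \<subseteq> {x. a \<bullet> x = b}" "\<forall>p\<in>verts K. a \<bullet> p \<le> b"
      using S \<open>t \<in> faces K\<close> by (auto simp: supported_def)
    then show ?thesis by (intro exI[of _ a] exI[of _ b]) (auto simp: not_less)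
  qed
  then show "delaunay_triangulation_of_sphere K"
    using cr supported_imp_homeomorphic_sphere[OF S cr(1)] unfolding delaunay_triangulation_of_sphere_def by blast
next
  assume "delaunay_triangulation_of_sphere K"
  then obtain c r where cr: "0 < r" "verts K \<subseteq> sphere c r"
    and f: "\<forall>t\<in>faces K. \<exists>a b. a \<noteq> 0 \<and> t \<subseteq> {x. a \<bullet> x = b} \<and> verts K \<inter> {x \<in> sphere c r. b < a \<bullet> x} = {}"
    unfolding delaunay_triangulation_of_sphere_def by blast
  have "\<exists>a b. a \<noteq> 0 \<and> t \<subseteq> {x. a \<bullet> x = b} \<and> (\<forall>p\<in>verts K. a \<bullet> p \<le> b)" if "t \<in> faces K" for t
  proof -
    obtain a b where ab: "a \<noteq> 0" "t \<subseteq> {x. a \<bullet> x = b}" "verts K \<inter> {x \<in> sphere c r. b < a \<bullet> x} = {}"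
      using f \<open>t \<in> faces K\<close> by blast
    have "a \<bullet> p \<le> b" if "p \<in> verts K" for p
      using ab(3) cr(2) that by (metis (mono_tags, lifting) IntI emptyE mem_Collect_eq not_le subsetD)
    then show ?thesis using ab by blast
  qed
  then show supported using cr unfolding supported_def by blast
qed

end

theorem theorem2p5:
  fixes K :: "(real^3) set set"
  assumes "closed_simplicial_surface K"
  shows "0 \<le> willmore K \<and>
    (willmore K = 0 \<longleftrightarrow> convex_polyhedral_surface K \<and> inscribed_in_sphere K) \<and>
    (convex_polyhedral_surface K \<and> inscribed_in_sphere K \<longleftrightarrow> delaunay_triangulation_of_sphere K)"
proof -
  interpret closed_surface K by (rule closed_surface.intro[OF assms])
  have "willmore K = 0 \<longleftrightarrow> supported"
    using willmore_eq_0_imp_supported supported_imp_willmore_eq_0 by blast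
  moreover have "supported \<longleftrightarrow> convex_polyhedral_surface K \<and> inscribed_in_sphere K"
    using supported_imp_convex_polyhedral_surface supported_imp_inscribed convex_inscribed_imp_supported by blast
  ultimately show ?thesis using willmore_nonneg supported_iff_delaunay by blast
qed

end
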